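(* Let $n\ge 2$, let $\Omega\subset\mathbb R^n$ be a bounded convex domain with $C^2$ boundary, and let $q\in C^2(\overline\Omega)$ satisfy $q(x)\ge c_0>0$ for a constant $c_0$. Fix $b>R_\Omega:=\sup_{x\in\overline\Omega}|x|$. For $e\in\mathbb S^{n-1}$ set $\ell_{e,b}(x)=e\cdot x+b$, and for $t>0$ let $u_{t,e,b}^q\in C(\overline\Omega)$ be the unique viscosity solution of $$-\Delta_\infty u_{t,e,b}^q+q(x)u_{t,e,b}^q=0\ \text{ in }\Omega,\qquad u_{t,e,b}^q=t\,\ell_{e,b}\ \text{ on }\partial\Omega,$$ so that $\Lambda_q(t\ell_{e,b}|_{\partial\Omega})=\partial_\nu u_{t,e,b}^q$ on $\partial\Omega$. Let $\Gamma_e=\{x\in\partial\Omega: e\cdot\nu(x)\neq 0\}$. (1) For every $x\in\Gamma_e$ the limit $$H_q(e,b;x)=\lim_{t\to\infty}t\left[\Lambda_q\bigl(t\ell_{e,b}|_{\partial\Omega}\bigr)(x)-t\,e\cdot\nu(x)\right]$$ exists, locally uniformly on $\Gamma_e$. (2) For each $y\in Y_e$, let $w_{q,e,b}(y,\cdot)$ be the unique solution of $$\partial_s^2w_{q,e,b}(y,s)=q(y+se)(s+b)\ \text{ for }\alpha_e(y)<s<\beta_e(y),\qquad w_{q,e,b}(y,s)=0\ \text{ for } s=\alpha_e(y)\text{ and } s=\beta_e(y),$$ and regard $w_{q,e,b}$ as a function of $x=y+se$. Then $w_{q,e,b}$ is of class $C^2$ on every closed chord tube whose transverse base is compactly contained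 in $Y_e$. In particular, it is $C^2$ up to every point of $\Gamma_e$, and $$H_q(e,b;x)=\partial_\nu w_{q,e,b}(x),\qquad x\in\Gamma_e.$$ (3) For every compact set $K\Subset\Gamma_e$ there are constants $C_K>0$ and $t_K>0$ such that $$\sup_{x\in K}\bigl|\Lambda_q\bigl(t\ell_{e,b}|_{\partial\Omega}\bigr)(x)-t\,e\cdot\nu(x)-t^{-1}\partial_\nu w_{q,e,b}(x)\bigr|\le C_Kt^{-3}\qquad\text{for } t\ge t_K.$$
   Context: The infinity Laplacian is $\Delta_\infty u=\langle D^2u\,Du,Du\rangle=\sum_{i,j}u_{x_i}u_{x_j}u_{x_ix_j}$. Set $F_q(x,r,p,X)=-p^TXp+q(x)r$. A function $u\in C(\Omega)$ is a viscosity subsolution (resp. supersolution) of $-\Delta_\infty u+qu=0$ in $\Omega$ if, whenever $\phi\in C^2(\Omega)$ and $u-\phi$ has a local maximum (resp. minimum) at $x_0\in\Omega$, one has $F_q(x_0,u(x_0),D\phi(x_0),D^2\phi(x_0))\le 0$ (resp. $\ge 0$); a viscosity solution is both. Boundary values are attained pointwise by a function in $C(\overline\Omega)$. For $f\in C(\partial\Omega)$ the Dirichlet problem has a unique viscosity solution $u_f^q\in C(\overline\Omega)$. A function $u\in C(\overline\Omega)$ is differentiable at $x_0\in\partial\Omega$ if there is a vector $Du(x_0)\in\mathbb R^n$ with $u(x)=u(x_0)+Du(x_0)\cdot(x-x_0)+o(|x-x_0|)$ as $x\to x_0$ within $\overline\Omega$. For $f\in C^1(\partial\Omega)$ the solution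 $u_f^q$ is differentiable at every boundary point, and the Dirichlet-to-Neumann map is $\Lambda_q(f)(x)=\partial_\nu u_f^q(x)=Du_f^q(x)\cdot\nu(x)$, $x\in\partial\Omega$, where $\nu$ is the outward unit normal. For $e\in\mathbb S^{n-1}$, $P_e=\mathrm{Id}-e\otimes e$ is the orthogonal projection onto $e^\perp$ and $Y_e=P_e\Omega\subset e^\perp$. For $y\in Y_e$, $\alpha_e(y)<\beta_e(y)$ are the numbers with $\Omega\cap(y+\mathbb Re)=\{y+se:\alpha_e(y)<s<\beta_e(y)\}$. A closed chord tube with transverse base $B\Subset Y_e$ is $\{y+se: y\in\overline B,\ \alpha_e(y)\le s\le\beta_e(y)\}$. At boundary points derivatives of $w_{q,e,b}$ are those of its $C^2$ extension up to the boundary. *)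

theory Defs
  imports "HOL-Analysis.Analysis"
begin

(* The ambient space R^n is an arbitrary type of class euclidean_space; DIM('a) = n. *)

(* C2_with S f g H: f is of class C^2 on S with gradient g and Hessian H.  On an open S these are
   the classical derivatives.  On a set that is closed (closure of a convex domain, chord tube) the
   derivatives at the points not interior to S are taken within S, so they are the continuous
   extensions of the interior derivatives: this is "C^2 up to the boundary". *)
definition C2_with ::
  "'a::euclidean_space set \<Rightarrow> ('a \<Rightarrow> real) \<Rightarrow> ('a \<Rightarrow> 'a) \<Rightarrow> ('a \<Rightarrow> 'a \<Rightarrow>\<^sub>L 'a) \<Rightarrow> bool"
  where "C2_with S f g H \<longleftrightarrow>
    (\<forall>x\<in>S. (f has_derivative (\<lambda>h. g x \<bullet> h)) (at x within S)) \<and>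
    (\<forall>x\<in>S. (g has_derivative blinfun_apply (H x)) (at x within S)) \<and>
    continuous_on S H"

definition C2_on :: "'a::euclidean_space set \<Rightarrow> ('a \<Rightarrow> real) \<Rightarrow> bool"
  where "C2_on S f \<longleftrightarrow> (\<exists>g H. C2_with S f g H)"

definition C1_on :: "'a::euclidean_space set \<Rightarrow> ('a \<Rightarrow> real) \<Rightarrow> bool"
  where "C1_on S f \<longleftrightarrow>
    (\<exists>g. (\<forall>x\<in>S. (f has_derivative (\<lambda>h. g x \<bullet> h)) (at x within S)) \<and> continuous_on S g)"

(* f belongs to C^1 of the boundary of \<Omega>: it is the restriction of a C^1 function
   defined near the boundary. *)
definition C1_frontier :: "'a::euclidean_space set \<Rightarrow> ('a \<Rightarrow> real) \<Rightarrow> bool"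
  where "C1_frontier \<Omega> f \<longleftrightarrow>
    (\<exists>U F. open U \<and> frontier \<Omega> \<subseteq> U \<and> C1_on U F \<and> (\<forall>x\<in>frontier \<Omega>. F x = f x))"

definition C2_defining_function ::
  "'a::euclidean_space set \<Rightarrow> 'a \<Rightarrow> 'a set \<Rightarrow> ('a \<Rightarrow> real) \<Rightarrow> ('a \<Rightarrow> 'a) \<Rightarrow> bool"
  where "C2_defining_function \<Omega> x U \<rho> g \<longleftrightarrow>
    open U \<and> x \<in> U \<and> (\<exists>H. C2_with U \<rho> g H) \<and> (\<forall>z\<in>U. g z \<noteq> 0) \<and>
    \<Omega> \<inter> U = {z \<in> U. \<rho> z < 0} \<and> frontier \<Omega> \<inter> U = {z \<in> U. \<rho> z = 0}"

definition C2_boundary :: "'a::euclidean_space set \<Rightarrow> bool"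
  where "C2_boundary \<Omega> \<longleftrightarrow> (\<forall>x\<in>frontier \<Omega>. \<exists>U \<rho> g. C2_defining_function \<Omega> x U \<rho> g)"

(* The normalized gradient does not depend on the choice of the local defining function. *)
definition outward_normal :: "'a::euclidean_space set \<Rightarrow> 'a \<Rightarrow> 'a"
  where "outward_normal \<Omega> x =
    (THE v. \<exists>U \<rho> g. C2_defining_function \<Omega> x U \<rho> g \<and> v = g x /\<^sub>R norm (g x))"

definition F_op ::
  "('a::euclidean_space \<Rightarrow> real) \<Rightarrow> 'a \<Rightarrow> real \<Rightarrow> 'a \<Rightarrow> ('a \<Rightarrow>\<^sub>L 'a) \<Rightarrow> real"
  where "F_op q x r p X = - (p \<bullet> blinfun_apply X p) + q x * r"

definition viscosity_subsolution ::
  "'a::euclidean_space set \<Rightarrow> ('a \<Rightarrow> real) \<Rightarrow> ('a \<Rightarrow> real) \<Rightarrow> bool"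
  where "viscosity_subsolution \<Omega> q u \<longleftrightarrow> continuous_on \<Omega> u \<and>
    (\<forall>\<phi> g H x0. C2_with \<Omega> \<phi> g H \<and> x0 \<in> \<Omega> \<and>
       (\<exists>r>0. \<forall>x\<in>\<Omega> \<inter> ball x0 r. u x - \<phi> x \<le> u x0 - \<phi> x0) \<longrightarrow>
       F_op q x0 (u x0) (g x0) (H x0) \<le> 0)"

definition viscosity_supersolution ::
  "'a::euclidean_space set \<Rightarrow> ('a \<Rightarrow> real) \<Rightarrow> ('a \<Rightarrow> real) \<Rightarrow> bool"
  where "viscosity_supersolution \<Omega> q u \<longleftrightarrow> continuous_on \<Omega> u \<and>
    (\<forall>\<phi> g H x0. C2_with \<Omega> \<phi> g H \<and> x0 \<in> \<Omega> \<and>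
       (\<exists>r>0. \<forall>x\<in>\<Omega> \<inter> ball x0 r. u x - \<phi> x \<ge> u x0 - \<phi> x0) \<longrightarrow>
       F_op q x0 (u x0) (g x0) (H x0) \<ge> 0)"

definition dirichlet_solution ::
  "'a::euclidean_space set \<Rightarrow> ('a \<Rightarrow> real) \<Rightarrow> ('a \<Rightarrow> real) \<Rightarrow> ('a \<Rightarrow> real) \<Rightarrow> bool"
  where "dirichlet_solution \<Omega> q f u \<longleftrightarrow> continuous_on (closure \<Omega>) u \<and>
    viscosity_subsolution \<Omega> q u \<and> viscosity_supersolution \<Omega> q u \<and>
    (\<forall>x\<in>frontier \<Omega>. u x = f x)"

(* u(z) = u(x) + D . (z - x) + o(|z - x|) as z tends to x within the closure of \<Omega> *)
definition has_boundary_gradient ::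
  "'a::euclidean_space set \<Rightarrow> ('a \<Rightarrow> real) \<Rightarrow> 'a \<Rightarrow> 'a \<Rightarrow> bool"
  where "has_boundary_gradient \<Omega> u x D \<longleftrightarrow>
    (u has_derivative (\<lambda>h. D \<bullet> h)) (at x within closure \<Omega>)"

definition boundary_gradient :: "'a::euclidean_space set \<Rightarrow> ('a \<Rightarrow> real) \<Rightarrow> 'a \<Rightarrow> 'a"
  where "boundary_gradient \<Omega> u x = (THE D. has_boundary_gradient \<Omega> u x D)"

definition normal_derivative :: "'a::euclidean_space set \<Rightarrow> ('a \<Rightarrow> real) \<Rightarrow> 'a \<Rightarrow> real"
  where "normal_derivative \<Omega> u x = boundary_gradient \<Omega> u x \<bullet> outward_normal \<Omega> x"

(* \<Lambda> is the Dirichlet-to-Neumann map of the equation with potential q on \<Omega>.  It is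
   a relation and not a THE-operator so that unique solvability of the Dirichlet problem
   need not be established before speaking of the map. *)
definition dirichlet_to_neumann ::
  "'a::euclidean_space set \<Rightarrow> ('a \<Rightarrow> real) \<Rightarrow> (('a \<Rightarrow> real) \<Rightarrow> 'a \<Rightarrow> real) \<Rightarrow> bool"
  where "dirichlet_to_neumann \<Omega> q \<Lambda> \<longleftrightarrow>
    (\<forall>f u. C1_frontier \<Omega> f \<and> dirichlet_solution \<Omega> q f u \<longrightarrow>
       (\<forall>x\<in>frontier \<Omega>. \<Lambda> f x = normal_derivative \<Omega> u x))"

definition ell :: "'a::euclidean_space \<Rightarrow> real \<Rightarrow> 'a \<Rightarrow> real"
  where "ell e b x = e \<bullet> x + b"

definition Gamma :: "'a::euclidean_space set \<Rightarrow> 'a \<Rightarrow> 'a set"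
  where "Gamma \<Omega> e = {x \<in> frontier \<Omega>. e \<bullet> outward_normal \<Omega> x \<noteq> 0}"

definition proj_perp :: "'a::euclidean_space \<Rightarrow> 'a \<Rightarrow> 'a"
  where "proj_perp e x = x - (e \<bullet> x) *\<^sub>R e"

definition Y_set :: "'a::euclidean_space set \<Rightarrow> 'a \<Rightarrow> 'a set"
  where "Y_set \<Omega> e = proj_perp e ` \<Omega>"

definition alpha :: "'a::euclidean_space set \<Rightarrow> 'a \<Rightarrow> 'a \<Rightarrow> real"
  where "alpha \<Omega> e y = (THE a. \<exists>b>a. {s. y + s *\<^sub>R e \<in> \<Omega>} = {a<..<b})"

definition beta :: "'a::euclidean_space set \<Rightarrow> 'a \<Rightarrow> 'a \<Rightarrow> real"
  where "beta \<Omega> e y = (THE b. \<exists>a<b. {s. y + s *\<^sub>R e \<in> \<Omega>} = {a<..<b})"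

definition chord_tube :: "'a::euclidean_space set \<Rightarrow> 'a \<Rightarrow> 'a set \<Rightarrow> 'a set"
  where "chord_tube \<Omega> e B =
    {y + s *\<^sub>R e | y s. y \<in> closure B \<and> alpha \<Omega> e y \<le> s \<and> s \<le> beta \<Omega> e y}"

definition chord_bvp ::
  "'a::euclidean_space set \<Rightarrow> ('a \<Rightarrow> real) \<Rightarrow> 'a \<Rightarrow> real \<Rightarrow> 'a \<Rightarrow> (real \<Rightarrow> real) \<Rightarrow> bool"
  where "chord_bvp \<Omega> q e b y v \<longleftrightarrow>
    continuous_on {alpha \<Omega> e y..beta \<Omega> e y} v \<and>
    (\<exists>v'. \<forall>s\<in>{alpha \<Omega> e y<..<beta \<Omega> e y}.
       (v has_real_derivative v' s) (at s) \<and>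
       (v' has_real_derivative q (y + s *\<^sub>R e) * (s + b)) (at s)) \<and>
    v (alpha \<Omega> e y) = 0 \<and> v (beta \<Omega> e y) = 0"

(* The value 0 off the closed chord only serves to make the solution unique as a total function. *)
definition chord_solution ::
  "'a::euclidean_space set \<Rightarrow> ('a \<Rightarrow> real) \<Rightarrow> 'a \<Rightarrow> real \<Rightarrow> 'a \<Rightarrow> real \<Rightarrow> real"
  where "chord_solution \<Omega> q e b y =
    (THE v. chord_bvp \<Omega> q e b y v \<and> (\<forall>s. s \<notin> {alpha \<Omega> e y..beta \<Omega> e y} \<longrightarrow> v s = 0))"

(* w(y, s) as a function of x = y + s e, with y orthogonal to the unit vector e *)
definition w_fun ::
  "'a::euclidean_space set \<Rightarrow> ('a \<Rightarrow> real) \<Rightarrow> 'a \<Rightarrow> real \<Rightarrow> 'a \<Rightarrow> real"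
  where "w_fun \<Omega> q e b x = chord_solution \<Omega> q e b (proj_perp e x) (e \<bullet> x)"

end

theory Submission
  imports Defs
begin

text \<open>
  The formal expansion. Put \<open>u = t \<ell> + w / t\<close> with \<open>\<ell>(x) = e \<bullet> x + b\<close>. The gradient is
  \<open>t e + Dw / t\<close> and the Hessian \<open>D\<^sup>2w / t\<close>, so the infinity Laplacian is \<open>t w\<^sub>s\<^sub>s + O(1 / t)\<close>, where
  \<open>s\<close> is the coordinate along \<open>e\<close>, and the zeroth order term is \<open>t q \<ell> + O(1 / t)\<close>. The terms of
  order \<open>t\<close> cancel exactly when \<open>w\<^sub>s\<^sub>s = q \<ell>\<close>, which is the two-point problem on the chords parallel
  to \<open>e\<close>; a residual of order \<open>1 / t\<close> is left, and it can be absorbed by a correction of order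
  \<open>t\<^sup>-\<^sup>3\<close> whose second \<open>s\<close>-derivative is a large constant.

  The expansion becomes a proof through explicit barriers. Near a chord over \<open>y\<^sub>0\<close>, with projection
  \<open>P\<close> onto the orthogonal complement of \<open>e\<close>, they are
  \<open>t \<ell> + (w \<plusminus> \<kappa> |P x - y\<^sub>0|\<^sup>2 \<plusminus> A t\<^sup>-\<^sup>2 \<zeta>) / t\<close>, where \<open>\<zeta>\<close> is the concave parabola that vanishes at both
  ends of every chord. The transverse paraboloid dominates the error on the lateral sides of a tube
  around the chord. It costs nothing at leading order, because its Hessian annihilates \<open>e\<close>: in
  \<open>\<langle>D\<^sup>2v Dv, Dv\<rangle>\<close> the large part \<open>t e\<close> of the gradient is killed. And it vanishes on the central
  chord, so there it leaves only the error \<open>A t\<^sup>-\<^sup>3 \<zeta>\<close> (\<open>chord_barriers\<close>). The lateral sides need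
  \<open>u - t \<ell> = O(1 / t)\<close> as an a priori bound; two global barriers supply it (\<open>u_below_plane\<close>,
  \<open>u_above_plane\<close>).

  All barriers are \<open>C\<^sup>2\<close> and strict, so that comparison with a viscosity solution is the definition
  itself, applied at an extremum of the difference (\<open>viscosity_comparison_above\<close>).

  At a point of \<open>\<Gamma>\<close> the functions \<open>u - t \<ell>\<close>, \<open>w\<close> and \<open>\<zeta>\<close> vanish along the boundary, so each of
  their gradients is a multiple of the normal (\<open>gradient_normal\<close>). One derivative along the
  transversal direction \<open>e\<close> therefore determines the normal derivative, and the two-sided bound on the
  chord gives the expansion with error \<open>O(t\<^sup>-\<^sup>3)\<close> (\<open>normal_derivative_expansion\<close>).

  What remains is regularity. In a convex domain no chord through an interior point is tangent to
  the boundary, so the end points of the chords are \<open>C\<^sup>2\<close> functions over the whole projection of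
  the domain, by an implicit function argument. The solution \<open>w\<close> is a combination of integrals of
  \<open>q \<ell>\<close> over segments whose ends depend on \<open>x\<close> in a \<open>C\<^sup>2\<close> way, and it is differentiated under the
  integral sign.
\<close>

section \<open>Functions of class C1 and C2 on arbitrary sets\<close>

definition C1_with ::
  "'a::euclidean_space set \<Rightarrow> ('a \<Rightarrow> real) \<Rightarrow> ('a \<Rightarrow> 'a) \<Rightarrow> bool"
  where "C1_with S f g \<longleftrightarrow>
    (\<forall>x\<in>S. (f has_derivative (\<lambda>h. g x \<bullet> h)) (at x within S)) \<and> continuous_on S g"

lemma C1_on_iff_with: "C1_on S f \<longleftrightarrow> (\<exists>g. C1_with S f g)"
  by (simp add: C1_on_def C1_with_def)

lemma C1_withI:
  assumes "\<And>x. x \<in> S \<Longrightarrow> (f has_derivative (\<lambda>h. g x \<bullet> h)) (at x within S)"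
    and "continuous_on S g"
  shows "C1_with S f g"
  using assms by (simp add: C1_with_def)

lemma C1_with_deriv: "C1_with S f g \<Longrightarrow> x \<in> S \<Longrightarrow> (f has_derivative (\<lambda>h. g x \<bullet> h)) (at x within S)"
  by (simp add: C1_with_def)

lemma C1_with_deriv_at:
  "C1_with S f g \<Longrightarrow> open S \<Longrightarrow> x \<in> S \<Longrightarrow> (f has_derivative (\<lambda>h. g x \<bullet> h)) (at x)"
  using C1_with_deriv at_within_open by metis

lemma C1_with_gradient_continuous: "C1_with S f g \<Longrightarrow> continuous_on S g"
  by (simp add: C1_with_def)

lemma C1_with_continuous: "C1_with S f g \<Longrightarrow> continuous_on S f"
  unfolding C1_with_def using has_derivative_continuous_on[of S f "\<lambda>x. (\<bullet>) (g x)"] by simp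

lemma C1_on_continuous: "C1_on S f \<Longrightarrow> continuous_on S f"
  using C1_on_iff_with C1_with_continuous by blast

lemma C1_with_subset: "C1_with S f g \<Longrightarrow> T \<subseteq> S \<Longrightarrow> C1_with T f g"
  unfolding C1_with_def
  by (auto intro: has_derivative_subset continuous_on_subset)

lemma C1_on_subset: "C1_on S f \<Longrightarrow> T \<subseteq> S \<Longrightarrow> C1_on T f"
  using C1_on_iff_with C1_with_subset by blast

lemma C1_with_cong:
  assumes "C1_with S f g" "\<And>x. x \<in> S \<Longrightarrow> f x = f' x" "\<And>x. x \<in> S \<Longrightarrow> g x = g' x"
  shows "C1_with S f' g'"
proof (rule C1_withI)
  fix x assume x: "x \<in> S"
  show "(f' has_derivative (\<lambda>h. g' x \<bullet> h)) (at x within S)"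
    by (rule has_derivative_transform[OF x])
      (use assms x C1_with_deriv[OF assms(1) x] in auto)
next
  show "continuous_on S g'"
    using continuous_on_cong[of S S g g'] C1_with_gradient_continuous[OF assms(1)] assms(3) by simp
qed

lemma C1_on_cong:
  assumes "C1_on S f" "\<And>x. x \<in> S \<Longrightarrow> f x = f' x"
  shows "C1_on S f'"
  using assms C1_with_cong unfolding C1_on_iff_with by blast

lemma C1_with_const: "C1_with S (\<lambda>x. c) (\<lambda>x. 0)"
  by (rule C1_withI) auto

lemma C1_with_inner: "C1_with S (\<lambda>x. v \<bullet> x) (\<lambda>x. v)"
  by (rule C1_withI) (auto intro!: derivative_eq_intros)

lemma C1_with_add:
  "C1_with S f1 g1 \<Longrightarrow> C1_with S f2 g2 \<Longrightarrow> C1_with S (\<lambda>x. f1 x + f2 x) (\<lambda>x. g1 x + g2 x)"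
  unfolding C1_with_def
  by (auto intro!: derivative_eq_intros continuous_intros simp: inner_add_left)

lemma C1_with_mult:
  assumes "C1_with S f1 g1" "C1_with S f2 g2"
  shows "C1_with S (\<lambda>x. f1 x * f2 x) (\<lambda>x. f1 x *\<^sub>R g2 x + f2 x *\<^sub>R g1 x)"
  using assms C1_with_continuous[OF assms(1)] C1_with_continuous[OF assms(2)] unfolding C1_with_def
  by (auto intro!: derivative_eq_intros continuous_intros simp: inner_add_left algebra_simps)

lemma C1_with_inverse:
  assumes "C1_with S f g" "\<And>x. x \<in> S \<Longrightarrow> f x \<noteq> 0"
  shows "C1_with S (\<lambda>x. inverse (f x)) (\<lambda>x. - (inverse (f x))\<^sup>2 *\<^sub>R g x)"
  using assms C1_with_continuous[OF assms(1)] unfolding C1_with_def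
  by (auto intro!: derivative_eq_intros continuous_intros simp: power2_eq_square)

lemma C1_on_const: "C1_on S (\<lambda>x. c)"
  using C1_with_const C1_on_iff_with by blast

lemma C1_on_inner: "C1_on S (\<lambda>x. v \<bullet> x)"
  using C1_with_inner C1_on_iff_with by blast

lemma C1_on_add: "C1_on S f1 \<Longrightarrow> C1_on S f2 \<Longrightarrow> C1_on S (\<lambda>x. f1 x + f2 x)"
  using C1_with_add unfolding C1_on_iff_with by blast

lemma C1_on_mult: "C1_on S f1 \<Longrightarrow> C1_on S f2 \<Longrightarrow> C1_on S (\<lambda>x. f1 x * f2 x)"
  using C1_with_mult unfolding C1_on_iff_with by blast

lemma C1_on_inverse: "C1_on S f \<Longrightarrow> (\<And>x. x \<in> S \<Longrightarrow> f x \<noteq> 0) \<Longrightarrow> C1_on S (\<lambda>x. inverse (f x))"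
  using C1_with_inverse unfolding C1_on_iff_with by blast

lemma C1_with_shear:
  assumes f: "C1_with S f g" and c: "C1_with T c k"
    and ST: "\<And>x. x \<in> T \<Longrightarrow> x + c x *\<^sub>R e \<in> S"
  shows "C1_with T (\<lambda>x. f (x + c x *\<^sub>R e))
           (\<lambda>x. g (x + c x *\<^sub>R e) + (g (x + c x *\<^sub>R e) \<bullet> e) *\<^sub>R k x)"
proof (rule C1_withI)
  have cT: "continuous_on T (\<lambda>x. x + c x *\<^sub>R e)"
    by (intro continuous_intros C1_with_continuous[OF c])
  have gT: "continuous_on T (\<lambda>x. g (x + c x *\<^sub>R e))"
    by (rule continuous_on_compose2[OF C1_with_gradient_continuous[OF f] cT]) (use ST in auto)
  show "continuous_on T (\<lambda>x. g (x + c x *\<^sub>R e) + (g (x + c x *\<^sub>R e) \<bullet> e) *\<^sub>R k x)"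
    by (intro continuous_intros gT C1_with_gradient_continuous[OF c])
  fix x assume x: "x \<in> T"
  let ?p = "x + c x *\<^sub>R e"
  have 1: "((\<lambda>x. x + c x *\<^sub>R e) has_derivative (\<lambda>h. h + (k x \<bullet> h) *\<^sub>R e)) (at x within T)"
    using C1_with_deriv[OF c x] by (auto intro!: derivative_eq_intros)
  have 2: "(f has_derivative (\<lambda>h. g ?p \<bullet> h)) (at ?p within (\<lambda>x. x + c x *\<^sub>R e) ` T)"
    by (rule has_derivative_subset[OF C1_with_deriv[OF f ST[OF x]]]) (use ST in auto)
  show "((\<lambda>x. f (x + c x *\<^sub>R e)) has_derivative
      (\<lambda>h. (g ?p + (g ?p \<bullet> e) *\<^sub>R k x) \<bullet> h)) (at x within T)"
    using diff_chain_within[OF 1 2]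
    by (simp add: o_def inner_add_left inner_add_right mult.commute)
qed

lemma C1_on_shear:
  assumes "C1_on S f" "C1_on T c" "\<And>x. x \<in> T \<Longrightarrow> x + c x *\<^sub>R e \<in> S"
  shows "C1_on T (\<lambda>x. f (x + c x *\<^sub>R e))"
  using assms C1_with_shear[of S f _ T c _ e] unfolding C1_on_iff_with by blast

text \<open>
  Differentiation under the integral sign along segments parallel to \<open>e\<close> whose ends move with \<open>x\<close>.
  The weight \<open>k\<close> makes the statement stable under differentiation: the components of the gradient are
  sums of products of integrals of the same form, with \<open>k\<close> or \<open>\<tau> k\<close> as weight, and of components of the
  gradients of \<open>c0\<close> and \<open>c1\<close>. Convexity of \<open>D\<close> replaces openness, so that \<open>D\<close> may contain
  boundary points.
\<close>

lemma C1_with_segment_integral: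
  fixes f :: "'a::euclidean_space \<Rightarrow> real" and k :: "real \<Rightarrow> real"
  assumes f: "C1_with S f g" and c0: "C1_with D c0 k0" and c1: "C1_with D c1 k1"
    and D: "convex D"
    and DS: "\<And>x \<tau>. x \<in> D \<Longrightarrow> \<tau> \<in> {0..1} \<Longrightarrow> x + (c0 x + \<tau> * c1 x) *\<^sub>R e \<in> S"
    and k: "continuous_on {0..1} k"
  shows "C1_with D (\<lambda>x. integral {0..1} (\<lambda>\<tau>. k \<tau> * f (x + (c0 x + \<tau> * c1 x) *\<^sub>R e)))
    (\<lambda>x. integral {0..1} (\<lambda>\<tau>. k \<tau> *\<^sub>R (g (x + (c0 x + \<tau> * c1 x) *\<^sub>R e)
        + (g (x + (c0 x + \<tau> * c1 x) *\<^sub>R e) \<bullet> e) *\<^sub>R (k0 x + \<tau> *\<^sub>R k1 x))))"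
    (is "C1_with D ?F (\<lambda>x. integral {0..1} (\<lambda>\<tau>. ?G x \<tau>))")
proof (rule C1_withI)
  let ?\<Phi> = "\<lambda>x \<tau>. x + (c0 x + \<tau> * c1 x) *\<^sub>R e"
  have c\<tau>: "C1_with D (\<lambda>x. c0 x + \<tau> * c1 x) (\<lambda>x. k0 x + \<tau> *\<^sub>R k1 x)" for \<tau>
    using C1_with_add[OF c0 C1_with_mult[OF C1_with_const c1]] by simp
  have fst_cont: "continuous_on (D \<times> {0..1::real}) (\<lambda>p. h (fst p))" if "continuous_on D h"
    for h :: "'a \<Rightarrow> 'b::topological_space"
    by (rule continuous_on_compose2[OF that continuous_on_fst[OF continuous_on_id]]) auto
  have \<Phi>_cont: "continuous_on (D \<times> {0..1::real}) (\<lambda>p. ?\<Phi> (fst p) (snd p))"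
    by (intro continuous_intros fst_cont[OF C1_with_continuous[OF c0]]
        fst_cont[OF C1_with_continuous[OF c1]])
  have g_cont: "continuous_on (D \<times> {0..1::real}) (\<lambda>p. g (?\<Phi> (fst p) (snd p)))"
    by (rule continuous_on_compose2[OF C1_with_gradient_continuous[OF f] \<Phi>_cont])
      (use DS in auto)
  have k_cont: "continuous_on (D \<times> {0..1::real}) (\<lambda>p. k (snd p))"
    by (rule continuous_on_compose2[OF k continuous_on_snd[OF continuous_on_id]]) auto
  have G_cont: "continuous_on (D \<times> {0..1::real}) (\<lambda>p. ?G (fst p) (snd p))"
    by (intro continuous_intros k_cont g_cont fst_cont[OF C1_with_gradient_continuous[OF c0]]
        fst_cont[OF C1_with_gradient_continuous[OF c1]])
  have Gx_cont: "continuous_on {0..1} (?G x)" if "x \<in> D" for x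
  proof -
    have "continuous_on {0..1} (\<lambda>\<tau>. (x, \<tau>::real))" by (intro continuous_intros)
    from continuous_on_compose2[OF G_cont this] that
    show ?thesis unfolding fst_conv snd_conv by blast
  qed
  show "continuous_on D (\<lambda>x. integral {0..1} (?G x))"
    using integral_continuous_on_param[of D 0 1 ?G] G_cont
    by (simp add: case_prod_unfold)
  fix x assume x: "x \<in> D"
  have "((\<lambda>x. integral (cbox 0 1) (\<lambda>\<tau>. k \<tau> * f (?\<Phi> x \<tau>))) has_derivative
       integral (cbox 0 1) (\<lambda>\<tau>. blinfun_inner_right (?G x \<tau>))) (at x within D)"
  proof (rule leibniz_rule[where f = "\<lambda>x \<tau>. k \<tau> * f (?\<Phi> x \<tau>)"
        and fx = "\<lambda>x \<tau>. blinfun_inner_right (?G x \<tau>)", OF _ _ _ x D])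
    fix y and \<tau> :: real assume y: "y \<in> D" and "\<tau> \<in> cbox 0 1"
    then have \<tau>: "\<tau> \<in> {0..1}" by simp
    have "((\<lambda>x. f (?\<Phi> x \<tau>)) has_derivative (\<lambda>h. (g (?\<Phi> y \<tau>)
        + (g (?\<Phi> y \<tau>) \<bullet> e) *\<^sub>R (k0 y + \<tau> *\<^sub>R k1 y)) \<bullet> h)) (at y within D)"
      by (rule C1_with_deriv[OF C1_with_shear[OF f c\<tau>] y]) (use DS \<tau> in blast)
    from has_derivative_mult_right[OF this, of "k \<tau>"]
    show "((\<lambda>x. k \<tau> * f (?\<Phi> x \<tau>)) has_derivative blinfun_apply (blinfun_inner_right (?G y \<tau>)))
        (at y within D)"
      by (rule has_derivative_eq_rhs) (simp add: fun_eq_iff)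
  next
    fix y assume y: "y \<in> D"
    have "continuous_on {0..1} (?\<Phi> y)" by (intro continuous_intros)
    then have "continuous_on {0..1} (\<lambda>\<tau>. f (?\<Phi> y \<tau>))"
      by (rule continuous_on_compose2[OF C1_with_continuous[OF f]]) (use DS y in auto)
    then show "(\<lambda>\<tau>. k \<tau> * f (?\<Phi> y \<tau>)) integrable_on cbox 0 1"
      by (intro integrable_continuous continuous_on_mult) (use k in auto)
  next
    show "continuous_on (D \<times> cbox 0 1) (\<lambda>(x, \<tau>). blinfun_inner_right (?G x \<tau>))"
      using bounded_linear.continuous_on[OF bounded_linear_blinfun_inner_right G_cont]
      by (simp add: case_prod_unfold)
  qed
  moreover have "integral {0..1} (\<lambda>\<tau>. blinfun_inner_right (?G x \<tau>))
      = blinfun_inner_right (integral {0..1} (?G x))"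
    using integral_linear[OF integrable_continuous_interval[OF Gx_cont[OF x]]
        bounded_linear_blinfun_inner_right] by (simp add: o_def)
  ultimately show "(?F has_derivative (\<lambda>h. integral {0..1} (?G x) \<bullet> h)) (at x within D)"
    unfolding cbox_interval by (simp only: blinfun_inner_right.rep_eq)
qed

lemma C1_on_segment_integral:
  fixes f :: "'a::euclidean_space \<Rightarrow> real" and k :: "real \<Rightarrow> real"
  assumes "C1_on S f" "C1_on D c0" "C1_on D c1" "convex D"
    and "\<And>x \<tau>. x \<in> D \<Longrightarrow> \<tau> \<in> {0..1} \<Longrightarrow> x + (c0 x + \<tau> * c1 x) *\<^sub>R e \<in> S"
    and "continuous_on {0..1} k"
  shows "C1_on D (\<lambda>x. integral {0..1} (\<lambda>\<tau>. k \<tau> * f (x + (c0 x + \<tau> * c1 x) *\<^sub>R e)))"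
proof -
  obtain g k0 k1 where "C1_with S f g" "C1_with D c0 k0" "C1_with D c1 k1"
    using assms(1-3) unfolding C1_on_iff_with by blast
  then show ?thesis
    unfolding C1_on_iff_with
    by (intro exI) (rule C1_with_segment_integral[OF _ _ _ assms(4) _ assms(6)], use assms(5) in auto)
qed

lemma gradient_unique:
  assumes "(f has_derivative (\<lambda>h. v \<bullet> h)) (at x)" "(f has_derivative (\<lambda>h. w \<bullet> h)) (at x)"
  shows "v = w"
proof -
  have "(\<lambda>h. v \<bullet> h) = (\<lambda>h. w \<bullet> h)" using assms by (rule has_derivative_unique)
  then have "v \<bullet> (v - w) = w \<bullet> (v - w)" by meson
  then have "(v - w) \<bullet> (v - w) = 0" by (simp add: inner_diff_left)
  then show ?thesis by simp
qed

text \<open>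
  On an open set the gradient at a point is unique, so local gradients agree and patch together. This
  is how the end points of chords, which are only described by local defining functions of the
  boundary, become globally \<open>C\<^sup>2\<close>.
\<close>

lemma C1_on_locally:
  assumes S: "open S" and loc: "\<And>x. x \<in> S \<Longrightarrow> \<exists>U. open U \<and> x \<in> U \<and> U \<subseteq> S \<and> C1_on U f"
  shows "C1_on S f"
proof -
  have "\<exists>v. (f has_derivative (\<lambda>h. v \<bullet> h)) (at x)" if "x \<in> S" for x
    using loc[OF that] C1_with_deriv_at unfolding C1_on_iff_with by blast
  then obtain g where g: "\<And>x. x \<in> S \<Longrightarrow> (f has_derivative (\<lambda>h. g x \<bullet> h)) (at x)" by metis
  have "continuous_on S g"
  proof (subst continuous_on_eq_continuous_at[OF S], rule ballI)
    fix x assume x: "x \<in> S"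
    obtain U k where U: "open U" "x \<in> U" "U \<subseteq> S" and k: "C1_with U f k"
      using loc[OF x] unfolding C1_on_iff_with by blast
    have "g z = k z" if "z \<in> U" for z
      by (rule gradient_unique[OF g C1_with_deriv_at[OF k U(1) that]]) (use U(3) that in auto)
    then have "continuous_on U g"
      using C1_with_gradient_continuous[OF k] continuous_on_cong[of U U g k] by simp
    then show "isCont g x" using U by (simp add: continuous_on_eq_continuous_at)
  qed
  moreover have "\<forall>x\<in>S. (f has_derivative (\<lambda>h. g x \<bullet> h)) (at x within S)"
    using g by (simp add: has_derivative_at_withinI)
  ultimately show ?thesis unfolding C1_on_def by blast
qed

text \<open>
  Reduces class \<open>C\<^sup>2\<close> to scalar \<open>C\<^sup>1\<close> functions, so that closure under sums, products and parameter
  integrals follows from the first order case, applied twice.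
\<close>

lemma C2_on_iff:
  "C2_on S f \<longleftrightarrow> (\<exists>g. C1_with S f g \<and> (\<forall>v. C1_on S (\<lambda>x. g x \<bullet> v)))"
proof
  assume "C2_on S f"
  then obtain g H where gH: "C2_with S f g H" unfolding C2_on_def by blast
  have g: "(g has_derivative blinfun_apply (H x)) (at x within S)" if "x \<in> S" for x
    using gH that by (simp add: C2_with_def)
  have "C1_with S f g"
    using gH has_derivative_continuous_on[OF g] by (simp add: C2_with_def C1_with_def)
  moreover have "C1_on S (\<lambda>x. g x \<bullet> v)" for v
  proof -
    have "C1_with S (\<lambda>x. g x \<bullet> v) (\<lambda>x. \<Sum>i\<in>Basis. (H x i \<bullet> v) *\<^sub>R i)"
    proof (rule C1_withI)
      have "continuous_on S H" using gH by (simp add: C2_with_def)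
      then show "continuous_on S (\<lambda>x. \<Sum>i\<in>Basis. (H x i \<bullet> v) *\<^sub>R i)"
        by (intro continuous_intros)
      fix x assume x: "x \<in> S"
      have "H x h \<bullet> v = (\<Sum>i\<in>Basis. (H x i \<bullet> v) *\<^sub>R i) \<bullet> h" for h
      proof -
        have "H x h = H x (\<Sum>i\<in>Basis. (h \<bullet> i) *\<^sub>R i)" by (simp add: euclidean_representation)
        also have "\<dots> \<bullet> v = (\<Sum>i\<in>Basis. (h \<bullet> i) * (H x i \<bullet> v))"
          by (simp add: blinfun.sum_right blinfun.scaleR_right inner_sum_left)
        finally show ?thesis
          by (simp add: inner_sum_right inner_commute[of _ h] mult.commute)
      qed
      then have "(\<lambda>h. H x h \<bullet> v) = (\<lambda>h. (\<Sum>i\<in>Basis. (H x i \<bullet> v) *\<^sub>R i) \<bullet> h)"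
        by blast
      with has_derivative_inner_left[OF g[OF x], of v]
      show "((\<lambda>x. g x \<bullet> v) has_derivative (\<lambda>h. (\<Sum>i\<in>Basis. (H x i \<bullet> v) *\<^sub>R i) \<bullet> h)) (at x within S)"
        by (rule has_derivative_eq_rhs)
    qed
    then show ?thesis using C1_on_iff_with by blast
  qed
  ultimately show "\<exists>g. C1_with S f g \<and> (\<forall>v. C1_on S (\<lambda>x. g x \<bullet> v))" by blast
next
  assume "\<exists>g. C1_with S f g \<and> (\<forall>v. C1_on S (\<lambda>x. g x \<bullet> v))"
  then obtain g where g: "C1_with S f g" "\<And>v. C1_on S (\<lambda>x. g x \<bullet> v)" by blast
  then obtain k where k: "\<And>v. C1_with S (\<lambda>x. g x \<bullet> v) (k v)"
    unfolding C1_on_iff_with by metis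
  define L where "L x h = (\<Sum>i\<in>Basis. (k i x \<bullet> h) *\<^sub>R i)" for x h
  have bl: "bounded_linear (L x)" for x
    unfolding L_def
    by (intro bounded_linear_sum bounded_linear_compose[OF bounded_linear_scaleR_left]
        bounded_linear_inner_right)
  define H where "H x = Blinfun (L x)" for x
  have H: "blinfun_apply (H x) = L x" for x
    unfolding H_def by (rule bounded_linear_Blinfun_apply[OF bl])
  have "C2_with S f g H"
    unfolding C2_with_def
  proof (intro conjI ballI)
    fix x assume x: "x \<in> S"
    show "(f has_derivative (\<lambda>h. g x \<bullet> h)) (at x within S)" using C1_with_deriv[OF g(1) x] .
    have "L x h \<bullet> i = k i x \<bullet> h" if "i \<in> Basis" for i h
      using that by (simp add: L_def inner_sum_left inner_Basis if_distrib cong: if_cong)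
    then show "(g has_derivative blinfun_apply (H x)) (at x within S)"
      unfolding H has_derivative_componentwise_within[of g]
      using C1_with_deriv[OF k x] by simp
  next
    show "continuous_on S H"
      by (rule continuous_on_blinfun_componentwise)
        (auto simp: H L_def intro!: continuous_intros C1_with_gradient_continuous[OF k])
  qed
  then show "C2_on S f" unfolding C2_on_def by blast
qed

lemma C2_on_imp_C1_on: "C2_on S f \<Longrightarrow> C1_on S f"
  unfolding C2_on_iff C1_on_iff_with by blast

lemma C2_on_subset: "C2_on S f \<Longrightarrow> T \<subseteq> S \<Longrightarrow> C2_on T f"
  unfolding C2_on_iff using C1_with_subset[of S f _ T] C1_on_subset[of S _ T] by blast

lemma C2_with_subset: "C2_with S f g H \<Longrightarrow> T \<subseteq> S \<Longrightarrow> C2_with T f g H"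
  unfolding C2_with_def
  by (auto intro: continuous_on_subset has_derivative_subset)

lemma C2_on_cong: "C2_on S f \<Longrightarrow> (\<And>x. x \<in> S \<Longrightarrow> f x = f' x) \<Longrightarrow> C2_on S f'"
  unfolding C2_on_iff using C1_with_cong[of S f _ f'] by blast

lemma C2_on_const: "C2_on S (\<lambda>x. c)"
  unfolding C2_on_iff
  by (intro exI[of _ "\<lambda>x. 0"] conjI allI C1_with_const) (simp add: C1_on_const)

lemma C2_on_inner: "C2_on S (\<lambda>x. v \<bullet> x)"
  unfolding C2_on_iff
  by (intro exI[of _ "\<lambda>x. v"] conjI allI C1_with_inner C1_on_const)

lemma C2_on_add:
  assumes "C2_on S f1" "C2_on S f2"
  shows "C2_on S (\<lambda>x. f1 x + f2 x)"
proof -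
  obtain g1 g2 where g1: "C1_with S f1 g1" "\<And>v. C1_on S (\<lambda>x. g1 x \<bullet> v)"
    and g2: "C1_with S f2 g2" "\<And>v. C1_on S (\<lambda>x. g2 x \<bullet> v)"
    using assms unfolding C2_on_iff by blast
  have "C1_on S (\<lambda>x. (g1 x + g2 x) \<bullet> v)" for v
    using C1_on_add[OF g1(2) g2(2)] by (simp add: inner_add_left)
  then show ?thesis unfolding C2_on_iff using C1_with_add[OF g1(1) g2(1)] by blast
qed

lemma C2_on_mult:
  assumes "C2_on S f1" "C2_on S f2"
  shows "C2_on S (\<lambda>x. f1 x * f2 x)"
proof -
  obtain g1 g2 where g1: "C1_with S f1 g1" "\<And>v. C1_on S (\<lambda>x. g1 x \<bullet> v)"
    and g2: "C1_with S f2 g2" "\<And>v. C1_on S (\<lambda>x. g2 x \<bullet> v)"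
    using assms unfolding C2_on_iff by blast
  have "C1_on S (\<lambda>x. (f1 x *\<^sub>R g2 x + f2 x *\<^sub>R g1 x) \<bullet> v)" for v
    using C1_on_add[OF C1_on_mult[OF C2_on_imp_C1_on[OF assms(1)] g2(2)]
        C1_on_mult[OF C2_on_imp_C1_on[OF assms(2)] g1(2)]] by (simp add: inner_add_left)
  then show ?thesis unfolding C2_on_iff using C1_with_mult[OF g1(1) g2(1)] by blast
qed

lemma C2_on_diff: "C2_on S f1 \<Longrightarrow> C2_on S f2 \<Longrightarrow> C2_on S (\<lambda>x. f1 x - f2 x)"
  using C2_on_add[of S f1 "\<lambda>x. - 1 * f2 x"] C2_on_mult[OF C2_on_const[of S "-1"]] by force

text \<open>
  Each component \<open>v\<close> of the gradient in \<open>C1_with_segment_integral\<close> is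
  \<open>I k v + (I k e) (\<nabla>c0 \<bullet> v) + (I (\<tau> k) e) (\<nabla>c1 \<bullet> v)\<close>, where \<open>I m v\<close> is the segment integral of the
  component \<open>v\<close> of the gradient of \<open>f\<close> with weight \<open>m\<close>; each factor is \<open>C\<^sup>1\<close>.
\<close>

lemma C2_on_segment_integral:
  fixes f :: "'a::euclidean_space \<Rightarrow> real" and k :: "real \<Rightarrow> real"
  assumes "C2_on S f" "C2_on D c0" "C2_on D c1" and D: "convex D"
    and DS: "\<And>x \<tau>. x \<in> D \<Longrightarrow> \<tau> \<in> {0..1} \<Longrightarrow> x + (c0 x + \<tau> * c1 x) *\<^sub>R e \<in> S"
    and k: "continuous_on {0..1} k"
  shows "C2_on D (\<lambda>x. integral {0..1} (\<lambda>\<tau>. k \<tau> * f (x + (c0 x + \<tau> * c1 x) *\<^sub>R e)))"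
proof -
  obtain g k0 k1 where f: "C1_with S f g" "\<And>v. C1_on S (\<lambda>x. g x \<bullet> v)"
    and c0: "C1_with D c0 k0" "\<And>v. C1_on D (\<lambda>x. k0 x \<bullet> v)"
    and c1: "C1_with D c1 k1" "\<And>v. C1_on D (\<lambda>x. k1 x \<bullet> v)"
    using assms(1-3) unfolding C2_on_iff by blast
  let ?\<Phi> = "\<lambda>x \<tau>. x + (c0 x + \<tau> * c1 x) *\<^sub>R e"
  let ?G = "\<lambda>x \<tau>. k \<tau> *\<^sub>R (g (?\<Phi> x \<tau>) + (g (?\<Phi> x \<tau>) \<bullet> e) *\<^sub>R (k0 x + \<tau> *\<^sub>R k1 x))"
  have kt: "continuous_on {0..1} (\<lambda>\<tau>. k \<tau> * \<tau>)" by (intro continuous_intros k)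
  define I where "I m v x = integral {0..1} (\<lambda>\<tau>. m \<tau> * (g (?\<Phi> x \<tau>) \<bullet> v))" for m :: "real \<Rightarrow> real" and v x
  have C1_I: "C1_on D (I m v)" if "continuous_on {0..1} m" for m v
    unfolding I_def using c0 c1
    by (intro C1_on_segment_integral[OF f(2) _ _ D _ that] DS)
      (auto simp: C1_on_iff_with)
  have cont_g: "continuous_on {0..1} (\<lambda>\<tau>. g (?\<Phi> x \<tau>))" if "x \<in> D" for x
    by (rule continuous_on_compose2[OF C1_with_gradient_continuous[OF f(1)]])
      (use DS that in \<open>auto intro!: continuous_intros\<close>)
  have "C1_on D (\<lambda>x. integral {0..1} (?G x) \<bullet> v)" for v
  proof (rule C1_on_cong)
    show "C1_on D (\<lambda>x. I k v x + I k e x * (k0 x \<bullet> v) + I (\<lambda>\<tau>. k \<tau> * \<tau>) e x * (k1 x \<bullet> v))"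
      by (intro C1_on_add C1_on_mult C1_I k kt c0 c1)
    fix x assume x: "x \<in> D"
    have int: "(\<lambda>\<tau>. m \<tau> * (g (?\<Phi> x \<tau>) \<bullet> v)) integrable_on {0..1}"
      if "continuous_on {0..1} m" for m :: "real \<Rightarrow> real" and v
      by (intro integrable_continuous_interval continuous_intros that cont_g x)
    have hi: "((\<lambda>\<tau>. m \<tau> * (g (?\<Phi> x \<tau>) \<bullet> v)) has_integral I m v x) {0..1}"
      if "continuous_on {0..1} m" for m v
      unfolding I_def using int[OF that] by (rule integrable_integral)
    have "((\<lambda>\<tau>. k \<tau> * (g (?\<Phi> x \<tau>) \<bullet> v) + (k \<tau> * (g (?\<Phi> x \<tau>) \<bullet> e)) * (k0 x \<bullet> v)
          + (k \<tau> * \<tau> * (g (?\<Phi> x \<tau>) \<bullet> e)) * (k1 x \<bullet> v)) has_integral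
        I k v x + I k e x * (k0 x \<bullet> v) + I (\<lambda>\<tau>. k \<tau> * \<tau>) e x * (k1 x \<bullet> v)) {0..1}"
      by (intro has_integral_add has_integral_mult_left hi k kt)
    moreover have "?G x integrable_on {0..1}"
      by (intro integrable_continuous_interval continuous_intros k cont_g x)
    then have "((\<lambda>\<tau>. ?G x \<tau> \<bullet> v) has_integral integral {0..1} (?G x) \<bullet> v) {0..1}"
      using has_integral_linear[OF integrable_integral bounded_linear_inner_left]
      by (fastforce simp: o_def)
    ultimately show "I k v x + I k e x * (k0 x \<bullet> v) + I (\<lambda>\<tau>. k \<tau> * \<tau>) e x * (k1 x \<bullet> v)
        = integral {0..1} (?G x) \<bullet> v"
      by (intro has_integral_unique[rotated]) (auto simp: inner_add_left algebra_simps)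
  qed
  moreover have "C1_with D (\<lambda>x. integral {0..1} (\<lambda>\<tau>. k \<tau> * f (?\<Phi> x \<tau>)))
      (\<lambda>x. integral {0..1} (?G x))"
    by (rule C1_with_segment_integral[OF f(1) c0(1) c1(1) D _ k]) (use DS in auto)
  ultimately show ?thesis unfolding C2_on_iff by blast
qed

lemma C2_on_locally:
  assumes S: "open S" and loc: "\<And>x. x \<in> S \<Longrightarrow> \<exists>U. open U \<and> x \<in> U \<and> U \<subseteq> S \<and> C2_on U f"
  shows "C2_on S f"
proof -
  have "C1_on S f" by (rule C1_on_locally[OF S]) (use loc C2_on_imp_C1_on in blast)
  then obtain g where g: "C1_with S f g" unfolding C1_on_iff_with by blast
  have "C1_on S (\<lambda>x. g x \<bullet> v)" for v
  proof (rule C1_on_locally[OF S])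
    fix x assume "x \<in> S"
    then obtain U k where U: "open U" "x \<in> U" "U \<subseteq> S"
      and k: "C1_with U f k" "C1_on U (\<lambda>x. k x \<bullet> v)"
      using loc unfolding C2_on_iff by metis
    have "k z = g z" if "z \<in> U" for z
      by (rule gradient_unique[OF C1_with_deriv_at[OF k(1) U(1) that] C1_with_deriv_at[OF g S]])
        (use U(3) that in auto)
    then have "C1_on U (\<lambda>x. g x \<bullet> v)" by (intro C1_on_cong[OF k(2)]) simp
    then show "\<exists>U. open U \<and> x \<in> U \<and> U \<subseteq> S \<and> C1_on U (\<lambda>x. g x \<bullet> v)"
      using U by blast
  qed
  then show ?thesis unfolding C2_on_iff using g by blast
qed

section \<open>The outward normal of a convex domain\<close>

lemma has_real_derivative_along_line:
  assumes "(f has_derivative (\<lambda>h. v \<bullet> h)) (at (x + s *\<^sub>R d))"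
  shows "((\<lambda>s. f (x + s *\<^sub>R d)) has_real_derivative v \<bullet> d) (at s)"
proof -
  have 1: "((\<lambda>s. x + s *\<^sub>R d) has_derivative (\<lambda>h. h *\<^sub>R d)) (at s)"
    by (auto intro!: derivative_eq_intros)
  show ?thesis
    using has_derivative_compose[OF 1 assms]
    by (simp add: has_field_derivative_def mult.commute[of _ "v \<bullet> d"])
qed

text \<open>
  How inequalities between functions reach their gradients at a boundary point: along a ray that
  enters the set, difference quotients keep their sign in the limit.
\<close>

lemma one_sided_derivative_nonpos:
  assumes \<phi>: "(\<phi> has_derivative (\<lambda>h. D \<bullet> h)) (at x within S)" and d0: "d0 > 0"
    and le: "\<And>t. 0 < t \<Longrightarrow> t < d0 \<Longrightarrow> x + t *\<^sub>R d \<in> S \<and> \<phi> (x + t *\<^sub>R d) \<le> \<phi> x"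
  shows "D \<bullet> d \<le> 0"
proof -
  let ?l = "\<lambda>t. x + t *\<^sub>R d" and ?I = "{0<..<d0}"
  have l: "(?l has_derivative (\<lambda>t. t *\<^sub>R d)) (at 0 within ?I)"
    by (auto intro!: derivative_eq_intros)
  have "(\<phi> has_derivative (\<lambda>h. D \<bullet> h)) (at x within ?l ` ?I)"
    by (rule has_derivative_subset[OF \<phi>]) (use le in auto)
  then have "(\<phi> has_derivative (\<lambda>h. D \<bullet> h)) (at (?l 0) within ?l ` ?I)" by simp
  from diff_chain_within[OF l this]
  have "((\<lambda>t. \<phi> (?l t)) has_real_derivative D \<bullet> d) (at 0 within ?I)"
    by (simp add: o_def has_field_derivative_def mult.commute[of _ "D \<bullet> d"])
  then have lim: "((\<lambda>t. (\<phi> (?l t) - \<phi> x) / t) \<longlongrightarrow> D \<bullet> d) (at 0 within ?I)"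
    by (simp add: has_field_derivative_iff)
  show ?thesis
  proof (rule tendsto_upperbound[OF lim])
    show "eventually (\<lambda>t. (\<phi> (?l t) - \<phi> x) / t \<le> 0) (at 0 within ?I)"
      using le by (auto simp: eventually_at_filter divide_nonpos_pos intro!: always_eventually)
    show "at 0 within ?I \<noteq> bot" using d0 by (simp add: at_within_eq_bot_iff)
  qed
qed

lemma segment_into_convex_open:
  fixes x p :: "'a::euclidean_space"
  assumes "open \<Omega>" "convex \<Omega>" "x \<in> closure \<Omega>" "p \<in> \<Omega>" "0 < t" "t < 1"
  shows "x + t *\<^sub>R (p - x) \<in> \<Omega>"
proof -
  have "x - t *\<^sub>R (x - p) \<in> interior \<Omega>"
    by (rule mem_interior_closure_convex_shrink) (use assms in \<open>auto simp: interior_open\<close>)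
  moreover have "x - t *\<^sub>R (x - p) = x + t *\<^sub>R (p - x)" by (simp add: algebra_simps)
  ultimately show ?thesis using assms(1) by (simp add: interior_open)
qed

lemma defining_function_deriv:
  assumes "C2_defining_function \<Omega> x U \<rho> g" "z \<in> U"
  shows "(\<rho> has_derivative (\<lambda>h. g z \<bullet> h)) (at z)"
  using assms at_within_open[of z U] unfolding C2_defining_function_def C2_with_def by auto

lemma defining_function_directional:
  assumes "C2_defining_function \<Omega> x U \<rho> g"
  shows "((\<lambda>t. \<rho> (x + t *\<^sub>R h)) has_real_derivative g x \<bullet> h) (at 0)"
  by (rule has_real_derivative_along_line, simp, rule defining_function_deriv[OF assms])
    (use assms in \<open>simp add: C2_defining_function_def\<close>)

lemma eventually_line_in_open:
  fixes x h :: "'a::real_normed_vector"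
  assumes "open U" "x \<in> U"
  obtains d where "d > 0" "\<And>t. \<bar>t\<bar> < d \<Longrightarrow> x + t *\<^sub>R h \<in> U"
proof -
  have "open ((\<lambda>t::real. x + t *\<^sub>R h) -` U)"
    by (intro open_vimage assms continuous_intros)
  moreover have "0 \<in> (\<lambda>t::real. x + t *\<^sub>R h) -` U" using assms by simp
  ultimately obtain d where "d > 0" "ball 0 d \<subseteq> (\<lambda>t::real. x + t *\<^sub>R h) -` U"
    using open_contains_ball by metis
  then show thesis by (intro that[of d]) (auto simp: subset_iff)
qed

lemma defining_function_inward:
  assumes def: "C2_defining_function \<Omega> x U \<rho> g" and x: "x \<in> frontier \<Omega>" and h: "g x \<bullet> h < 0"
  shows "\<exists>d>0. \<forall>t. 0 < t \<and> t < d \<longrightarrow> x + t *\<^sub>R h \<in> \<Omega>"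
proof -
  have U: "open U" "x \<in> U" and \<rho>: "\<rho> x = 0" "\<Omega> \<inter> U = {z \<in> U. \<rho> z < 0}"
    using def x unfolding C2_defining_function_def by auto
  obtain d1 where d1: "d1 > 0" "\<And>t. \<bar>t\<bar> < d1 \<Longrightarrow> x + t *\<^sub>R h \<in> U"
    using eventually_line_in_open[OF U] by metis
  obtain d2 where d2: "d2 > 0" "\<And>t. 0 < t \<Longrightarrow> t < d2 \<Longrightarrow> \<rho> (x + t *\<^sub>R h) < \<rho> x"
    using DERIV_neg_dec_right[OF defining_function_directional[OF def] h] by auto
  show ?thesis
    using d1 d2 \<rho> by (intro exI[of _ "min d1 d2"]) auto
qed

text \<open>
  Convexity makes every direction into the domain non-tangential. A direction \<open>p - x\<close> that increases
  \<open>\<rho>\<close> to first order would leave the domain, although the segment from \<open>x\<close> to \<open>p\<close> stays in it; this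
  gives the weak inequality. It is strict because \<open>p\<close> may be moved a little in the direction of the
  gradient.
\<close>

lemma defining_function_gradient_outward:
  assumes \<Omega>: "open \<Omega>" "convex \<Omega>"
    and def: "C2_defining_function \<Omega> x U \<rho> g" and x: "x \<in> frontier \<Omega>" and p: "p \<in> \<Omega>"
  shows "g x \<bullet> (p - x) < 0"
proof -
  have U: "open U" "x \<in> U" and \<rho>: "\<rho> x = 0" "\<Omega> \<inter> U = {z \<in> U. \<rho> z < 0}" and g: "g x \<noteq> 0"
    using def x unfolding C2_defining_function_def by auto
  have le: "g x \<bullet> (p - x) \<le> 0" if p: "p \<in> \<Omega>" for p
  proof (rule ccontr)
    assume "\<not> g x \<bullet> (p - x) \<le> 0"
    then obtain d2 where d2: "d2 > 0" "\<And>t. 0 < t \<Longrightarrow> t < d2 \<Longrightarrow> \<rho> (x + t *\<^sub>R (p - x)) > \<rho> x"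
      using DERIV_pos_inc_right[OF defining_function_directional[OF def, of "p - x"]] by auto
    obtain d1 where d1: "d1 > 0" "\<And>t. \<bar>t\<bar> < d1 \<Longrightarrow> x + t *\<^sub>R (p - x) \<in> U"
      using eventually_line_in_open[OF U] by metis
    define t where "t = min (min d1 d2) 1 / 2"
    have t: "0 < t" "t < d1" "t < d2" "t < 1" using d1 d2 by (auto simp: t_def min_def)
    have "x + t *\<^sub>R (p - x) \<in> \<Omega>"
      using segment_into_convex_open[OF \<Omega> _ p t(1) t(4)] x by (simp add: frontier_def)
    then have "\<rho> (x + t *\<^sub>R (p - x)) < 0" using d1(2)[of t] t \<rho>(2) by auto
    then show False using d2(2)[OF t(1) t(3)] \<rho>(1) by simp
  qed
  obtain \<epsilon> where \<epsilon>: "\<epsilon> > 0" "ball p \<epsilon> \<subseteq> \<Omega>" using \<Omega>(1) p open_contains_ball by metis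
  define p' where "p' = p + (\<epsilon> / 2 / norm (g x)) *\<^sub>R g x"
  have "p' \<in> \<Omega>" using \<epsilon> g by (intro subsetD[OF \<epsilon>(2)]) (simp add: p'_def dist_norm)
  from le[OF this] have "g x \<bullet> (p - x) + (\<epsilon> / 2 / norm (g x)) * (norm (g x))\<^sup>2 \<le> 0"
    by (simp add: p'_def power2_norm_eq_inner algebra_simps)
  moreover have "(\<epsilon> / 2 / norm (g x)) * (norm (g x))\<^sup>2 > 0" using \<epsilon> g by simp
  ultimately show ?thesis by linarith
qed

text \<open>
  If two defining functions gave different unit normals \<open>v\<close> and \<open>w\<close>, the direction \<open>v - w\<close> would
  point into the domain for \<open>w\<close> and out of it for \<open>v\<close>.
\<close>

lemma outward_normal_eq:
  assumes \<Omega>: "open \<Omega>" "convex \<Omega>"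
    and def: "C2_defining_function \<Omega> x U \<rho> g" and x: "x \<in> frontier \<Omega>"
  shows "outward_normal \<Omega> x = g x /\<^sub>R norm (g x)"
  unfolding outward_normal_def
proof (rule the_equality)
  show "\<exists>U \<rho> g'. C2_defining_function \<Omega> x U \<rho> g' \<and> g x /\<^sub>R norm (g x) = g' x /\<^sub>R norm (g' x)"
    using def by blast
next
  fix v assume "\<exists>U \<rho> g. C2_defining_function \<Omega> x U \<rho> g \<and> v = g x /\<^sub>R norm (g x)"
  then obtain U' \<rho>' g' where def': "C2_defining_function \<Omega> x U' \<rho>' g'" and v: "v = g' x /\<^sub>R norm (g' x)"
    by blast
  define w where "w = g x /\<^sub>R norm (g x)"
  have g: "g x \<noteq> 0" "g' x \<noteq> 0"
    using def def' by (auto simp: C2_defining_function_def)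
  have unit: "v \<bullet> v = 1" "w \<bullet> w = 1"
    using g by (simp_all add: v w_def power2_norm_eq_inner[symmetric] power2_eq_square field_simps)
  show "v = g x /\<^sub>R norm (g x)"
  proof (rule ccontr)
    assume "v \<noteq> g x /\<^sub>R norm (g x)"
    then have "(v - w) \<bullet> (v - w) > 0" by (simp add: w_def)
    then have vw: "v \<bullet> w < 1" using unit by (simp add: inner_diff_left inner_diff_right inner_commute)
    then have "w \<bullet> (v - w) < 0" using unit by (simp add: inner_diff_right inner_commute)
    then have "g x \<bullet> (v - w) < 0" using g by (simp add: w_def field_simps)
    then obtain d where d: "d > 0" "\<And>t. 0 < t \<Longrightarrow> t < d \<Longrightarrow> x + t *\<^sub>R (v - w) \<in> \<Omega>"
      using defining_function_inward[OF def x] by blast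
    have "g' x \<bullet> ((x + (d/2) *\<^sub>R (v - w)) - x) < 0"
      by (rule defining_function_gradient_outward[OF \<Omega> def' x]) (use d in auto)
    then have "g' x \<bullet> (v - w) < 0" using d by (simp add: mult_less_0_iff)
    then have "v \<bullet> (v - w) < 0" using g by (simp add: v field_simps)
    then show False using vw unit by (simp add: inner_diff_right)
  qed
qed

text \<open>
  The differentiability half of the implicit function theorem, for a solution \<open>c\<close> that is already
  known to be continuous: \<open>x + c(x) e\<close> stays on a level set of \<open>\<rho>\<close>, and \<open>e\<close> is transversal to it.
  Writing \<open>\<delta>\<close> for the increment of \<open>c\<close>, the first order expansion of \<open>\<rho>\<close> gives
  \<open>n \<bullet> (z - x) + \<delta> (n \<bullet> e) = o(|z - x| + |\<delta>|)\<close>. This first shows \<open>\<delta> = O(|z - x|)\<close>, and then identifies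
  the linear part of \<open>\<delta>\<close>.
\<close>

lemma implicit_shear_derivative:
  fixes \<rho> c :: "'a::euclidean_space \<Rightarrow> real"
  assumes \<rho>: "(\<rho> has_derivative (\<lambda>h. n \<bullet> h)) (at (x + c x *\<^sub>R e))" and ne: "n \<bullet> e \<noteq> 0"
    and c: "isCont c x"
    and W: "open W" "x \<in> W" "\<And>z. z \<in> W \<Longrightarrow> \<rho> (z + c z *\<^sub>R e) = \<rho> (x + c x *\<^sub>R e)"
  shows "(c has_derivative (\<lambda>h. (- (1 / (n \<bullet> e)) *\<^sub>R n) \<bullet> h)) (at x)"
  unfolding has_derivative_at_alt
proof (intro conjI allI impI)
  show "bounded_linear (\<lambda>h. (- (1 / (n \<bullet> e)) *\<^sub>R n) \<bullet> h)" by (rule bounded_linear_inner_right)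
next
  fix \<epsilon> :: real assume \<epsilon>: "0 < \<epsilon>"
  define m where "m = \<bar>n \<bullet> e\<bar>"
  have m: "m > 0" using ne by (simp add: m_def)
  \<comment> \<open>\<open>L\<close> is the Lipschitz bound for \<open>\<delta>\<close>; \<open>\<eta>\<close> is small enough to absorb \<open>\<delta>\<close> and then to reach \<open>\<epsilon>\<close>.\<close>
  define L where "L = 2 / m * (norm n + 1)"
  have L: "L \<ge> 0" using m by (simp add: L_def)
  define \<eta> where "\<eta> = min (min 1 (m / (2 * (norm e + 1)))) (\<epsilon> * m / (1 + norm e * L))"
  have pos: "1 + norm e * L > 0" using L by (simp add: add_pos_nonneg)
  have \<eta>: "\<eta> > 0" "\<eta> \<le> 1" "\<eta> * (2 * (norm e + 1)) \<le> m" "\<eta> * (1 + norm e * L) \<le> \<epsilon> * m"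
  proof -
    show "\<eta> > 0" using \<epsilon> m pos by (simp add: \<eta>_def add_nonneg_pos)
    show "\<eta> \<le> 1" by (simp add: \<eta>_def)
    have "\<eta> \<le> m / (2 * (norm e + 1))" by (simp add: \<eta>_def)
    then show "\<eta> * (2 * (norm e + 1)) \<le> m" by (simp add: pos_le_divide_eq add_nonneg_pos)
    have "\<eta> \<le> \<epsilon> * m / (1 + norm e * L)" by (simp add: \<eta>_def)
    then show "\<eta> * (1 + norm e * L) \<le> \<epsilon> * m" using pos by (simp add: pos_le_divide_eq)
  qed
  let ?F = "\<lambda>z. z + c z *\<^sub>R e"
  obtain d where d: "d > 0"
    "\<And>z. norm (z - ?F x) < d \<Longrightarrow> norm (\<rho> z - \<rho> (?F x) - n \<bullet> (z - ?F x)) \<le> \<eta> * norm (z - ?F x)"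
    using \<rho> \<eta>(1) unfolding has_derivative_at_alt by blast
  have "isCont ?F x" by (intro continuous_intros c)
  then obtain d1 where d1: "d1 > 0" "\<And>z. dist z x < d1 \<Longrightarrow> dist (?F z) (?F x) < d"
    using d(1) unfolding continuous_at_eps_delta by blast
  obtain d2 where d2: "d2 > 0" "ball x d2 \<subseteq> W" using W open_contains_ball by metis
  show "\<exists>d>0. \<forall>z. norm (z - x) < d \<longrightarrow>
      norm (c z - c x - (- (1 / (n \<bullet> e)) *\<^sub>R n) \<bullet> (z - x)) \<le> \<epsilon> * norm (z - x)"
  proof (intro exI[of _ "min d1 d2"] conjI allI impI)
    show "0 < min d1 d2" using d1 d2 by simp
    fix z assume z: "norm (z - x) < min d1 d2"
    define \<delta> where "\<delta> = c z - c x"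
    have F: "?F z - ?F x = (z - x) + \<delta> *\<^sub>R e" by (simp add: \<delta>_def algebra_simps)
    have "z \<in> W" using z d2 by (auto simp: dist_norm norm_minus_commute)
    then have "\<rho> (?F z) = \<rho> (?F x)" by (rule W)
    moreover have "norm (?F z - ?F x) < d" using d1(2)[of z] z by (simp add: dist_norm)
    ultimately have 1: "\<bar>n \<bullet> (z - x) + \<delta> * (n \<bullet> e)\<bar> \<le> \<eta> * norm ((z - x) + \<delta> *\<^sub>R e)"
      using d(2)[of "?F z"] unfolding F by (simp add: inner_add_right)
    also have "\<dots> \<le> \<eta> * (norm (z - x) + \<bar>\<delta>\<bar> * norm e)"
      using norm_triangle_ineq[of "z - x" "\<delta> *\<^sub>R e"] \<eta>(1) by (intro mult_left_mono) auto
    finally have 2: "\<bar>n \<bullet> (z - x) + \<delta> * (n \<bullet> e)\<bar> \<le> \<eta> * (norm (z - x) + \<bar>\<delta>\<bar> * norm e)" .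
    have "\<bar>\<delta>\<bar> * m \<le> \<bar>n \<bullet> (z - x) + \<delta> * (n \<bullet> e)\<bar> + \<bar>n \<bullet> (z - x)\<bar>"
      unfolding m_def abs_mult[symmetric] by linarith
    also have "\<dots> \<le> \<eta> * (norm (z - x) + \<bar>\<delta>\<bar> * norm e) + norm n * norm (z - x)"
      using 2 Cauchy_Schwarz_ineq2[of n "z - x"] by linarith
    also have "\<dots> \<le> norm (z - x) + \<bar>\<delta>\<bar> * (m / 2) + norm n * norm (z - x)"
    proof -
      have "\<eta> * norm e \<le> m / 2" using \<eta>(1,3) by (simp add: algebra_simps)
      then have "\<bar>\<delta>\<bar> * (\<eta> * norm e) \<le> \<bar>\<delta>\<bar> * (m / 2)" by (intro mult_left_mono) auto
      moreover have "\<eta> * norm (z - x) \<le> norm (z - x)" using \<eta>(2) by (simp add: mult_left_le_one_le \<eta>(1) less_imp_le)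
      ultimately show ?thesis by (simp add: algebra_simps)
    qed
    finally have "\<bar>\<delta>\<bar> * (m / 2) \<le> (norm n + 1) * norm (z - x)" by (simp add: algebra_simps)
    then have \<delta>: "\<bar>\<delta>\<bar> \<le> L * norm (z - x)" using m by (simp add: L_def field_simps)
    have "\<bar>n \<bullet> (z - x) + \<delta> * (n \<bullet> e)\<bar> \<le> \<eta> * (norm (z - x) + (L * norm (z - x)) * norm e)"
      using 2 \<delta> \<eta>(1)
      by (elim order_trans) (intro mult_left_mono add_left_mono mult_right_mono; simp)
    also have "\<dots> = (\<eta> * (1 + norm e * L)) * norm (z - x)" by (simp add: algebra_simps)
    also have "\<dots> \<le> (\<epsilon> * m) * norm (z - x)" using \<eta>(4) by (intro mult_right_mono) auto
    finally have 3: "\<bar>n \<bullet> (z - x) + \<delta> * (n \<bullet> e)\<bar> \<le> m * (\<epsilon> * norm (z - x))" by (simp add: algebra_simps)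
    have "n \<bullet> (z - x) + \<delta> * (n \<bullet> e) = (n \<bullet> e) * (\<delta> + n \<bullet> (z - x) / (n \<bullet> e))"
      using ne by (simp add: field_simps)
    then have "m * \<bar>\<delta> + n \<bullet> (z - x) / (n \<bullet> e)\<bar> \<le> m * (\<epsilon> * norm (z - x))"
      using 3 by (simp add: m_def abs_mult)
    then show "norm (c z - c x - (- (1 / (n \<bullet> e)) *\<^sub>R n) \<bullet> (z - x)) \<le> \<epsilon> * norm (z - x)"
      using m by (simp add: \<delta>_def)
  qed
qed

section \<open>Chords in a fixed direction\<close>

lemma proj_perp_add: "proj_perp e (x + y) = proj_perp e x + proj_perp e y"
  by (simp add: proj_perp_def inner_add_right scaleR_add_left)

lemma proj_perp_scaleR: "proj_perp e (t *\<^sub>R x) = t *\<^sub>R proj_perp e x"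
  by (simp add: proj_perp_def algebra_simps)

lemma proj_perp_minus: "proj_perp (- e) = proj_perp e"
  by (simp add: proj_perp_def fun_eq_iff)

lemma proj_perp_split: "proj_perp e x + (e \<bullet> x) *\<^sub>R e = x"
  by (simp add: proj_perp_def)

lemma continuous_on_proj_perp: "continuous_on S (proj_perp e)"
  unfolding proj_perp_def by (intro continuous_intros)

lemma open_convex_bounded_real:
  fixes I :: "real set"
  assumes "open I" "convex I" "bounded I" "I \<noteq> {}"
  shows "Inf I < Sup I \<and> I = {Inf I<..<Sup I}"
proof -
  have bdd: "bdd_below I" "bdd_above I"
    using assms(3) by (auto intro: bounded_imp_bdd_below bounded_imp_bdd_above)
  have in1: "Inf I < s \<and> s < Sup I" if s: "s \<in> I" for s
  proof -
    obtain d where d: "d > 0" "\<And>t. \<bar>t\<bar> < d \<Longrightarrow> s + t *\<^sub>R 1 \<in> I"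
      using eventually_line_in_open[OF assms(1) s] by metis
    have "Inf I \<le> s + (- d/2)" "s + d/2 \<le> Sup I"
      using d(2)[of "-d/2"] d(2)[of "d/2"] d(1) bdd cInf_lower cSup_upper by auto
    then show ?thesis using d(1) by linarith
  qed
  have in2: "s \<in> I" if s: "Inf I < s" "s < Sup I" for s
  proof -
    obtain s1 s2 where "s1 \<in> I" "s1 < s" "s2 \<in> I" "s < s2"
      using s cInf_lessD[OF assms(4)] less_cSupD[OF assms(4)] by metis
    then show ?thesis
      using assms(2) by (metis less_imp_le is_interval_convex_1 mem_is_interval_1_I)
  qed
  show ?thesis using in1 in2 assms(4) by force
qed

locale chord_domain =
  fixes \<Omega> :: "'a::euclidean_space set" and e :: 'a
  assumes open_dom: "open \<Omega>" and convex_dom: "convex \<Omega>" and bounded_dom: "bounded \<Omega>"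
    and C2_bd: "C2_boundary \<Omega>" and unit_e: "norm e = 1"
begin

abbreviation \<nu> where "\<nu> \<equiv> outward_normal \<Omega>"
abbreviation P where "P \<equiv> proj_perp e"

text \<open>
  The chords are handled as functions on \<open>R\<^sup>n\<close> that are constant in the direction \<open>e\<close>. They are defined
  on the open cylinder over the projection of \<open>\<Omega>\<close>, where the calculus of open sets applies.
\<close>

definition cylinder where "cylinder = {x. P x \<in> Y_set \<Omega> e}"
definition lower where "lower x = alpha \<Omega> e (P x)"
definition upper where "upper x = beta \<Omega> e (P x)"

lemma e_e [simp]: "e \<bullet> e = 1"
  using unit_e by (simp add: norm_eq_1)

lemma P_e [simp]: "P e = 0"
  by (simp add: proj_perp_def)

lemma P_line [simp]: "P (x + s *\<^sub>R e) = P x"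
  by (simp add: proj_perp_add proj_perp_scaleR)

lemma e_P [simp]: "e \<bullet> P x = 0"
  by (simp add: proj_perp_def inner_diff_right)

lemma P_P [simp]: "P (P x) = P x"
  by (simp add: proj_perp_def inner_diff_right)

lemma lower_line [simp]: "lower (x + s *\<^sub>R e) = lower x" and upper_line [simp]: "upper (x + s *\<^sub>R e) = upper x"
  by (simp_all add: lower_def upper_def)

lemma cylinder_line [simp]: "x + s *\<^sub>R e \<in> cylinder \<longleftrightarrow> x \<in> cylinder"
  by (simp add: cylinder_def)

lemma dom_subset_cylinder: "\<Omega> \<subseteq> cylinder"
  by (auto simp: cylinder_def Y_set_def)

lemma cylinder_iff: "x \<in> cylinder \<longleftrightarrow> (\<exists>s. x + s *\<^sub>R e \<in> \<Omega>)"
proof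
  assume "x \<in> cylinder"
  then obtain z where z: "z \<in> \<Omega>" "P x = P z" by (auto simp: cylinder_def Y_set_def)
  have "x + (e \<bullet> z - e \<bullet> x) *\<^sub>R e = z"
    using z(2) by (simp add: proj_perp_def algebra_simps)
  then show "\<exists>s. x + s *\<^sub>R e \<in> \<Omega>" using z(1) by metis
next
  assume "\<exists>s. x + s *\<^sub>R e \<in> \<Omega>"
  then show "x \<in> cylinder" using dom_subset_cylinder cylinder_line by blast
qed

lemma open_cylinder: "open cylinder"
proof -
  have "cylinder = (\<Union>s. (\<lambda>x. x + s *\<^sub>R e) -` \<Omega>)" using cylinder_iff by auto
  moreover have "open ((\<lambda>x. x + s *\<^sub>R e) -` \<Omega>)" for s
    by (intro open_vimage open_dom continuous_intros)
  ultimately show ?thesis by auto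
qed

lemma convex_cylinder: "convex cylinder"
proof (rule convexI)
  fix x y and u v :: real
  assume x: "x \<in> cylinder" and y: "y \<in> cylinder" and uv: "0 \<le> u" "0 \<le> v" "u + v = 1"
  obtain s s' where "x + s *\<^sub>R e \<in> \<Omega>" "y + s' *\<^sub>R e \<in> \<Omega>" using x y cylinder_iff by metis
  then have "u *\<^sub>R (x + s *\<^sub>R e) + v *\<^sub>R (y + s' *\<^sub>R e) \<in> \<Omega>"
    using convexD[OF convex_dom] uv by blast
  then have "(u *\<^sub>R x + v *\<^sub>R y) + (u * s + v * s') *\<^sub>R e \<in> \<Omega>"
    by (simp add: algebra_simps)
  then show "u *\<^sub>R x + v *\<^sub>R y \<in> cylinder" using cylinder_iff by blast
qed

text \<open>
  The set of parameters is bounded, open, convex and nonempty, hence an open interval; its infimum and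
  supremum are the only possible values of \<open>alpha\<close> and \<open>beta\<close>.
\<close>

lemma chord_interval:
  assumes y: "y \<in> Y_set \<Omega> e"
  shows "alpha \<Omega> e y < beta \<Omega> e y \<and> {s. y + s *\<^sub>R e \<in> \<Omega>} = {alpha \<Omega> e y<..<beta \<Omega> e y}"
proof -
  define I where "I = {s. y + s *\<^sub>R e \<in> \<Omega>}"
  obtain z where z: "z \<in> \<Omega>" "y = P z" using y by (auto simp: Y_set_def)
  have "e \<bullet> z \<in> I" using z by (simp add: I_def proj_perp_split)
  then have "I \<noteq> {}" by blast
  moreover have "open I"
  proof -
    have "I = (\<lambda>s. y + s *\<^sub>R e) -` \<Omega>" by (auto simp: I_def)
    then show ?thesis by (simp add: open_vimage open_dom continuous_intros)
  qed
  moreover have "convex I"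
  proof (rule convexI)
    fix s s' u v :: real assume "s \<in> I" "s' \<in> I" and uv: "0 \<le> u" "0 \<le> v" "u + v = 1"
    then have "u *\<^sub>R (y + s *\<^sub>R e) + v *\<^sub>R (y + s' *\<^sub>R e) \<in> \<Omega>"
      using convexD[OF convex_dom] by (simp add: I_def)
    also have "u *\<^sub>R (y + s *\<^sub>R e) + v *\<^sub>R (y + s' *\<^sub>R e) = (u + v) *\<^sub>R y + (u * s + v * s') *\<^sub>R e"
      by (simp add: algebra_simps)
    finally show "u *\<^sub>R s + v *\<^sub>R s' \<in> I" using uv by (simp add: I_def)
  qed
  moreover have "bounded I"
  proof -
    obtain R where R: "\<And>x. x \<in> \<Omega> \<Longrightarrow> norm x \<le> R" using bounded_dom bounded_iff by metis
    have "\<bar>s\<bar> \<le> R + norm y" if "s \<in> I" for s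
    proof -
      have "norm (s *\<^sub>R e) \<le> norm (y + s *\<^sub>R e) + norm y"
        using norm_triangle_ineq4[of "y + s *\<^sub>R e" y] by simp
      then show ?thesis using R[of "y + s *\<^sub>R e"] that unit_e by (simp add: I_def)
    qed
    then show ?thesis unfolding bounded_iff by auto
  qed
  ultimately have I: "Inf I < Sup I" "I = {Inf I<..<Sup I}"
    using open_convex_bounded_real by auto
  have "alpha \<Omega> e y = Inf I"
    unfolding alpha_def I_def[symmetric]
    by (rule the_equality) (use I cInf_greaterThanLessThan in blast, metis cInf_greaterThanLessThan)
  moreover have "beta \<Omega> e y = Sup I"
    unfolding beta_def I_def[symmetric]
    by (rule the_equality) (use I cSup_greaterThanLessThan in blast, metis cSup_greaterThanLessThan)
  ultimately show ?thesis using I by (simp add: I_def)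
qed

lemma lower_less_upper: "x \<in> cylinder \<Longrightarrow> lower x < upper x"
  using chord_interval by (simp add: cylinder_def lower_def upper_def)

lemma mem_dom_iff:
  assumes "x \<in> cylinder"
  shows "x \<in> \<Omega> \<longleftrightarrow> lower x < e \<bullet> x \<and> e \<bullet> x < upper x"
proof -
  have "e \<bullet> x \<in> {s. P x + s *\<^sub>R e \<in> \<Omega>} \<longleftrightarrow> lower x < e \<bullet> x \<and> e \<bullet> x < upper x"
    using chord_interval assms by (simp add: cylinder_def lower_def upper_def)
  then show ?thesis by (simp add: proj_perp_split)
qed

lemma mem_dom_line:
  assumes "x \<in> cylinder"
  shows "x + s *\<^sub>R e \<in> \<Omega> \<longleftrightarrow> lower x < e \<bullet> x + s \<and> e \<bullet> x + s < upper x"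
  using mem_dom_iff[of "x + s *\<^sub>R e"] assms by (simp add: inner_add_right)

lemma mem_closure_iff:
  assumes x: "x \<in> cylinder"
  shows "x \<in> closure \<Omega> \<longleftrightarrow> lower x \<le> e \<bullet> x \<and> e \<bullet> x \<le> upper x"
proof
  assume c: "lower x \<le> e \<bullet> x \<and> e \<bullet> x \<le> upper x"
  let ?f = "\<lambda>s. P x + s *\<^sub>R e"
  have "?f ` {lower x<..<upper x} \<subseteq> \<Omega>"
    using chord_interval x unfolding cylinder_def lower_def upper_def by blast
  then have "?f ` closure {lower x<..<upper x} \<subseteq> closure \<Omega>"
    by (intro image_closure_subset continuous_intros) (use closure_subset in blast)+
  moreover have "e \<bullet> x \<in> closure {lower x<..<upper x}" using c lower_less_upper[OF x] by simp
  ultimately have "?f (e \<bullet> x) \<in> closure \<Omega>" by blast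
  then show "x \<in> closure \<Omega>" by (simp add: proj_perp_split)
next
  assume c: "x \<in> closure \<Omega>"
  define m where "m = (lower x + upper x) / 2"
  define p where "p = x + (m - e \<bullet> x) *\<^sub>R e"
  have p: "p \<in> \<Omega>" using lower_less_upper[OF x] by (simp add: p_def mem_dom_line[OF x] m_def)
  have mid: "lower x < e \<bullet> x + t * (m - e \<bullet> x) \<and> e \<bullet> x + t * (m - e \<bullet> x) < upper x" if "0 < t" "t < 1" for t
    using segment_into_convex_open[OF open_dom convex_dom c p that] mem_dom_line[OF x]
    by (simp add: p_def)
  have lim: "((\<lambda>t. e \<bullet> x + t * (m - e \<bullet> x)) \<longlongrightarrow> e \<bullet> x + 0 * (m - e \<bullet> x)) (at_right 0)"
    by (intro tendsto_intros)
  have ev: "eventually (\<lambda>t. 0 < t \<and> t < (1::real)) (at_right 0)"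
    by (auto simp: eventually_at_right_field intro: exI[of _ 1])
  have "lower x \<le> e \<bullet> x + 0 * (m - e \<bullet> x)"
    by (rule tendsto_lowerbound[OF lim eventually_mono[OF ev]]) (use mid less_imp_le in auto)
  moreover have "e \<bullet> x + 0 * (m - e \<bullet> x) \<le> upper x"
    by (rule tendsto_upperbound[OF lim eventually_mono[OF ev]]) (use mid less_imp_le in auto)
  ultimately show "lower x \<le> e \<bullet> x \<and> e \<bullet> x \<le> upper x" by simp
qed

lemma mem_frontier_iff:
  assumes x: "x \<in> cylinder"
  shows "x \<in> frontier \<Omega> \<longleftrightarrow> e \<bullet> x = lower x \<or> e \<bullet> x = upper x"
  using mem_closure_iff[OF x] mem_dom_iff[OF x] lower_less_upper[OF x] open_dom
  by (auto simp: frontier_def interior_open)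

lemma normal_facts:
  assumes x: "x \<in> frontier \<Omega>"
  shows "norm (\<nu> x) = 1" "\<And>p. p \<in> \<Omega> \<Longrightarrow> \<nu> x \<bullet> (p - x) < 0"
    "\<And>h. \<nu> x \<bullet> h < 0 \<Longrightarrow> \<exists>d>0. \<forall>t. 0 < t \<and> t < d \<longrightarrow> x + t *\<^sub>R h \<in> \<Omega>"
proof -
  obtain U \<rho> g where def: "C2_defining_function \<Omega> x U \<rho> g"
    using C2_bd x unfolding C2_boundary_def by blast
  then have g: "g x \<noteq> 0" by (auto simp: C2_defining_function_def)
  have \<nu>: "\<nu> x = g x /\<^sub>R norm (g x)"
    by (rule outward_normal_eq[OF open_dom convex_dom def x])
  show "norm (\<nu> x) = 1" using g by (simp add: \<nu>)
  show "\<nu> x \<bullet> (p - x) < 0" if "p \<in> \<Omega>" for p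
    using defining_function_gradient_outward[OF open_dom convex_dom def x that] g
    by (simp add: \<nu> mult_pos_neg)
  show "\<exists>d>0. \<forall>t. 0 < t \<and> t < d \<longrightarrow> x + t *\<^sub>R h \<in> \<Omega>" if "\<nu> x \<bullet> h < 0" for h
  proof (rule defining_function_inward[OF def x])
    show "g x \<bullet> h < 0" using that g by (simp add: \<nu> mult_less_0_iff)
  qed
qed

text \<open>
  Through an end point of a chord, \<open>e\<close> points from the lower end into the domain and from the upper end out
  of it, so neither end is a point of tangency.
\<close>

lemma normal_at_ends:
  assumes x: "x \<in> frontier \<Omega>" "x \<in> cylinder"
  shows "e \<bullet> x = lower x \<Longrightarrow> \<nu> x \<bullet> e < 0" "e \<bullet> x = upper x \<Longrightarrow> \<nu> x \<bullet> e > 0"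
proof -
  define m where "m = (lower x + upper x) / 2 - e \<bullet> x"
  have "x + m *\<^sub>R e \<in> \<Omega>" using lower_less_upper[OF x(2)] by (simp add: m_def mem_dom_line[OF x(2)])
  from normal_facts(2)[OF x(1) this] have "m * (\<nu> x \<bullet> e) < 0" by simp
  moreover have "m > 0" if "e \<bullet> x = lower x" using lower_less_upper[OF x(2)] that by (simp add: m_def)
  moreover have "m < 0" if "e \<bullet> x = upper x" using lower_less_upper[OF x(2)] that by (simp add: m_def)
  ultimately show "e \<bullet> x = lower x \<Longrightarrow> \<nu> x \<bullet> e < 0" "e \<bullet> x = upper x \<Longrightarrow> \<nu> x \<bullet> e > 0"
    by (auto simp: mult_less_0_iff)
qed

text \<open>
  If \<open>e\<close> is transversal to the boundary at \<open>x\<close>, then one of \<open>e\<close> and \<open>-e\<close> points into \<open>\<Omega>\<close>, so \<open>x\<close> lies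
  on a chord; the converse is \<open>normal_at_ends\<close>. In particular \<open>\<Gamma>\<close> is relatively open in the boundary.
\<close>

lemma Gamma_eq: "Gamma \<Omega> e = frontier \<Omega> \<inter> cylinder"
proof (intro set_eqI iffI)
  fix x assume "x \<in> Gamma \<Omega> e"
  then have x: "x \<in> frontier \<Omega>" and ne: "\<nu> x \<bullet> e \<noteq> 0" by (auto simp: Gamma_def inner_commute)
  obtain \<sigma> :: real where "\<nu> x \<bullet> (\<sigma> *\<^sub>R e) < 0"
  proof (cases "\<nu> x \<bullet> e < 0")
    case True then show ?thesis by (intro that[of 1]) simp
  next
    case False then show ?thesis using ne by (intro that[of "-1"]) simp
  qed
  from normal_facts(3)[OF x this] obtain d where
    "d > 0" "\<And>t. 0 < t \<Longrightarrow> t < d \<Longrightarrow> x + t *\<^sub>R \<sigma> *\<^sub>R e \<in> \<Omega>" by blast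
  from this(2)[of "d/2"] this(1) have "x + (d/2 * \<sigma>) *\<^sub>R e \<in> \<Omega>" by simp
  then show "x \<in> frontier \<Omega> \<inter> cylinder" using x cylinder_iff by blast
next
  fix x assume "x \<in> frontier \<Omega> \<inter> cylinder"
  then show "x \<in> Gamma \<Omega> e"
    using normal_at_ends[of x] mem_frontier_iff[of x] by (auto simp: Gamma_def inner_commute)
qed

text \<open>
  Written as a shear \<open>x + c(x) e\<close>, so that \<open>implicit_shear_derivative\<close> and \<open>C1_on_shear\<close> apply.
\<close>

definition lower_pt where "lower_pt x = x + (lower x - e \<bullet> x) *\<^sub>R e"

lemma lower_pt_in: "x \<in> cylinder \<Longrightarrow> lower_pt x \<in> frontier \<Omega> \<inter> cylinder"
  using mem_frontier_iff[of "lower_pt x"] by (simp add: lower_pt_def inner_add_right)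

lemma normal_A: "x \<in> cylinder \<Longrightarrow> \<nu> (lower_pt x) \<bullet> e < 0"
  using normal_at_ends(1)[of "lower_pt x"] lower_pt_in by (simp add: lower_pt_def inner_add_right)

lemma lower_pt_id: "x \<in> cylinder \<Longrightarrow> e \<bullet> x = lower x \<Longrightarrow> lower_pt x = x"
  by (simp add: lower_pt_def)

text \<open>
  A point of the chord slightly above its lower end lies in the open set \<open>\<Omega>\<close>, and a point slightly below
  it lies in the open complement of \<open>closure \<Omega>\<close>. Both properties persist on nearby chords and
  confine their lower ends.
\<close>

lemma continuous_lower: "continuous_on cylinder lower"
proof (subst continuous_on_eq_continuous_at[OF open_cylinder], rule ballI)
  fix x assume x: "x \<in> cylinder"
  show "isCont lower x"
    unfolding continuous_at_eps_delta
  proof (intro allI impI)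
    fix \<epsilon>' :: real assume "\<epsilon>' > 0"
    define \<epsilon> where "\<epsilon> = min \<epsilon>' (upper x - lower x) / 2"
    have \<epsilon>: "\<epsilon> > 0" "\<epsilon> < \<epsilon>'" "\<epsilon> < upper x - lower x"
      using \<open>\<epsilon>' > 0\<close> lower_less_upper[OF x] by (auto simp: \<epsilon>_def min_def)
    let ?up = "\<lambda>z. P z + (lower x + \<epsilon>) *\<^sub>R e" and ?dn = "\<lambda>z. P z + (lower x - \<epsilon>) *\<^sub>R e"
    have cl: "P z + s *\<^sub>R e = z + (s - e \<bullet> z) *\<^sub>R e" for z s
      by (simp add: proj_perp_def algebra_simps)
    have in_cl: "P z + s *\<^sub>R e \<in> closure \<Omega> \<longleftrightarrow> lower z \<le> s \<and> s \<le> upper z"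
      and in_dom: "P z + s *\<^sub>R e \<in> \<Omega> \<longleftrightarrow> lower z < s \<and> s < upper z" if "z \<in> cylinder" for z s
      using mem_closure_iff[of "z + (s - e \<bullet> z) *\<^sub>R e"] mem_dom_line[OF that, of "s - e \<bullet> z"] that
      unfolding cl by (simp_all add: inner_add_right)
    let ?N = "(?up -` \<Omega>) \<inter> (?dn -` (- closure \<Omega>))"
    have "open ?N"
      by (intro open_Int open_vimage open_dom open_Compl closed_closure continuous_intros
          continuous_on_proj_perp)
    moreover have "x \<in> ?N" using \<epsilon> in_cl[OF x] in_dom[OF x] by simp
    ultimately obtain d1 where d1: "d1 > 0" "ball x d1 \<subseteq> ?N" using open_contains_ball by metis
    obtain d2 where d2: "d2 > 0" "ball x d2 \<subseteq> cylinder" using open_cylinder x open_contains_ball by metis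
    have "dist (lower z) (lower x) < \<epsilon>'" if "dist z x < min d1 d2" for z
    proof -
      have z: "z \<in> ?N" "z \<in> cylinder" using that d1 d2 by (auto simp: dist_commute)
      have "lower z < lower x + \<epsilon>" "lower x + \<epsilon> < upper z" using z in_dom[OF z(2)] by simp_all
      moreover have "\<not> (lower z \<le> lower x - \<epsilon> \<and> lower x - \<epsilon> \<le> upper z)" using z in_cl[OF z(2)] by simp
      ultimately have "\<bar>lower z - lower x\<bar> < \<epsilon>'" using \<epsilon> by linarith
      then show ?thesis by (simp add: dist_real_def)
    qed
    then show "\<exists>d>0. \<forall>z. dist z x < d \<longrightarrow> dist (lower z) (lower x) < \<epsilon>'"
      using d1 d2 by (intro exI[of _ "min d1 d2"]) auto
  qed
qed

lemma lower_end_gradient: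
  assumes x: "x \<in> cylinder" and def: "C2_defining_function \<Omega> (lower_pt x0) U \<rho> g" and U: "lower_pt x \<in> U"
  shows "g (lower_pt x) \<bullet> e \<noteq> 0"
    and "((\<lambda>z. lower z - e \<bullet> z) has_derivative (\<lambda>h. (- (1 / (g (lower_pt x) \<bullet> e)) *\<^sub>R g (lower_pt x)) \<bullet> h)) (at x)"
    and "\<nu> (lower_pt x) = g (lower_pt x) /\<^sub>R norm (g (lower_pt x))"
proof -
  have def': "C2_defining_function \<Omega> (lower_pt x) U \<rho> g"
    using def U unfolding C2_defining_function_def by blast
  show \<nu>: "\<nu> (lower_pt x) = g (lower_pt x) /\<^sub>R norm (g (lower_pt x))"
    by (rule outward_normal_eq[OF open_dom convex_dom def']) (use lower_pt_in[OF x] in blast)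
  show ne: "g (lower_pt x) \<bullet> e \<noteq> 0" using normal_A[OF x] by (auto simp: \<nu>)
  let ?c = "\<lambda>z. lower z - e \<bullet> z"
  have cont: "continuous_on cylinder ?c" by (intro continuous_intros continuous_lower)
  have contA: "continuous_on cylinder lower_pt" unfolding lower_pt_def by (intro continuous_intros continuous_lower)
  define W where "W = lower_pt -` U \<inter> cylinder"
  have openW: "open W"
    using continuous_open_preimage[OF contA open_cylinder, of U] def
    by (auto simp: W_def C2_defining_function_def Int_commute)
  have \<rho>0: "\<rho> (lower_pt z) = 0" if "z \<in> W" for z
    using lower_pt_in[of z] that def by (auto simp: W_def C2_defining_function_def)
  have xW: "x \<in> W" using U x by (simp add: W_def)
  show "(?c has_derivative (\<lambda>h. (- (1 / (g (lower_pt x) \<bullet> e)) *\<^sub>R g (lower_pt x)) \<bullet> h)) (at x)"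
  proof (rule implicit_shear_derivative[OF _ ne _ openW xW])
    show "(\<rho> has_derivative (\<lambda>h. g (lower_pt x) \<bullet> h)) (at (x + ?c x *\<^sub>R e))"
      using defining_function_deriv[OF def U] by (simp add: lower_pt_def)
    show "isCont ?c x" using cont open_cylinder x by (simp add: continuous_on_eq_continuous_at)
    show "\<rho> (z + ?c z *\<^sub>R e) = \<rho> (x + ?c x *\<^sub>R e)" if "z \<in> W" for z
      using \<rho>0[OF that] \<rho>0[OF xW] by (simp add: lower_pt_def)
  qed
qed

lemma lower_end_gradient_normal:
  assumes x: "x \<in> cylinder"
  shows "((\<lambda>z. lower z - e \<bullet> z) has_derivative
      (\<lambda>h. (- (1 / (\<nu> (lower_pt x) \<bullet> e)) *\<^sub>R \<nu> (lower_pt x)) \<bullet> h)) (at x)"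
proof -
  obtain U \<rho> g where def: "C2_defining_function \<Omega> (lower_pt x) U \<rho> g"
    using C2_bd lower_pt_in[OF x] unfolding C2_boundary_def by blast
  then have "lower_pt x \<in> U" "g (lower_pt x) \<noteq> 0" by (auto simp: C2_defining_function_def)
  then show ?thesis
    using lower_end_gradient[OF x def] by simp
qed

text \<open>
  Near the end point of a chord the gradient of \<open>lower x - e \<bullet> x\<close> is \<open>- g / (g \<bullet> e)\<close> evaluated at
  the end point, where \<open>g\<close> is the gradient of a local defining function. As \<open>g\<close> is \<open>C\<^sup>1\<close> and the end point
  is now known to be \<open>C\<^sup>1\<close>, this gradient is \<open>C\<^sup>1\<close>.
\<close>

lemma C2_on_lower: "C2_on cylinder lower"
proof (rule C2_on_locally[OF open_cylinder])
  fix x0 assume x0: "x0 \<in> cylinder"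
  obtain U \<rho> g where def: "C2_defining_function \<Omega> (lower_pt x0) U \<rho> g"
    using C2_bd lower_pt_in[OF x0] unfolding C2_boundary_def by blast
  then obtain H where U: "open U" "lower_pt x0 \<in> U" and H: "C2_with U \<rho> g H"
    by (auto simp: C2_defining_function_def)
  have contA: "continuous_on cylinder lower_pt" unfolding lower_pt_def by (intro continuous_intros continuous_lower)
  define W where "W = lower_pt -` U \<inter> cylinder"
  have openW: "open W"
    using continuous_open_preimage[OF contA open_cylinder U(1)] by (simp add: W_def Int_commute)
  let ?c = "\<lambda>z. lower z - e \<bullet> z"
  let ?k = "\<lambda>x. - (1 / (g (lower_pt x) \<bullet> e)) *\<^sub>R g (lower_pt x)"
  have gH: "C1_on U (\<lambda>x. g x \<bullet> v)" for v
  proof -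
    have "C2_on U \<rho>" using H unfolding C2_on_def by blast
    then obtain g' where g': "C1_with U \<rho> g'" "\<And>v. C1_on U (\<lambda>x. g' x \<bullet> v)"
      unfolding C2_on_iff by blast
    have "g' x = g x" if "x \<in> U" for x
      by (rule gradient_unique[OF C1_with_deriv_at[OF g'(1) U(1) that] defining_function_deriv[OF def that]])
    then show ?thesis by (intro C1_on_cong[OF g'(2)[of v]]) simp
  qed
  have g_cont: "continuous_on U g"
    using H unfolding C2_with_def by (intro has_derivative_continuous_on) blast
  have ne: "g (lower_pt x) \<bullet> e \<noteq> 0" if "x \<in> W" for x
    using lower_end_gradient(1)[OF _ def, of x] that by (simp add: W_def)
  have c: "C1_with W ?c ?k"
  proof (rule C1_withI)
    fix x assume "x \<in> W"
    then show "(?c has_derivative (\<lambda>h. ?k x \<bullet> h)) (at x within W)"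
      using lower_end_gradient(2)[OF _ def, of x] by (simp add: W_def has_derivative_at_withinI)
  next
    have "continuous_on W (\<lambda>x. g (lower_pt x))"
      by (rule continuous_on_compose2[OF g_cont continuous_on_subset[OF contA]]) (auto simp: W_def)
    then show "continuous_on W ?k" using ne by (intro continuous_intros) auto
  qed
  have gA: "C1_on W (\<lambda>x. g (lower_pt x) \<bullet> v)" for v
    unfolding lower_pt_def
    by (rule C1_on_shear[OF gH]) (use c C1_on_iff_with in \<open>auto simp: W_def lower_pt_def\<close>)
  have "C1_on W (\<lambda>x. ?k x \<bullet> v)" for v
  proof (rule C1_on_cong)
    show "C1_on W (\<lambda>x. - 1 * (inverse (g (lower_pt x) \<bullet> e) * (g (lower_pt x) \<bullet> v)))"
      by (intro C1_on_mult C1_on_const C1_on_inverse gA ne)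
  qed (simp add: divide_inverse)
  then have "C2_on W ?c" unfolding C2_on_iff using c by blast
  from C2_on_add[OF this C2_on_inner[of W e]] have "C2_on W lower" by simp
  then show "\<exists>V. open V \<and> x0 \<in> V \<and> V \<subseteq> cylinder \<and> C2_on V lower"
    using openW x0 U(2) by (intro exI[of _ W]) (auto simp: W_def)
qed

text \<open>
  Reversing \<open>e\<close> exchanges the two ends of each chord and changes their signs, which transfers the
  results on lower ends to upper ends.
\<close>

lemma reversed: "chord_domain \<Omega> (- e)"
  using open_dom convex_dom bounded_dom C2_bd unit_e by unfold_locales auto

lemma cylinder_reversed: "chord_domain.cylinder \<Omega> (- e) = cylinder"
  by (auto simp: chord_domain.cylinder_def[OF reversed] cylinder_def Y_set_def proj_perp_minus)

lemma lower_reversed: "x \<in> cylinder \<Longrightarrow> chord_domain.lower \<Omega> (- e) x = - upper x"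
proof -
  assume x: "x \<in> cylinder"
  interpret r: chord_domain \<Omega> "- e" by (rule reversed)
  have y: "P x \<in> Y_set \<Omega> e" "P x \<in> Y_set \<Omega> (- e)"
    using x by (auto simp: cylinder_def Y_set_def proj_perp_minus)
  have "{s. P x + s *\<^sub>R (- e) \<in> \<Omega>} = uminus ` {s. P x + s *\<^sub>R e \<in> \<Omega>}"
    by (force simp: image_iff intro: exI[of _ "- _"])
  also have "\<dots> = {- upper x<..<- lower x}"
    using chord_interval[OF y(1)] by (simp add: lower_def upper_def)
  finally have "{alpha \<Omega> (- e) (P x)<..<beta \<Omega> (- e) (P x)} = {- upper x<..<- lower x}"
    using r.chord_interval[OF y(2)] by simp
  then have "alpha \<Omega> (- e) (P x) = - upper x"
    using r.chord_interval[OF y(2)] lower_less_upper[OF x] cInf_greaterThanLessThan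
    by (metis neg_less_iff_less)
  then show ?thesis by (simp add: r.lower_def proj_perp_minus)
qed

lemma C2_on_upper: "C2_on cylinder upper"
proof -
  have "C2_on cylinder (\<lambda>x. 0 - chord_domain.lower \<Omega> (- e) x)"
    using chord_domain.C2_on_lower[OF reversed] C2_on_const by (intro C2_on_diff) (simp_all add: cylinder_reversed)
  then show ?thesis by (rule C2_on_cong) (simp add: lower_reversed)
qed

text \<open>
  The map \<open>lower_pt\<close> sends a full neighbourhood of \<open>x\<close> into \<open>\<Gamma>\<close>, where \<open>\<phi>\<close> vanishes. Hence the
  derivative of \<open>\<phi>\<close> annihilates the image of the derivative of \<open>lower_pt\<close>, which is the tangent space.
\<close>

lemma gradient_normal_lower:
  assumes x: "x \<in> Gamma \<Omega> e" "e \<bullet> x = lower x"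
    and \<phi>: "(\<phi> has_derivative (\<lambda>h. D \<bullet> h)) (at x within closure \<Omega>)"
    and zero: "\<And>z. z \<in> Gamma \<Omega> e \<Longrightarrow> \<phi> z = 0"
  shows "D = ((D \<bullet> e) / (\<nu> x \<bullet> e)) *\<^sub>R \<nu> x"
proof -
  have xZ: "x \<in> cylinder" using x Gamma_eq by blast
  have Ax: "lower_pt x = x" using lower_pt_id[OF xZ x(2)] .
  define k where "k = - (1 / (\<nu> x \<bullet> e)) *\<^sub>R \<nu> x"
  have "(lower_pt has_derivative (\<lambda>h. h + (k \<bullet> h) *\<^sub>R e)) (at x within cylinder)"
    unfolding lower_pt_def
    by (intro has_derivative_add has_derivative_ident has_derivative_scaleR_left)
      (use has_derivative_at_withinI[OF lower_end_gradient_normal[OF xZ]] in \<open>simp add: Ax k_def\<close>)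
  moreover have "(\<phi> has_derivative (\<lambda>h. D \<bullet> h)) (at (lower_pt x) within lower_pt ` cylinder)"
    unfolding Ax by (rule has_derivative_subset[OF \<phi>]) (use lower_pt_in in \<open>auto simp: frontier_def\<close>)
  ultimately have "(\<phi> \<circ> lower_pt has_derivative (\<lambda>h. D \<bullet> h) \<circ> (\<lambda>h. h + (k \<bullet> h) *\<^sub>R e)) (at x within cylinder)"
    by (rule diff_chain_within)
  then have "(\<phi> \<circ> lower_pt has_derivative (\<lambda>h. (D + (D \<bullet> e) *\<^sub>R k) \<bullet> h)) (at x within cylinder)"
    by (rule has_derivative_eq_rhs) (simp add: fun_eq_iff inner_add_left inner_add_right)
  then have 1: "(\<phi> \<circ> lower_pt has_derivative (\<lambda>h. (D + (D \<bullet> e) *\<^sub>R k) \<bullet> h)) (at x)"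
    using at_within_open[OF xZ open_cylinder] by simp
  have "((\<lambda>z. 0) has_derivative (\<lambda>h. (D + (D \<bullet> e) *\<^sub>R k) \<bullet> h)) (at x)"
    by (rule has_derivative_transform_within_open[OF 1 open_cylinder xZ]) (use zero lower_pt_in Gamma_eq in auto)
  then have "D + (D \<bullet> e) *\<^sub>R k = 0" by (rule gradient_unique) simp
  then show ?thesis by (simp add: k_def)
qed

lemma gradient_normal:
  assumes x: "x \<in> Gamma \<Omega> e"
    and \<phi>: "(\<phi> has_derivative (\<lambda>h. D \<bullet> h)) (at x within closure \<Omega>)"
    and zero: "\<And>z. z \<in> Gamma \<Omega> e \<Longrightarrow> \<phi> z = 0"
  shows "D = ((D \<bullet> e) / (\<nu> x \<bullet> e)) *\<^sub>R \<nu> x"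
proof (cases "e \<bullet> x = lower x")
  case True
  then show ?thesis using gradient_normal_lower assms by blast
next
  case False
  have xZ: "x \<in> frontier \<Omega>" "x \<in> cylinder" using x Gamma_eq by auto
  have "- e \<bullet> x = chord_domain.lower \<Omega> (- e) x"
    using False mem_frontier_iff[OF xZ(2)] xZ(1) lower_reversed[OF xZ(2)] by simp
  moreover have "Gamma \<Omega> (- e) = Gamma \<Omega> e" by (simp add: Gamma_def)
  ultimately show ?thesis
    using chord_domain.gradient_normal_lower[OF reversed, of x \<phi> D] x \<phi> zero by simp
qed

text \<open>
  Two gradients agree on every direction \<open>p - x\<close> with \<open>p\<close> in the open set \<open>\<Omega>\<close>, and these
  directions span the space.
\<close>

lemma boundary_gradient_unique:
  assumes x: "x \<in> frontier \<Omega>"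
    and "has_boundary_gradient \<Omega> f x D" "has_boundary_gradient \<Omega> f x D'"
  shows "D = D'"
proof -
  have diff0: "((\<lambda>z. 0) has_derivative (\<lambda>h. (D1 - D2) \<bullet> h)) (at x within closure \<Omega>)"
    if "has_boundary_gradient \<Omega> f x D1" "has_boundary_gradient \<Omega> f x D2" for D1 D2
    using has_derivative_diff[OF that[unfolded has_boundary_gradient_def]]
    by (simp add: inner_diff_left)
  have inside: "x + t *\<^sub>R (p - x) \<in> closure \<Omega>" if "p \<in> \<Omega>" "0 < t" "t < 1" for p t
    using segment_into_convex_open[OF open_dom convex_dom _ that] x closure_subset
    by (auto simp: frontier_def)
  have zero: "(D - D') \<bullet> (p - x) = 0" if p: "p \<in> \<Omega>" for p
  proof -
    have "(D - D') \<bullet> (p - x) \<le> 0" "(D' - D) \<bullet> (p - x) \<le> 0"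
      using inside[OF p]
      by (intro one_sided_derivative_nonpos[OF diff0[OF assms(2,3)], of 1]
          one_sided_derivative_nonpos[OF diff0[OF assms(3,2)], of 1]; simp)+
    then show ?thesis by (simp add: inner_diff_left)
  qed
  obtain p where p: "p \<in> \<Omega>" using x by fastforce
  obtain d where d: "d > 0" "\<And>t. \<bar>t\<bar> < d \<Longrightarrow> p + t *\<^sub>R (D - D') \<in> \<Omega>"
    using eventually_line_in_open[OF open_dom p] by metis
  have "(D - D') \<bullet> ((p + (d/2) *\<^sub>R (D - D')) - x) = 0" by (rule zero) (use d in auto)
  moreover have "(p + (d/2) *\<^sub>R (D - D')) - x = (p - x) + (d/2) *\<^sub>R (D - D')" by simp
  ultimately have "(d/2) * ((D - D') \<bullet> (D - D')) = 0"
    using zero[OF p] by (simp only: inner_add_right inner_scaleR_right)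
  then show ?thesis using d(1) by simp
qed

lemma normal_derivative_eq:
  assumes "x \<in> frontier \<Omega>" "has_boundary_gradient \<Omega> f x D"
  shows "normal_derivative \<Omega> f x = D \<bullet> \<nu> x"
proof -
  have "boundary_gradient \<Omega> f x = D"
    unfolding boundary_gradient_def
  proof (rule the_equality)
    show "has_boundary_gradient \<Omega> f x D" by (rule assms(2))
    show "D' = D" if "has_boundary_gradient \<Omega> f x D'" for D'
      by (rule boundary_gradient_unique[OF assms(1) that assms(2)])
  qed
  then show ?thesis by (simp add: normal_derivative_def)
qed

end

section \<open>The two-point problem along chords\<close>

text \<open>
  The right-hand side is the solution of \<open>v'' = \<phi>\<close> with \<open>v(\<alpha>) = v'(\<alpha>) = 0\<close>. On the left the
  interval of integration is fixed, which is what differentiation under the integral sign needs. The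
  identity is the fundamental theorem of calculus for the composition of
  \<open>t \<mapsto> \<integral>\<^sub>\<alpha>\<^sup>t (s - \<sigma>) \<phi>(\<sigma>) d\<sigma>\<close> with \<open>\<tau> \<mapsto> \<alpha> + \<tau> (s - \<alpha>)\<close>; unlike a substitution, this includes \<open>s = \<alpha>\<close>.
\<close>

lemma taylor_remainder_unit_interval:
  fixes \<phi> :: "real \<Rightarrow> real"
  assumes \<phi>: "continuous_on {\<alpha>..\<beta>} \<phi>" and s: "s \<in> {\<alpha>..\<beta>}"
  shows "(s - \<alpha>)\<^sup>2 * integral {0..1} (\<lambda>\<tau>. (1 - \<tau>) * \<phi> (\<alpha> + \<tau> * (s - \<alpha>)))
    = integral {\<alpha>..s} (\<lambda>\<sigma>. (s - \<sigma>) * \<phi> \<sigma>)"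
proof -
  define K where "K t = integral {\<alpha>..t} (\<lambda>\<sigma>. (s - \<sigma>) * \<phi> \<sigma>)" for t
  define G where "G \<tau> = K (\<alpha> + \<tau> * (s - \<alpha>))" for \<tau>
  have cont: "continuous_on {\<alpha>..s} (\<lambda>\<sigma>. (s - \<sigma>) * \<phi> \<sigma>)"
    using s by (intro continuous_intros continuous_on_subset[OF \<phi>]) auto
  have K: "(K has_real_derivative (s - t) * \<phi> t) (at t within {\<alpha>..s})" if "t \<in> {\<alpha>..s}" for t
    unfolding K_def by (rule integral_has_real_derivative[OF cont that])
  have img: "\<alpha> + \<tau> * (s - \<alpha>) \<in> {\<alpha>..s}" if "\<tau> \<in> {0..1}" for \<tau>
    using that s mult_left_le_one_le[of "s - \<alpha>" \<tau>] by auto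
  have "(G has_vector_derivative (s - \<alpha>)\<^sup>2 * ((1 - \<tau>) * \<phi> (\<alpha> + \<tau> * (s - \<alpha>)))) (at \<tau> within {0..1})"
    if \<tau>: "\<tau> \<in> {0..1}" for \<tau>
  proof -
    have 1: "((\<lambda>\<tau>. \<alpha> + \<tau> * (s - \<alpha>)) has_real_derivative (s - \<alpha>)) (at \<tau> within {0..1})"
      by (auto intro!: derivative_eq_intros)
    have 2: "(K has_real_derivative (s - (\<alpha> + \<tau> * (s - \<alpha>))) * \<phi> (\<alpha> + \<tau> * (s - \<alpha>)))
        (at (\<alpha> + \<tau> * (s - \<alpha>)) within (\<lambda>\<tau>. \<alpha> + \<tau> * (s - \<alpha>)) ` {0..1})"
      by (rule DERIV_subset[OF K[OF img[OF \<tau>]]]) (use img in auto)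
    have "(s - (\<alpha> + \<tau> * (s - \<alpha>))) * \<phi> (\<alpha> + \<tau> * (s - \<alpha>)) * (s - \<alpha>)
        = (s - \<alpha>)\<^sup>2 * ((1 - \<tau>) * \<phi> (\<alpha> + \<tau> * (s - \<alpha>)))"
      by (simp add: power2_eq_square algebra_simps)
    moreover have "(G has_real_derivative (s - (\<alpha> + \<tau> * (s - \<alpha>))) * \<phi> (\<alpha> + \<tau> * (s - \<alpha>)) * (s - \<alpha>))
        (at \<tau> within {0..1})"
      using DERIV_image_chain[OF 2 1] by (simp only: G_def[abs_def] o_def)
    ultimately show ?thesis by (simp only: has_real_derivative_iff_has_vector_derivative)
  qed
  then have "((\<lambda>\<tau>. (s - \<alpha>)\<^sup>2 * ((1 - \<tau>) * \<phi> (\<alpha> + \<tau> * (s - \<alpha>)))) has_integral G 1 - G 0) {0..1}"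
    by (intro fundamental_theorem_of_calculus) auto
  then have "integral {0..1} (\<lambda>\<tau>. (s - \<alpha>)\<^sup>2 * ((1 - \<tau>) * \<phi> (\<alpha> + \<tau> * (s - \<alpha>)))) = G 1 - G 0"
    by (rule integral_unique)
  then show ?thesis by (simp add: G_def K_def)
qed

lemma twice_integrated_derivatives:
  fixes \<phi> :: "real \<Rightarrow> real"
  assumes \<phi>: "continuous_on {\<alpha>..\<beta>} \<phi>" and s: "\<alpha> < s" "s < \<beta>"
  shows "((\<lambda>s. integral {\<alpha>..s} (\<lambda>\<sigma>. (s - \<sigma>) * \<phi> \<sigma>)) has_real_derivative integral {\<alpha>..s} \<phi>) (at s)"
    and "((\<lambda>s. integral {\<alpha>..s} \<phi>) has_real_derivative \<phi> s) (at s)"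
proof -
  have at: "at s within {\<alpha>..\<beta>} = at s" using s by (simp add: at_within_Icc_at)
  have c2: "continuous_on {\<alpha>..\<beta>} (\<lambda>\<sigma>. \<sigma> * \<phi> \<sigma>)" by (intro continuous_intros \<phi>)
  show 1: "((\<lambda>s. integral {\<alpha>..s} \<phi>) has_real_derivative \<phi> s) (at s)"
    using integral_has_real_derivative[OF \<phi>, of s] s at by simp
  have 2: "((\<lambda>s. integral {\<alpha>..s} (\<lambda>\<sigma>. \<sigma> * \<phi> \<sigma>)) has_real_derivative s * \<phi> s) (at s)"
    using integral_has_real_derivative[OF c2, of s] s at by simp
  have 3: "((\<lambda>s. s * integral {\<alpha>..s} \<phi> - integral {\<alpha>..s} (\<lambda>\<sigma>. \<sigma> * \<phi> \<sigma>))
      has_real_derivative integral {\<alpha>..s} \<phi>) (at s)"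
    using 1 2 by (auto intro!: derivative_eq_intros)
  have eq: "t * integral {\<alpha>..t} \<phi> - integral {\<alpha>..t} (\<lambda>\<sigma>. \<sigma> * \<phi> \<sigma>)
      = integral {\<alpha>..t} (\<lambda>\<sigma>. (t - \<sigma>) * \<phi> \<sigma>)" if "t \<in> {\<alpha><..<\<beta>}" for t
  proof -
    have i: "\<phi> integrable_on {\<alpha>..t}" "(\<lambda>\<sigma>. \<sigma> * \<phi> \<sigma>) integrable_on {\<alpha>..t}"
      using that by (auto intro!: integrable_continuous_interval continuous_on_subset[OF \<phi>]
          continuous_on_subset[OF c2])
    have "integral {\<alpha>..t} (\<lambda>\<sigma>. t * \<phi> \<sigma> - \<sigma> * \<phi> \<sigma>)
        = t * integral {\<alpha>..t} \<phi> - integral {\<alpha>..t} (\<lambda>\<sigma>. \<sigma> * \<phi> \<sigma>)"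
      using i by (simp add: integral_diff integrable_on_mult_right)
    then show ?thesis by (simp add: left_diff_distrib)
  qed
  show "((\<lambda>s. integral {\<alpha>..s} (\<lambda>\<sigma>. (s - \<sigma>) * \<phi> \<sigma>)) has_real_derivative integral {\<alpha>..s} \<phi>) (at s)"
    by (rule has_field_derivative_transform_within_open[OF 3, of "{\<alpha><..<\<beta>}"]) (use s eq in auto)
qed

text \<open>
  The difference of two solutions has constant derivative \<open>C\<close> inside the interval. The mean value
  theorem carries this up to the end points, where the difference vanishes, so \<open>C = 0\<close>.
\<close>

lemma two_point_problem_unique:
  fixes v1 v2 :: "real \<Rightarrow> real"
  assumes c: "continuous_on {\<alpha>..\<beta>} v1" "continuous_on {\<alpha>..\<beta>} v2"
    and d1: "\<And>s. s \<in> {\<alpha><..<\<beta>} \<Longrightarrow> (v1 has_real_derivative v1' s) (at s)"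
      "\<And>s. s \<in> {\<alpha><..<\<beta>} \<Longrightarrow> (v1' has_real_derivative f s) (at s)"
    and d2: "\<And>s. s \<in> {\<alpha><..<\<beta>} \<Longrightarrow> (v2 has_real_derivative v2' s) (at s)"
      "\<And>s. s \<in> {\<alpha><..<\<beta>} \<Longrightarrow> (v2' has_real_derivative f s) (at s)"
    and ends: "v1 \<alpha> = v2 \<alpha>" "v1 \<beta> = v2 \<beta>" and s: "s \<in> {\<alpha>..\<beta>}"
  shows "v1 s = v2 s"
proof (cases "s = \<alpha>")
  case False
  then have s: "\<alpha> < s" "s \<le> \<beta>" using s by auto
  define d where "d s = v1 s - v2 s" for s
  have "\<exists>C. \<forall>s\<in>{\<alpha><..<\<beta>}. v1' s - v2' s = C"
  proof (rule has_derivative_zero_constant)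
    fix s assume "s \<in> {\<alpha><..<\<beta>}"
    then have "((\<lambda>s. v1' s - v2' s) has_real_derivative 0) (at s within {\<alpha><..<\<beta>})"
      using DERIV_diff[OF d1(2) d2(2)] has_field_derivative_at_within by force
    then show "((\<lambda>s. v1' s - v2' s) has_derivative (\<lambda>h. 0)) (at s within {\<alpha><..<\<beta>})"
      by (simp add: has_field_derivative_def lambda_zero)
  qed simp
  then obtain C where C: "\<And>s. s \<in> {\<alpha><..<\<beta>} \<Longrightarrow> v1' s - v2' s = C" by blast
  have d: "(d has_real_derivative C) (at s)" if "s \<in> {\<alpha><..<\<beta>}" for s
    unfolding d_def using DERIV_diff[OF d1(1) d2(1)] C that by auto
  have lin: "d t - d \<alpha> = (t - \<alpha>) * C" if t: "\<alpha> < t" "t \<le> \<beta>" for t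
  proof -
    have "continuous_on {\<alpha>..t} d"
      unfolding d_def using t
      by (intro continuous_intros continuous_on_subset[OF c(1)] continuous_on_subset[OF c(2)]) auto
    moreover have "d differentiable (at x)" if "\<alpha> < x" "x < t" for x
      using d[of x] that t real_differentiable_def by auto
    ultimately obtain l z where z: "\<alpha> < z" "z < t" "DERIV d z :> l" "d t - d \<alpha> = (t - \<alpha>) * l"
      using MVT[OF t(1)] by blast
    have "l = C" using DERIV_unique[OF z(3) d] z t by simp
    then show ?thesis using z by simp
  qed
  have "C = 0" using lin[of \<beta>] s ends by (simp add: d_def)
  then show ?thesis using lin[OF s] ends by (simp add: d_def)
qed (simp add: ends)

text \<open>
  Reads the quadratic form of the Hessian in a direction \<open>d\<close> off the restriction of \<open>f\<close> to a line;
  this is how the ordinary differential equation on chords enters the partial differential equation.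
\<close>

lemma second_derivative_along_line:
  assumes S: "open S" "x \<in> S" and f: "C2_with S f g H"
    and v: "\<epsilon> > 0" "\<And>s. \<bar>s\<bar> < \<epsilon> \<Longrightarrow> ((\<lambda>s. f (x + s *\<^sub>R d)) has_real_derivative v' s) (at s)"
    and l: "(v' has_real_derivative l) (at 0)"
  shows "H x d \<bullet> d = l"
proof -
  obtain \<epsilon>' where \<epsilon>': "\<epsilon>' > 0" "\<And>s. \<bar>s\<bar> < \<epsilon>' \<Longrightarrow> x + s *\<^sub>R d \<in> S"
    using eventually_line_in_open[OF S] by metis
  have fd: "(f has_derivative (\<lambda>h. g z \<bullet> h)) (at z)" and gd: "(g has_derivative H z) (at z)"
    if "z \<in> S" for z
    using f that at_within_open[OF that S(1)] by (auto simp: C2_with_def)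
  have eq: "v' s = g (x + s *\<^sub>R d) \<bullet> d" if "s \<in> {- min \<epsilon> \<epsilon>'<..<min \<epsilon> \<epsilon>'}" for s
    using DERIV_unique[OF v(2) has_real_derivative_along_line[OF fd[OF \<epsilon>'(2)]], of s] that by auto
  have "((\<lambda>s. x + s *\<^sub>R d) has_derivative (\<lambda>h. h *\<^sub>R d)) (at 0)"
    by (auto intro!: derivative_eq_intros)
  from has_derivative_compose[OF this, of g "H x"] gd[OF S(2)]
  have "((\<lambda>s. g (x + s *\<^sub>R d)) has_derivative (\<lambda>h. H x (h *\<^sub>R d))) (at 0)" by simp
  from has_derivative_inner_left[OF this, of d]
  have "((\<lambda>s. g (x + s *\<^sub>R d) \<bullet> d) has_real_derivative H x d \<bullet> d) (at 0)"
    by (simp add: has_field_derivative_def blinfun.scaleR_right mult.commute[of _ "H x d \<bullet> d"])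
  then have "(v' has_real_derivative H x d \<bullet> d) (at 0)"
    by (rule has_field_derivative_transform_within_open[of _ _ _ "{- min \<epsilon> \<epsilon>'<..<min \<epsilon> \<epsilon>'}"])
      (use eq \<epsilon>' v(1) in auto)
  then show ?thesis using DERIV_unique l by blast
qed

locale chord_problem = chord_domain \<Omega> e for \<Omega> :: "'a::euclidean_space set" and e +
  fixes q :: "'a \<Rightarrow> real" and b :: real
  assumes C2_q: "C2_on (closure \<Omega>) q"
begin

abbreviation f where "f x \<equiv> q x * ell e b x"

text \<open>
  The union of all closed chords. It contains \<open>\<Omega>\<close> and \<open>\<Gamma>\<close>, is convex, and is relatively open in
  the closure of \<open>\<Omega>\<close>.
\<close>

definition closed_tube where "closed_tube = closure \<Omega> \<inter> cylinder"

text \<open>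
  With \<open>V(s)\<close> the solution of \<open>V'' = q \<ell>\<close> that vanishes to second order at the lower end \<open>\<alpha>\<close>, the
  solution of the two-point problem is \<open>V(s) - (s - \<alpha>) / (\<beta> - \<alpha>) V(\<beta>)\<close>. Here \<open>V(s)\<close> and \<open>V(\<beta>)\<close> are
  written by \<open>taylor_remainder_unit_interval\<close>; the factor \<open>(\<beta> - \<alpha>)\<^sup>2\<close> in \<open>V(\<beta>)\<close> cancels the denominator.
\<close>

definition chord_formula where
  "chord_formula x = (e \<bullet> x - lower x) * (e \<bullet> x - lower x)
      * integral {0..1} (\<lambda>\<tau>. (1 - \<tau>) * f (x + ((lower x - e \<bullet> x) + \<tau> * (e \<bullet> x - lower x)) *\<^sub>R e))
    - (e \<bullet> x - lower x) * (upper x - lower x)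
      * integral {0..1} (\<lambda>\<tau>. (1 - \<tau>) * f (x + ((lower x - e \<bullet> x) + \<tau> * (upper x - lower x)) *\<^sub>R e))"

lemma convex_closed_tube: "convex closed_tube"
  unfolding closed_tube_def by (intro convex_Int convex_closure convex_dom convex_cylinder)

lemma closed_tube_mem: "x \<in> closed_tube \<longleftrightarrow> x \<in> cylinder \<and> lower x \<le> e \<bullet> x \<and> e \<bullet> x \<le> upper x"
  using mem_closure_iff by (auto simp: closed_tube_def)

lemma dom_subset_closed_tube: "\<Omega> \<subseteq> closed_tube"
  using dom_subset_cylinder closure_subset by (auto simp: closed_tube_def)

lemma Gamma_subset_closed_tube: "Gamma \<Omega> e \<subseteq> closed_tube"
  using Gamma_eq by (auto simp: closed_tube_def frontier_def)

lemma C2_f: "C2_on (closure \<Omega>) f"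
  unfolding ell_def by (intro C2_on_mult C2_q C2_on_add C2_on_inner C2_on_const)

lemma C2_chord_formula: "C2_on closed_tube chord_formula"
proof -
  have lower: "C2_on closed_tube lower" and upper: "C2_on closed_tube upper"
    using C2_on_subset[OF C2_on_lower] C2_on_subset[OF C2_on_upper] by (auto simp: closed_tube_def)
  have in_cl: "x + (c0 x + \<tau> * c1 x) *\<^sub>R e \<in> closure \<Omega>"
    if "x \<in> closed_tube" "\<tau> \<in> {0..1}" "c0 x = lower x - e \<bullet> x" "0 \<le> c1 x" "c1 x \<le> upper x - lower x"
    for x \<tau> and c0 c1 :: "'a \<Rightarrow> real"
  proof -
    have "0 \<le> \<tau> * c1 x" "\<tau> * c1 x \<le> upper x - lower x"
      using that mult_left_le_one_le[of "c1 x" \<tau>] by auto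
    then show ?thesis
      using that mem_closure_iff[of "x + (c0 x + \<tau> * c1 x) *\<^sub>R e"] closed_tube_mem[of x]
      by (simp add: inner_add_right)
  qed
  show ?thesis
    unfolding chord_formula_def
  proof (intro C2_on_diff C2_on_mult lower upper C2_on_inner)
    show "C2_on closed_tube (\<lambda>x. integral {0..1}
        (\<lambda>\<tau>. (1 - \<tau>) * f (x + ((lower x - e \<bullet> x) + \<tau> * (e \<bullet> x - lower x)) *\<^sub>R e)))"
      by (rule C2_on_segment_integral[OF C2_f _ _ convex_closed_tube])
        (auto intro!: C2_on_diff lower C2_on_inner continuous_intros
          in_cl[of _ _ "\<lambda>x. lower x - e \<bullet> x" "\<lambda>x. e \<bullet> x - lower x"] simp: closed_tube_mem)
    show "C2_on closed_tube (\<lambda>x. integral {0..1}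
        (\<lambda>\<tau>. (1 - \<tau>) * f (x + ((lower x - e \<bullet> x) + \<tau> * (upper x - lower x)) *\<^sub>R e)))"
      by (rule C2_on_segment_integral[OF C2_f _ _ convex_closed_tube])
        (auto intro!: C2_on_diff lower upper C2_on_inner continuous_intros less_imp_le[OF lower_less_upper]
          in_cl[of _ _ "\<lambda>x. lower x - e \<bullet> x" "\<lambda>x. upper x - lower x"] simp: closed_tube_mem)
  qed
qed

lemma Y_facts:
  assumes "y \<in> Y_set \<Omega> e"
  shows "P y = y" "e \<bullet> y = 0" "y \<in> cylinder" "lower y = alpha \<Omega> e y" "upper y = beta \<Omega> e y"
proof -
  obtain z where z: "z \<in> \<Omega>" "y = P z" using assms by (auto simp: Y_set_def)
  show y: "P y = y" "e \<bullet> y = 0" using z by auto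
  show "y \<in> cylinder" "lower y = alpha \<Omega> e y" "upper y = beta \<Omega> e y"
    using assms by (simp_all add: cylinder_def lower_def upper_def y)
qed

lemma chord_in_closed_tube:
  assumes "y \<in> Y_set \<Omega> e" "s \<in> {alpha \<Omega> e y..beta \<Omega> e y}"
  shows "y + s *\<^sub>R e \<in> closed_tube"
  using assms Y_facts[OF assms(1)] by (simp add: closed_tube_mem inner_add_right)

lemma chord_bvp_chord_formula:
  assumes y: "y \<in> Y_set \<Omega> e"
  shows "chord_bvp \<Omega> q e b y (\<lambda>s. chord_formula (y + s *\<^sub>R e))"
proof -
  let ?\<alpha> = "alpha \<Omega> e y" and ?\<beta> = "beta \<Omega> e y"
  define \<phi> where "\<phi> s = q (y + s *\<^sub>R e) * (s + b)" for s
  note Y = Y_facts[OF y]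
  have less: "?\<alpha> < ?\<beta>" using chord_interval[OF y] by simp
  have line_cont: "continuous_on {?\<alpha>..?\<beta>} (\<lambda>s. F (y + s *\<^sub>R e))" if "continuous_on closed_tube F"
    for F :: "'a \<Rightarrow> real"
    by (rule continuous_on_compose2[OF that]) (use chord_in_closed_tube[OF y] in \<open>auto intro!: continuous_intros\<close>)
  have "continuous_on closed_tube q"
    by (rule continuous_on_subset[OF C1_on_continuous[OF C2_on_imp_C1_on[OF C2_q]]]) (simp add: closed_tube_def)
  then have \<phi>: "continuous_on {?\<alpha>..?\<beta>} \<phi>"
    unfolding \<phi>_def by (intro continuous_intros line_cont)
  have f_line: "f (y + \<sigma> *\<^sub>R e) = \<phi> \<sigma>" for \<sigma>
    by (simp add: \<phi>_def ell_def inner_add_right Y)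
  define J where "J s = integral {0..1} (\<lambda>\<tau>. (1 - \<tau>) * \<phi> (?\<alpha> + \<tau> * (s - ?\<alpha>)))" for s
  define C where "C = - (?\<beta> - ?\<alpha>) * J ?\<beta>"
  have W_line: "chord_formula (y + s *\<^sub>R e) = integral {?\<alpha>..s} (\<lambda>\<sigma>. (s - \<sigma>) * \<phi> \<sigma>) + C * (s - ?\<alpha>)"
    if s: "s \<in> {?\<alpha>..?\<beta>}" for s
  proof -
    have pt: "y + s *\<^sub>R e + (?\<alpha> - s + r) *\<^sub>R e = y + (?\<alpha> + r) *\<^sub>R e" for r
      by (simp add: algebra_simps)
    have "chord_formula (y + s *\<^sub>R e) = (s - ?\<alpha>) * (s - ?\<alpha>) * J s - (s - ?\<alpha>) * (?\<beta> - ?\<alpha>) * J ?\<beta>"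
      unfolding chord_formula_def J_def
      by (simp add: inner_add_right Y pt f_line del: scaleR_add_left)
    also have "\<dots> = (s - ?\<alpha>)\<^sup>2 * J s + C * (s - ?\<alpha>)"
      by (simp add: C_def power2_eq_square algebra_simps)
    finally show ?thesis using taylor_remainder_unit_interval[OF \<phi> s] by (simp add: J_def)
  qed
  show ?thesis
    unfolding chord_bvp_def
  proof (intro conjI exI[of _ "\<lambda>s. integral {?\<alpha>..s} \<phi> + C"] ballI)
    show "continuous_on {?\<alpha>..?\<beta>} (\<lambda>s. chord_formula (y + s *\<^sub>R e))"
      by (rule line_cont[OF C1_on_continuous[OF C2_on_imp_C1_on[OF C2_chord_formula]]])
    fix s assume s: "s \<in> {?\<alpha><..<?\<beta>}"
    then have s': "?\<alpha> < s" "s < ?\<beta>" by auto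
    note der = twice_integrated_derivatives[OF \<phi> s']
    have "((\<lambda>s. integral {?\<alpha>..s} (\<lambda>\<sigma>. (s - \<sigma>) * \<phi> \<sigma>) + C * (s - ?\<alpha>))
        has_real_derivative integral {?\<alpha>..s} \<phi> + C) (at s)"
      using der(1) by (auto intro!: derivative_eq_intros)
    then show "((\<lambda>s. chord_formula (y + s *\<^sub>R e)) has_real_derivative integral {?\<alpha>..s} \<phi> + C) (at s)"
      by (rule has_field_derivative_transform_within_open[of _ _ _ "{?\<alpha><..<?\<beta>}"])
        (use s W_line in auto)
    show "((\<lambda>s. integral {?\<alpha>..s} \<phi> + C) has_real_derivative q (y + s *\<^sub>R e) * (s + b)) (at s)"
      using der(2) by (auto intro!: derivative_eq_intros simp: \<phi>_def)
  next
    show "chord_formula (y + ?\<alpha> *\<^sub>R e) = 0" using W_line[of ?\<alpha>] less by simp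
    show "chord_formula (y + ?\<beta> *\<^sub>R e) = 0" by (simp add: chord_formula_def inner_add_right Y)
  qed
qed

lemma chord_bvp_unique:
  assumes y: "y \<in> Y_set \<Omega> e" and v: "chord_bvp \<Omega> q e b y v1" "chord_bvp \<Omega> q e b y v2"
    and s: "s \<in> {alpha \<Omega> e y..beta \<Omega> e y}"
  shows "v1 s = v2 s"
proof -
  obtain v1' where v1': "\<forall>s\<in>{alpha \<Omega> e y<..<beta \<Omega> e y}. (v1 has_real_derivative v1' s) (at s) \<and>
       (v1' has_real_derivative q (y + s *\<^sub>R e) * (s + b)) (at s)"
    using v(1) unfolding chord_bvp_def by blast
  obtain v2' where v2': "\<forall>s\<in>{alpha \<Omega> e y<..<beta \<Omega> e y}. (v2 has_real_derivative v2' s) (at s) \<and>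
       (v2' has_real_derivative q (y + s *\<^sub>R e) * (s + b)) (at s)"
    using v(2) unfolding chord_bvp_def by blast
  show ?thesis
    by (rule two_point_problem_unique[of "alpha \<Omega> e y" "beta \<Omega> e y" v1 v2 v1'
          "\<lambda>s. q (y + s *\<^sub>R e) * (s + b)" v2'])
      (use v v1' v2' s in \<open>auto simp: chord_bvp_def\<close>)
qed

lemma chord_bvp_cong:
  assumes "chord_bvp \<Omega> q e b y v" "\<And>s. s \<in> {alpha \<Omega> e y..beta \<Omega> e y} \<Longrightarrow> v s = v2 s"
    "alpha \<Omega> e y \<le> beta \<Omega> e y"
  shows "chord_bvp \<Omega> q e b y v2"
proof -
  let ?I = "{alpha \<Omega> e y<..<beta \<Omega> e y}"
  obtain v' where v': "\<And>s. s \<in> ?I \<Longrightarrow> (v has_real_derivative v' s) (at s) \<and>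
       (v' has_real_derivative q (y + s *\<^sub>R e) * (s + b)) (at s)"
    using assms(1) unfolding chord_bvp_def by blast
  have "(v2 has_real_derivative v' s) (at s)" if "s \<in> ?I" for s
    by (rule has_field_derivative_transform_within_open[OF conjunct1[OF v'[OF that]], of ?I])
      (use that assms(2) in auto)
  moreover have "continuous_on {alpha \<Omega> e y..beta \<Omega> e y} v2"
    by (rule continuous_on_eq[of _ v]) (use assms(1,2) in \<open>simp_all add: chord_bvp_def\<close>)
  ultimately show ?thesis
    using assms v' unfolding chord_bvp_def by (metis atLeastAtMost_iff order_refl)
qed

lemma chord_solution_eq:
  assumes y: "y \<in> Y_set \<Omega> e"
  shows "chord_solution \<Omega> q e b y
    = (\<lambda>s. if s \<in> {alpha \<Omega> e y..beta \<Omega> e y} then chord_formula (y + s *\<^sub>R e) else 0)"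
    (is "_ = ?v")
  unfolding chord_solution_def
proof (rule the_equality)
  have less: "alpha \<Omega> e y < beta \<Omega> e y" using chord_interval[OF y] by simp
  note bvp = chord_bvp_chord_formula[OF y]
  have "chord_bvp \<Omega> q e b y ?v"
    by (rule chord_bvp_cong[OF bvp]) (use less in auto)
  then show "chord_bvp \<Omega> q e b y ?v \<and> (\<forall>s. s \<notin> {alpha \<Omega> e y..beta \<Omega> e y} \<longrightarrow> ?v s = 0)"
    by simp
  fix v assume v: "chord_bvp \<Omega> q e b y v \<and> (\<forall>s. s \<notin> {alpha \<Omega> e y..beta \<Omega> e y} \<longrightarrow> v s = 0)"
  show "v = ?v"
  proof
    fix s show "v s = ?v s"
      using chord_bvp_unique[OF y conjunct1[OF v] bvp, of s] v by auto
  qed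
qed

abbreviation w where "w \<equiv> w_fun \<Omega> q e b"

lemma w_eq_chord_formula: "x \<in> closed_tube \<Longrightarrow> w x = chord_formula x"
  using chord_solution_eq[of "P x"] closed_tube_mem[of x]
  by (simp add: w_fun_def cylinder_def lower_def upper_def proj_perp_split)

text \<open>
  The regularity of \<open>w\<close>, up to the boundary points in \<open>\<Gamma>\<close>. Chord tubes and small relative
  neighbourhoods of points of \<open>\<Gamma>\<close> are subsets of \<open>closed_tube\<close>, and within-derivatives restrict to subsets.
\<close>

lemma C2_w: "C2_on closed_tube w"
  by (rule C2_on_cong[OF C2_chord_formula]) (simp add: w_eq_chord_formula)

lemma chord_bvp_w:
  assumes y: "y \<in> Y_set \<Omega> e"
  shows "chord_bvp \<Omega> q e b y (\<lambda>s. w (y + s *\<^sub>R e))"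
  by (rule chord_bvp_cong[OF chord_bvp_chord_formula[OF y]])
    (use w_eq_chord_formula[OF chord_in_closed_tube[OF y]] chord_interval[OF y] in auto)

lemma w_Gamma: "x \<in> Gamma \<Omega> e \<Longrightarrow> w x = 0"
proof -
  assume x: "x \<in> Gamma \<Omega> e"
  then have xZ: "x \<in> cylinder" "x \<in> frontier \<Omega>" using Gamma_eq by auto
  have y: "P x \<in> Y_set \<Omega> e" using xZ by (simp add: cylinder_def)
  have "w (P x + lower x *\<^sub>R e) = 0" "w (P x + upper x *\<^sub>R e) = 0"
    using chord_bvp_w[OF y] by (simp_all add: chord_bvp_def lower_def upper_def)
  then show ?thesis
    using mem_frontier_iff[OF xZ(1)] xZ(2) proj_perp_split[of e x] by metis
qed

lemma w_second_derivative:
  assumes x: "x \<in> \<Omega>" and H: "C2_with \<Omega> w g H"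
  shows "H x e \<bullet> e = f x"
proof -
  have xZ: "x \<in> cylinder" using x dom_subset_cylinder by blast
  have y: "P x \<in> Y_set \<Omega> e" using xZ by (simp add: cylinder_def)
  obtain v' where v': "\<And>s. s \<in> {lower x<..<upper x} \<Longrightarrow>
       ((\<lambda>s. w (P x + s *\<^sub>R e)) has_real_derivative v' s) (at s) \<and>
       (v' has_real_derivative q (P x + s *\<^sub>R e) * (s + b)) (at s)"
    using chord_bvp_w[OF y] unfolding chord_bvp_def lower_def upper_def by blast
  have ex: "lower x < e \<bullet> x" "e \<bullet> x < upper x" using x mem_dom_iff[OF xZ] by auto
  define \<epsilon> where "\<epsilon> = min (e \<bullet> x - lower x) (upper x - e \<bullet> x)"
  have pt: "P x + (s + e \<bullet> x) *\<^sub>R e = x + s *\<^sub>R e" for s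
    by (simp add: proj_perp_def algebra_simps)
  have shift: "((\<lambda>s. s + e \<bullet> x) has_real_derivative 1) (at s)" for s
    by (auto intro!: derivative_eq_intros)
  show ?thesis
  proof (rule second_derivative_along_line[OF open_dom x H])
    show "\<epsilon> > 0" using ex by (simp add: \<epsilon>_def)
    show "((\<lambda>s. w (x + s *\<^sub>R e)) has_real_derivative v' (s + e \<bullet> x)) (at s)" if "\<bar>s\<bar> < \<epsilon>" for s
    proof -
      have "s + e \<bullet> x \<in> {lower x<..<upper x}" using that by (auto simp: \<epsilon>_def)
      from DERIV_chain2[OF conjunct1[OF v'[OF this]] shift] show ?thesis by (simp add: pt)
    qed
    have "((\<lambda>s. v' (s + e \<bullet> x)) has_real_derivative q (P x + (0 + e \<bullet> x) *\<^sub>R e) * (0 + e \<bullet> x + b) * 1) (at 0)"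
      by (rule DERIV_chain2[OF conjunct2[OF v'] shift]) (use ex in auto)
    then show "((\<lambda>s. v' (s + e \<bullet> x)) has_real_derivative f x) (at 0)"
      by (simp add: ell_def proj_perp_split)
  qed
qed

end

section \<open>Comparison with strict classical barriers\<close>

lemma C2_with_combine:
  assumes "C2_with S f1 g1 H1" "C2_with S f2 g2 H2"
  shows "C2_with S (\<lambda>x. f1 x + c * f2 x) (\<lambda>x. g1 x + c *\<^sub>R g2 x) (\<lambda>x. H1 x + c *\<^sub>R H2 x)"
  using assms unfolding C2_with_def
  by (auto intro!: derivative_eq_intros continuous_intros
      simp: inner_add_left blinfun.add_left blinfun.scaleR_left)

lemma C2_with_zero: "C2_with S (\<lambda>x. 0) (\<lambda>x. 0) (\<lambda>x. 0)"
  unfolding C2_with_def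
  by (auto intro!: has_derivative_eq_rhs[OF has_derivative_const] simp: fun_eq_iff)

lemma C2_with_ell: "C2_with S (\<lambda>x. ell e b x) (\<lambda>x. e) (\<lambda>x. 0)"
  unfolding C2_with_def ell_def by (auto intro!: derivative_eq_intros)

lemma C2_with_continuous:
  assumes "C2_with S f g H"
  shows "continuous_on S f" "continuous_on S g" "continuous_on S H"
  using assms has_derivative_continuous_on[of S f "\<lambda>x. (\<bullet>) (g x)"]
    has_derivative_continuous_on[of S g "\<lambda>x. blinfun_apply (H x)"]
  by (auto simp: C2_with_def)

lemma F_op_minus: "F_op q x (- r) (- p) (- X) = - F_op q x r p X"
  by (simp add: F_op_def blinfun.minus_left blinfun.minus_right)

lemma viscosity_supersolution_minus:
  assumes "viscosity_supersolution \<Omega> q u"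
  shows "viscosity_subsolution \<Omega> q (\<lambda>x. - u x)"
  unfolding viscosity_subsolution_def
proof (intro conjI allI impI)
  show "continuous_on \<Omega> (\<lambda>x. - u x)"
    using assms by (auto simp: viscosity_supersolution_def intro: continuous_on_minus)
  fix \<phi> g H x0
  assume "C2_with \<Omega> \<phi> g H \<and> x0 \<in> \<Omega> \<and>
    (\<exists>r>0. \<forall>x\<in>\<Omega> \<inter> ball x0 r. - u x - \<phi> x \<le> - u x0 - \<phi> x0)"
  then obtain r where \<phi>: "C2_with \<Omega> \<phi> g H" and x0: "x0 \<in> \<Omega>"
    and r: "r > 0" "\<And>x. x \<in> \<Omega> \<inter> ball x0 r \<Longrightarrow> - u x - \<phi> x \<le> - u x0 - \<phi> x0" by blast
  have "C2_with \<Omega> (\<lambda>x. - \<phi> x) (\<lambda>x. - g x) (\<lambda>x. - H x)"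
    using C2_with_combine[OF C2_with_zero \<phi>, of "-1"] by simp
  moreover have "\<forall>x\<in>\<Omega> \<inter> ball x0 r. u x - - \<phi> x \<ge> u x0 - - \<phi> x0"
    using r(2) by fastforce
  ultimately have "F_op q x0 (u x0) (- g x0) (- H x0) \<ge> 0"
    using assms x0 r(1) unfolding viscosity_supersolution_def by blast
  then show "F_op q x0 (- u x0) (g x0) (H x0) \<le> 0"
    using F_op_minus[of q x0 "u x0" "- g x0" "- H x0"] by simp
qed

text \<open>
  At a positive maximum of \<open>u - v\<close> in \<open>N\<close> the barrier is itself a test function. As \<open>q \<ge> 0\<close>, replacing
  the value \<open>u\<close> there by the smaller value \<open>v\<close> does not increase the operator, and strictness of the
  barrier contradicts the subsolution property. The barrier must be \<open>C\<^sup>2\<close> on all of \<open>\<Omega>\<close>, as test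
  functions are, but strict only on \<open>N\<close>.
\<close>

lemma viscosity_comparison_above:
  assumes u: "viscosity_subsolution \<Omega> q u" and v: "C2_with \<Omega> v g H"
    and T: "compact T" "continuous_on T u" "continuous_on T v"
    and N: "open N" "N \<subseteq> \<Omega>" "N \<subseteq> T"
    and bd: "\<And>x. x \<in> T - N \<Longrightarrow> u x \<le> v x"
    and q: "\<And>x. x \<in> N \<Longrightarrow> q x \<ge> 0"
    and F: "\<And>x. x \<in> N \<Longrightarrow> F_op q x (v x) (g x) (H x) > 0"
    and x: "x \<in> T"
  shows "u x \<le> v x"
proof (rule ccontr)
  assume neg: "\<not> u x \<le> v x"
  have "continuous_on T (\<lambda>x. u x - v x)" by (intro continuous_intros T)
  then obtain m where m: "m \<in> T" "\<And>z. z \<in> T \<Longrightarrow> u z - v z \<le> u m - v m"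
    using continuous_attains_sup[OF T(1)] x by blast
  have pos: "u m > v m" using m(2)[OF x] neg by simp
  then have mN: "m \<in> N" using bd[of m] m(1) by force
  then obtain r where r: "r > 0" "ball m r \<subseteq> N" using N(1) open_contains_ball by metis
  have "\<exists>r>0. \<forall>z\<in>\<Omega> \<inter> ball m r. u z - v z \<le> u m - v m"
    using r N(3) m(2) by blast
  then have "F_op q m (u m) (g m) (H m) \<le> 0"
    using u v mN N(2) unfolding viscosity_subsolution_def by blast
  moreover have "q m * v m \<le> q m * u m" using q[OF mN] pos by (simp add: mult_left_mono)
  ultimately show False using F[OF mN] by (simp add: F_op_def)
qed

lemma viscosity_comparison_below:
  assumes u: "viscosity_supersolution \<Omega> q u" and v: "C2_with \<Omega> v g H"
    and T: "compact T" "continuous_on T u" "continuous_on T v"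
    and N: "open N" "N \<subseteq> \<Omega>" "N \<subseteq> T"
    and bd: "\<And>x. x \<in> T - N \<Longrightarrow> v x \<le> u x"
    and q: "\<And>x. x \<in> N \<Longrightarrow> q x \<ge> 0"
    and F: "\<And>x. x \<in> N \<Longrightarrow> F_op q x (v x) (g x) (H x) < 0"
    and x: "x \<in> T"
  shows "v x \<le> u x"
proof -
  have "C2_with \<Omega> (\<lambda>x. - v x) (\<lambda>x. - g x) (\<lambda>x. - H x)"
    using C2_with_combine[OF C2_with_zero v, of "-1"] by simp
  then have "- u x \<le> - v x"
    by (rule viscosity_comparison_above[OF viscosity_supersolution_minus[OF u] _ T(1) _ _ N _ q _ x])
      (use T bd F in \<open>auto simp: F_op_minus intro: continuous_on_minus\<close>)
  then show ?thesis by simp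
qed

text \<open>
  The expansion of the operator at a perturbed plane. The first term is the only one of order \<open>t\<close>; it
  sees the perturbation through its second derivative along \<open>e\<close> alone.
\<close>

lemma F_op_near_plane:
  assumes t: "t > 0"
  shows "F_op q x (t * l + \<psi> / t) (t *\<^sub>R e + (1 / t) *\<^sub>R p) ((1 / t) *\<^sub>R X)
    = t * (q x * l - X e \<bullet> e)
      - (1 / t) * (e \<bullet> X p + p \<bullet> X e + (1 / t\<^sup>2) * (p \<bullet> X p) - q x * \<psi>)"
proof -
  have "F_op q x (t * l + \<psi> / t) (t *\<^sub>R e + (1 / t) *\<^sub>R p) ((1 / t) *\<^sub>R X)
    = - ((t *\<^sub>R e + (1 / t) *\<^sub>R p) \<bullet> (X e + (1 / t\<^sup>2) *\<^sub>R X p)) + q x * (t * l + \<psi> / t)"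
    using t by (simp add: F_op_def blinfun.scaleR_left blinfun.add_right blinfun.scaleR_right
        scaleR_add_right power2_eq_square)
  also have "\<dots> = - (t * (e \<bullet> X e) + (1 / t) * (e \<bullet> X p) + (1 / t) * (p \<bullet> X e)
      + (1 / t) * ((1 / t\<^sup>2) * (p \<bullet> X p))) + q x * (t * l + \<psi> / t)"
    using t by (simp add: inner_add_left inner_add_right power2_eq_square add_divide_distrib)
  finally show ?thesis by (simp add: algebra_simps inner_commute[of "X e" e])
qed

lemma near_plane_remainder_bound:
  fixes X :: "'a::euclidean_space \<Rightarrow>\<^sub>L 'a"
  assumes "norm e = 1" "norm p \<le> m" "norm X \<le> m" "\<bar>\<psi>\<bar> \<le> m" "0 \<le> r" "r \<le> Q" "t \<ge> 1"
  shows "\<bar>e \<bullet> X p + p \<bullet> X e + (1 / t\<^sup>2) * (p \<bullet> X p) - r * \<psi>\<bar> \<le> 2 * m\<^sup>2 + m^3 + Q * m"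
proof -
  have m: "m \<ge> 0" using assms(2) norm_ge_zero order_trans by blast
  have Xp: "norm (X p) \<le> m * m"
    using norm_blinfun[of X p] mult_mono[OF assms(3,2) m norm_ge_zero] by linarith
  have Xe: "norm (X e) \<le> m" using norm_blinfun[of X e] assms(1,3) by simp
  have 1: "\<bar>e \<bullet> X p\<bar> \<le> m\<^sup>2"
    using Cauchy_Schwarz_ineq2[of e "X p"] Xp assms(1) by (simp add: power2_eq_square)
  have 2: "\<bar>p \<bullet> X e\<bar> \<le> m\<^sup>2"
    using Cauchy_Schwarz_ineq2[of p "X e"] mult_mono[OF assms(2) Xe m norm_ge_zero]
    by (simp add: power2_eq_square)
  have 3: "\<bar>(1 / t\<^sup>2) * (p \<bullet> X p)\<bar> \<le> m^3"
  proof -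
    have "\<bar>p \<bullet> X p\<bar> \<le> m * (m * m)"
      using Cauchy_Schwarz_ineq2[of p "X p"] mult_mono[OF assms(2) Xp m norm_ge_zero] by linarith
    moreover have "1 / t\<^sup>2 \<le> 1" using assms(7) by simp
    ultimately have "(1 / t\<^sup>2) * \<bar>p \<bullet> X p\<bar> \<le> 1 * (m * (m * m))"
      by (intro mult_mono) auto
    then show ?thesis by (simp add: abs_mult power3_eq_cube)
  qed
  have 4: "\<bar>r * \<psi>\<bar> \<le> Q * m"
    using mult_mono[OF assms(6,4)] assms(5,6) by (simp add: abs_mult)
  show ?thesis using 1 2 3 4 by linarith
qed

context chord_domain
begin

lemma bounded_linear_P: "bounded_linear P"
  unfolding proj_perp_def
  by (intro bounded_linear_sub bounded_linear_ident bounded_linear_compose[OF bounded_linear_scaleR_left]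
      bounded_linear_inner_right)

definition transverse_hessian where "transverse_hessian = Blinfun (\<lambda>h. 2 *\<^sub>R P h)"

lemma transverse_hessian_apply: "blinfun_apply transverse_hessian h = 2 *\<^sub>R P h"
  unfolding transverse_hessian_def
  by (subst bounded_linear_Blinfun_apply)
    (auto intro: bounded_linear_compose[OF bounded_linear_scaleR_right bounded_linear_P])

text \<open>
  The squared distance to the chord over \<open>y\<close>, which keeps the barriers in order on the lateral sides
  of a tube. Its Hessian \<open>2 P\<close> annihilates \<open>e\<close>.
\<close>

lemma C2_with_transverse:
  assumes y: "e \<bullet> y = 0"
  shows "C2_with S (\<lambda>x. (P x - y) \<bullet> (P x - y)) (\<lambda>x. 2 *\<^sub>R (P x - y)) (\<lambda>x. transverse_hessian)"
  unfolding C2_with_def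
proof (intro conjI ballI continuous_on_const)
  fix x
  have P: "(P has_derivative P) (at x within S)"
    by (rule bounded_linear_imp_has_derivative[OF bounded_linear_P])
  have orth: "(P x - y) \<bullet> P h = (P x - y) \<bullet> h" for h
    using y e_P[of x] by (simp add: proj_perp_def[of e h] inner_diff_left inner_diff_right inner_commute)
  have "((\<lambda>x. (P x - y) \<bullet> (P x - y)) has_derivative
      (\<lambda>h. (P x - y) \<bullet> P h + P h \<bullet> (P x - y))) (at x within S)"
    using P by (auto intro!: derivative_eq_intros)
  then show "((\<lambda>x. (P x - y) \<bullet> (P x - y)) has_derivative (\<lambda>h. 2 *\<^sub>R (P x - y) \<bullet> h)) (at x within S)"
    by (rule has_derivative_eq_rhs) (simp add: fun_eq_iff orth inner_commute[of "P _" "P x - y"])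
  show "((\<lambda>x. 2 *\<^sub>R (P x - y)) has_derivative blinfun_apply transverse_hessian) (at x within S)"
    using P by (auto intro!: derivative_eq_intros simp: transverse_hessian_apply)
qed

definition \<zeta> where "\<zeta> x = (e \<bullet> x - lower x) * (upper x - e \<bullet> x)"

lemma C2_zeta: "C2_on cylinder \<zeta>"
  unfolding \<zeta>_def by (intro C2_on_mult C2_on_diff C2_on_lower C2_on_upper C2_on_inner)

lemma zeta_nonneg: "x \<in> cylinder \<Longrightarrow> x \<in> closure \<Omega> \<Longrightarrow> \<zeta> x \<ge> 0"
  using mem_closure_iff by (simp add: \<zeta>_def)

lemma zeta_Gamma: "x \<in> Gamma \<Omega> e \<Longrightarrow> \<zeta> x = 0"
  using mem_frontier_iff[of x] Gamma_eq by (auto simp: \<zeta>_def)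

lemma zeta_second_derivative:
  assumes x: "x \<in> \<Omega>" and H: "C2_with \<Omega> \<zeta> g H"
  shows "H x e \<bullet> e = - 2"
proof (rule second_derivative_along_line[OF open_dom x H, of 1])
  show "((\<lambda>s. \<zeta> (x + s *\<^sub>R e)) has_real_derivative upper x + lower x - 2 * (e \<bullet> x + s)) (at s)" for s
    by (auto simp: \<zeta>_def inner_add_right algebra_simps intro!: derivative_eq_intros)
  show "((\<lambda>s. upper x + lower x - 2 * (e \<bullet> x + s)) has_real_derivative - 2) (at 0)"
    by (auto intro!: derivative_eq_intros)
qed simp

end

locale large_data_family = chord_problem \<Omega> e q b
  for \<Omega> :: "'a::euclidean_space set" and e q b +
  fixes u :: "real \<Rightarrow> 'a \<Rightarrow> real"
  assumes q_pos: "\<And>x. x \<in> closure \<Omega> \<Longrightarrow> q x > 0"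
    and ell_pos: "\<And>x. x \<in> closure \<Omega> \<Longrightarrow> ell e b x > 0"
    and solution: "\<And>t. t > 0 \<Longrightarrow> dirichlet_solution \<Omega> q (\<lambda>x. t * ell e b x) (u t)"
    and boundary_differentiable:
      "\<And>t x. t > 0 \<Longrightarrow> x \<in> frontier \<Omega> \<Longrightarrow> \<exists>D. has_boundary_gradient \<Omega> (u t) x D"
begin

lemma compact_cl: "compact (closure \<Omega>)"
  using bounded_dom by (simp add: compact_closure)

lemma cl_minus_dom: "closure \<Omega> - \<Omega> = frontier \<Omega>"
  using open_dom by (simp add: frontier_def interior_open)

lemma C2_with_near_plane:
  assumes "C2_with S \<psi> p X"
  shows "C2_with S (\<lambda>x. t * ell e b x + \<psi> x / t) (\<lambda>x. t *\<^sub>R e + (1 / t) *\<^sub>R p x) (\<lambda>x. (1 / t) *\<^sub>R X x)"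
  using C2_with_combine[OF C2_with_combine[OF C2_with_zero C2_with_ell[of S e b], of t] assms, of "1 / t"]
  by simp

lemma u_facts:
  assumes "t > 0"
  shows "continuous_on (closure \<Omega>) (u t)" "viscosity_subsolution \<Omega> q (u t)"
    "viscosity_supersolution \<Omega> q (u t)" "\<And>x. x \<in> frontier \<Omega> \<Longrightarrow> u t x = t * ell e b x"
  using solution[OF assms] by (auto simp: dirichlet_solution_def)

lemma q_bounded: "\<exists>Q>0. \<forall>x\<in>closure \<Omega>. q x \<le> Q \<and> f x \<le> Q"
proof -
  have c: "continuous_on (closure \<Omega>) q" "continuous_on (closure \<Omega>) f"
    using C1_on_continuous[OF C2_on_imp_C1_on] C2_q C2_f by blast+
  have "bounded (q ` closure \<Omega>)" "bounded (f ` closure \<Omega>)"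
    using compact_cl by (intro compact_imp_bounded compact_continuous_image c; simp)+
  then obtain B1 B2 where "\<And>x. x \<in> closure \<Omega> \<Longrightarrow> \<bar>q x\<bar> \<le> B1" "\<And>x. x \<in> closure \<Omega> \<Longrightarrow> \<bar>f x\<bar> \<le> B2"
    unfolding bounded_iff by (metis image_eqI real_norm_def)
  then show ?thesis
    by (intro exI[of _ "max 1 (max B1 B2)"]) (fastforce simp: le_max_iff_disj)
qed

text \<open>
  A plane \<open>t \<ell>\<close> has vanishing infinity Laplacian, and \<open>q t \<ell> > 0\<close>, so it is a strict supersolution.
\<close>

lemma u_below_plane:
  assumes t: "t > 0" and x: "x \<in> closure \<Omega>"
  shows "u t x \<le> t * ell e b x"
proof (rule viscosity_comparison_above[OF u_facts(2)[OF t] _ compact_cl u_facts(1)[OF t]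
      _ open_dom order_refl closure_subset _ _ _ x])
  show "C2_with \<Omega> (\<lambda>x. t * ell e b x) (\<lambda>x. t *\<^sub>R e) (\<lambda>x. 0)"
    using C2_with_near_plane[OF C2_with_zero, of \<Omega> t] by simp
  show "continuous_on (closure \<Omega>) (\<lambda>x. t * ell e b x)"
    unfolding ell_def by (intro continuous_intros)
  show "u t x \<le> t * ell e b x" if "x \<in> closure \<Omega> - \<Omega>" for x
    using that u_facts(4)[OF t] unfolding cl_minus_dom by simp
  fix x assume "x \<in> \<Omega>"
  then have "x \<in> closure \<Omega>" using closure_subset by blast
  then show "q x \<ge> 0" "F_op q x (t * ell e b x) (t *\<^sub>R e) 0 > 0"
    using q_pos ell_pos t by (auto simp: F_op_def less_imp_le)
qed

text \<open>
  The barrier is \<open>t \<ell> + (C / 2) ((e \<bullet> x)\<^sup>2 - R\<^sup>2) / t\<close>, convex along \<open>e\<close> and at most \<open>t \<ell>\<close> on the closure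
  of \<open>\<Omega>\<close>. Its infinity Laplacian is \<open>t C + O(1 / t)\<close>, which exceeds the zeroth order term
  \<open>t q \<ell> + O(1 / t)\<close> for large \<open>t\<close> as soon as \<open>C > sup q \<ell>\<close>.
\<close>

lemma u_above_plane:
  "\<exists>C\<ge>0. \<exists>t0\<ge>1. \<forall>t\<ge>t0. \<forall>x\<in>closure \<Omega>. u t x \<ge> t * ell e b x - C / t"
proof -
  obtain Q where Q: "Q > 0" "\<And>x. x \<in> closure \<Omega> \<Longrightarrow> q x \<le> Q \<and> f x \<le> Q" using q_bounded by blast
  obtain R where R: "\<And>x. x \<in> closure \<Omega> \<Longrightarrow> norm x \<le> R" "R \<ge> 0"
    using bounded_closure[OF bounded_dom] unfolding bounded_iff
    by (metis linorder_le_cases order_trans)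
  define C where "C = Q + 1"
  \<comment> \<open>\<open>I - P\<close> is the orthogonal projection onto the line of \<open>e\<close>, so \<open>X\<close> is \<open>C\<close> times \<open>e \<otimes> e\<close>.\<close>
  define X where "X = C *\<^sub>R (id_blinfun - (1 / 2) *\<^sub>R transverse_hessian)"
  have X: "blinfun_apply X h = (C * (e \<bullet> h)) *\<^sub>R e" for h
    by (simp add: X_def blinfun.scaleR_left blinfun.diff_left transverse_hessian_apply proj_perp_def)
  define \<psi> where "\<psi> x = C / 2 * ((e \<bullet> x)\<^sup>2 - R\<^sup>2)" for x
  define p where "p x = (C * (e \<bullet> x)) *\<^sub>R e" for x
  have \<psi>: "C2_with S \<psi> p (\<lambda>x. X)" for S
    unfolding C2_with_def \<psi>_def p_def
    by (auto intro!: derivative_eq_intros simp: X fun_eq_iff)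
  have ex: "\<bar>e \<bullet> x\<bar> \<le> R" if "x \<in> closure \<Omega>" for x
    using Cauchy_Schwarz_ineq2[of e x] R(1)[OF that] unit_e by simp
  have ex2: "(e \<bullet> x)\<^sup>2 \<le> R\<^sup>2" if "x \<in> closure \<Omega>" for x
    using ex[OF that] abs_le_square_iff[of "e \<bullet> x" R] R(2) by simp
  define m where "m = max (norm X) (max (C * R) (C / 2 * R\<^sup>2))"
  have m: "norm (p x) \<le> m" "norm X \<le> m" "\<bar>\<psi> x\<bar> \<le> m" if "x \<in> closure \<Omega>" for x
  proof -
    have C: "C \<ge> 0" using Q(1) by (simp add: C_def)
    have "norm (p x) \<le> C * R"
      using ex[OF that] C unit_e by (simp add: p_def abs_mult mult_left_mono)
    then show "norm (p x) \<le> m" by (simp add: m_def)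
    show "norm X \<le> m" by (simp add: m_def)
    have "\<bar>(e \<bullet> x)\<^sup>2 - R\<^sup>2\<bar> \<le> R\<^sup>2" using ex2[OF that] zero_le_power2[of "e \<bullet> x"] by linarith
    then have "\<bar>\<psi> x\<bar> \<le> C / 2 * R\<^sup>2" using C by (simp add: \<psi>_def abs_mult mult_left_mono)
    then show "\<bar>\<psi> x\<bar> \<le> m" by (simp add: m_def)
  qed
  define E where "E = 2 * m\<^sup>2 + m^3 + Q * m"
  define t0 where "t0 = max 1 (E + 1)"
  have "u t x \<ge> t * ell e b x - C / 2 * R\<^sup>2 / t" if t: "t0 \<le> t" and x: "x \<in> closure \<Omega>" for t x
  proof -
    have t1: "t \<ge> 1" "t > E" "t > 0" using t by (auto simp: t0_def)
    have "t * ell e b x + \<psi> x / t \<le> u t x"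
    proof (rule viscosity_comparison_below[OF u_facts(3)[OF t1(3)] C2_with_near_plane[OF \<psi>] compact_cl
          u_facts(1)[OF t1(3)] _ open_dom order_refl closure_subset _ _ _ x])
      show "continuous_on (closure \<Omega>) (\<lambda>x. t * ell e b x + \<psi> x / t)"
        unfolding ell_def \<psi>_def using t1 by (intro continuous_intros) auto
      show "t * ell e b x + \<psi> x / t \<le> u t x" if "x \<in> closure \<Omega> - \<Omega>" for x
      proof -
        have "\<psi> x \<le> 0" using ex2[of x] that Q(1) by (simp add: \<psi>_def C_def mult_le_0_iff)
        then have "\<psi> x / t \<le> 0" using t1(3) by (simp add: divide_nonpos_pos)
        then show ?thesis using that u_facts(4)[OF t1(3), of x] unfolding cl_minus_dom by simp
      qed
      fix x assume "x \<in> \<Omega>"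
      then have x: "x \<in> closure \<Omega>" using closure_subset by blast
      show qx: "q x \<ge> 0" using q_pos[OF x] by simp
      have "F_op q x (t * ell e b x + \<psi> x / t) (t *\<^sub>R e + (1 / t) *\<^sub>R p x) ((1 / t) *\<^sub>R X)
        = t * (f x - C) - (1 / t) * (e \<bullet> X (p x) + p x \<bullet> X e + (1 / t\<^sup>2) * (p x \<bullet> X (p x)) - q x * \<psi> x)"
        unfolding F_op_near_plane[OF t1(3)] by (simp add: X)
      also have "\<dots> \<le> t * (- 1) + (1 / t) * E"
      proof -
        have "\<bar>e \<bullet> X (p x) + p x \<bullet> X e + (1 / t\<^sup>2) * (p x \<bullet> X (p x)) - q x * \<psi> x\<bar> \<le> E"
          unfolding E_def using near_plane_remainder_bound[OF unit_e m[OF x] qx _ t1(1)] Q(2)[OF x] by blast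
        then have "(1 / t) * - (e \<bullet> X (p x) + p x \<bullet> X e + (1 / t\<^sup>2) * (p x \<bullet> X (p x)) - q x * \<psi> x) \<le> (1 / t) * E"
          using t1(3) by (intro mult_left_mono) auto
        moreover have "t * (f x - C) \<le> t * (- 1)"
          using Q(2)[OF x] t1(3) by (intro mult_left_mono) (auto simp: C_def)
        ultimately show ?thesis by (simp only: mult_minus_right)
      qed
      also have "\<dots> < 0"
      proof -
        have "E < t * t" using t1 mult_right_mono[OF t1(1), of t] by linarith
        then show ?thesis using t1(3) by (simp add: field_simps)
      qed
      finally show "F_op q x (t * ell e b x + \<psi> x / t) (t *\<^sub>R e + (1 / t) *\<^sub>R p x) ((1 / t) *\<^sub>R X) < 0" .
    qed
    moreover have "\<psi> x / t \<ge> - (C / 2 * R\<^sup>2) / t"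
      using Q(1) t1(3) by (intro divide_right_mono) (auto simp: \<psi>_def C_def algebra_simps)
    ultimately show ?thesis by simp
  qed
  moreover have "0 \<le> C / 2 * R\<^sup>2" "1 \<le> t0" using Q(1) by (simp_all add: C_def t0_def)
  ultimately show ?thesis by blast
qed

end

section \<open>Barriers in a tube and the normal derivative\<close>

context large_data_family
begin

lemma continuous_bounded_on_compact:
  fixes h :: "'a \<Rightarrow> 'b::real_normed_vector"
  assumes "continuous_on closed_tube h" "compact S" "S \<subseteq> closed_tube"
  shows "\<exists>M\<ge>0. \<forall>x\<in>S. norm (h x) \<le> M"
proof -
  have "bounded (h ` S)"
    using assms by (intro compact_imp_bounded compact_continuous_image) (auto intro: continuous_on_subset)
  then obtain M where "\<And>x. x \<in> S \<Longrightarrow> norm (h x) \<le> M" unfolding bounded_iff by blast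
  then show ?thesis by (intro exI[of _ "max 0 M"]) (auto simp: le_max_iff_disj)
qed

lemma C2_zeta_closed_tube: "C2_on closed_tube \<zeta>"
  by (rule C2_on_subset[OF C2_zeta]) (simp add: closed_tube_def)

text \<open>
  The projection of \<open>K\<close> is a compact subset of the open cylinder. So tubes of one radius \<open>r\<close> around all
  chords through points of \<open>K\<close> stay in one compact set, on which the \<open>C\<^sup>2\<close> norms of \<open>w\<close> and \<open>\<zeta>\<close> are
  bounded; this makes the constants below uniform in \<open>K\<close>.
\<close>

lemma uniform_tube:
  assumes K: "compact K" "K \<subseteq> Gamma \<Omega> e" "K \<noteq> {}"
  shows "\<exists>r>0. \<exists>S. compact S \<and> S \<subseteq> closed_tube \<and>
    (\<forall>x0\<in>K. \<forall>x\<in>closure \<Omega>. norm (P x - P x0) \<le> r \<longrightarrow> x \<in> S)"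
proof -
  have PK: "compact (P ` K)" "P ` K \<noteq> {}" "P ` K \<subseteq> cylinder"
    using K Gamma_eq by (auto simp: cylinder_def intro: compact_continuous_image continuous_on_proj_perp)
  obtain r where r: "r > 0" "(\<Union>y\<in>P ` K. cball y r) \<subseteq> cylinder"
    by (rule compact_subset_open_imp_cball_epsilon_subset[OF PK(1) open_cylinder PK(3)])
  define S where "S = closure \<Omega> \<inter> {x. infdist (P x) (P ` K) \<le> r}"
  have "closed {x. infdist (P x) (P ` K) \<le> r}"
    by (intro closed_Collect_le continuous_on_infdist continuous_on_proj_perp continuous_on_const)
  then have "compact S" unfolding S_def by (rule compact_Int_closed[OF compact_cl])
  moreover have "S \<subseteq> closed_tube"
  proof
    fix x assume x: "x \<in> S"
    obtain y where y: "y \<in> P ` K" "infdist (P x) (P ` K) = dist (P x) y"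
      using infdist_attains_inf[OF compact_imp_closed[OF PK(1)] PK(2)] by metis
    have "P x \<in> cball y r" using x y(2) by (simp add: S_def dist_commute)
    then have "P x \<in> cylinder" using r(2) y(1) by blast
    then show "x \<in> closed_tube" using x by (simp add: S_def closed_tube_def cylinder_def)
  qed
  moreover have "x \<in> S" if "x0 \<in> K" "x \<in> closure \<Omega>" "norm (P x - P x0) \<le> r" for x0 x
    using infdist_le2[of "P x0" "P ` K" "P x" r] that by (simp add: S_def dist_norm)
  ultimately show ?thesis using r(1) by blast
qed

text \<open>
  The barriers \<open>t \<ell> + (w + \<sigma> \<kappa> |P x - y|\<^sup>2 + \<sigma> A t\<^sup>-\<^sup>2 \<zeta>) / t\<close>, with \<open>\<sigma> = 1\<close> above and \<open>\<sigma> = -1\<close> below the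
  solution, on the tube of radius \<open>r\<close> around the chord over \<open>y\<close>. On the boundary of \<open>\<Omega>\<close> both \<open>w\<close> and
  \<open>\<zeta>\<close> vanish; on the lateral side \<open>\<kappa> r\<^sup>2\<close> outweighs \<open>w\<close> and the a priori bound \<open>C\<close>. Inside, \<open>w\<^sub>s\<^sub>s = q \<ell>\<close>
  cancels the term of order \<open>t\<close> of the operator, and \<open>\<zeta>\<^sub>s\<^sub>s = -2\<close> contributes \<open>2 \<sigma> A / t\<close>, which fixes the
  sign once \<open>A\<close> exceeds the bound \<open>E\<close> of the remaining terms. On the central chord the paraboloid
  vanishes.
\<close>

lemma chord_barriers:
  assumes K: "compact K" "K \<subseteq> Gamma \<Omega> e"
  shows "\<exists>A>0. \<exists>t0\<ge>1. \<forall>t\<ge>t0. \<forall>x0\<in>K. \<forall>x\<in>closure \<Omega>. P x = P x0 \<longrightarrow>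
    \<bar>u t x - t * ell e b x - w x / t\<bar> \<le> A / t ^ 3 * \<zeta> x"
proof (cases "K = {}")
  case True
  then show ?thesis by (intro exI[of _ 1]) auto
next
  case False
  obtain r S where r: "r > 0" and S: "compact S" "S \<subseteq> closed_tube"
    and near: "\<And>x0 x. x0 \<in> K \<Longrightarrow> x \<in> closure \<Omega> \<Longrightarrow> norm (P x - P x0) \<le> r \<Longrightarrow> x \<in> S"
    using uniform_tube[OF K False] by blast
  obtain C t1 where C: "C \<ge> 0" "t1 \<ge> 1"
    "\<And>t x. t \<ge> t1 \<Longrightarrow> x \<in> closure \<Omega> \<Longrightarrow> u t x \<ge> t * ell e b x - C / t"
    using u_above_plane by blast
  obtain Q where Q: "Q > 0" "\<And>x. x \<in> closure \<Omega> \<Longrightarrow> q x \<le> Q \<and> f x \<le> Q" using q_bounded by blast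
  obtain gw Hw where w: "C2_with closed_tube w gw Hw" using C2_w unfolding C2_on_def by blast
  obtain gz Hz where z: "C2_with closed_tube \<zeta> gz Hz"
    using C2_zeta_closed_tube unfolding C2_on_def by blast
  note cw = C2_with_continuous[OF w] and cz = C2_with_continuous[OF z]
  obtain B1 where B1: "B1 \<ge> 0" "\<And>x. x \<in> S \<Longrightarrow> norm (w x) \<le> B1"
    using continuous_bounded_on_compact[OF cw(1) S] by blast
  obtain B2 where B2: "B2 \<ge> 0" "\<And>x. x \<in> S \<Longrightarrow> norm (gw x) \<le> B2"
    using continuous_bounded_on_compact[OF cw(2) S] by blast
  obtain B3 where B3: "B3 \<ge> 0" "\<And>x. x \<in> S \<Longrightarrow> norm (Hw x) \<le> B3"
    using continuous_bounded_on_compact[OF cw(3) S] by blast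
  obtain B4 where B4: "B4 \<ge> 0" "\<And>x. x \<in> S \<Longrightarrow> norm (\<zeta> x) \<le> B4"
    using continuous_bounded_on_compact[OF cz(1) S] by blast
  obtain B5 where B5: "B5 \<ge> 0" "\<And>x. x \<in> S \<Longrightarrow> norm (gz x) \<le> B5"
    using continuous_bounded_on_compact[OF cz(2) S] by blast
  obtain B6 where B6: "B6 \<ge> 0" "\<And>x. x \<in> S \<Longrightarrow> norm (Hz x) \<le> B6"
    using continuous_bounded_on_compact[OF cz(3) S] by blast
  note B = B1 B2 B3 B4 B5 B6
  define T2 where "T2 = transverse_hessian"
  define Mw where "Mw = B1 + B2 + B3"
  define Mz where "Mz = B4 + B5 + B6"
  define \<kappa> where "\<kappa> = (C + Mw) / r\<^sup>2"
  \<comment> \<open>\<open>m\<close> bounds the perturbation with its first two derivatives. It must not depend on \<open>A\<close>, which is chosen after \<open>E\<close>; this is possible because \<open>t \<ge> t0\<close> forces \<open>A / t\<^sup>2 \<le> 1\<close>.\<close>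
  define m where "m = Mw + \<kappa> * (r\<^sup>2 + 2 * r + norm T2) + Mz"
  define E where "E = 2 * m\<^sup>2 + m^3 + Q * m"
  define A where "A = E + 1"
  define t0 where "t0 = max t1 A"
  have Mw: "Mw \<ge> 0" and Mz: "Mz \<ge> 0" using B by (simp_all add: Mw_def Mz_def)
  have \<kappa>: "\<kappa> \<ge> 0" "\<kappa> * r\<^sup>2 = C + Mw" using C(1) Mw r by (simp_all add: \<kappa>_def)
  have m: "m \<ge> 0" using Mw Mz \<kappa>(1) r by (simp add: m_def)
  have E: "E \<ge> 0" using m Q(1) by (simp add: E_def)
  have A: "A > 0" using E by (simp add: A_def)
  have "\<bar>u t x - t * ell e b x - w x / t\<bar> \<le> A / t ^ 3 * \<zeta> x"
    if t: "t \<ge> t0" and x0: "x0 \<in> K" and x: "x \<in> closure \<Omega>" "P x = P x0" for t x0 x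
  proof -
    have t': "t \<ge> t1" "t \<ge> 1" "t > 0" "t \<ge> A" using t C(2) by (auto simp: t0_def)
    have A1: "A / t\<^sup>2 \<le> 1" "A / t\<^sup>2 \<ge> 0"
    proof -
      have "A \<le> t * t" using t' mult_mono[of A t 1 t] A by linarith
      then show "A / t\<^sup>2 \<le> 1" using t'(3) by (simp add: power2_eq_square)
      show "A / t\<^sup>2 \<ge> 0" using A by simp
    qed
    define y where "y = P x0"
    have ey: "e \<bullet> y = 0" by (simp add: y_def)
    define \<eta> where "\<eta> x = (P x - y) \<bullet> (P x - y)" for x
    define T where "T = closure \<Omega> \<inter> {x. norm (P x - y) \<le> r}"
    define N where "N = \<Omega> \<inter> {x. norm (P x - y) < r}"
    have TS: "T \<subseteq> S" using near[OF x0] by (auto simp: T_def y_def)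
    have TD: "T \<subseteq> closed_tube" using TS S(2) by blast
    have NT: "N \<subseteq> T" "N \<subseteq> \<Omega>" using closure_subset by (auto simp: N_def T_def)
    have openN: "open N"
      unfolding N_def
      by (intro open_Int open_dom open_Collect_less continuous_intros continuous_on_proj_perp)
    have "closed {x. norm (P x - y) \<le> r}"
      by (intro closed_Collect_le continuous_intros continuous_on_proj_perp)
    then have compactT: "compact T" unfolding T_def by (rule compact_Int_closed[OF compact_cl])
    have contT: "continuous_on T (u t)"
      by (rule continuous_on_subset[OF u_facts(1)[OF t'(3)]]) (simp add: T_def)
    have \<eta>: "0 \<le> \<eta> z" "\<eta> z \<le> r\<^sup>2" "norm (2 *\<^sub>R (P z - y)) \<le> 2 * r" if "z \<in> T" for z
    proof -
      have "norm (P z - y) \<le> r" using that by (simp add: T_def)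
      then show "0 \<le> \<eta> z" "\<eta> z \<le> r\<^sup>2" "norm (2 *\<^sub>R (P z - y)) \<le> 2 * r"
        by (simp_all add: \<eta>_def power2_norm_eq_inner[symmetric] power_mono)
    qed
    have bd: "(z \<in> Gamma \<Omega> e \<and> w z = 0 \<and> \<zeta> z = 0) \<or> \<eta> z = r\<^sup>2" if "z \<in> T - N" for z
    proof (cases "z \<in> \<Omega>")
      case True
      then have "norm (P z - y) = r" using that by (auto simp: T_def N_def)
      then show ?thesis by (simp add: \<eta>_def power2_norm_eq_inner[symmetric])
    next
      case False
      then have "z \<in> Gamma \<Omega> e"
        using that TD cl_minus_dom by (auto simp: Gamma_eq T_def closed_tube_def)
      then show ?thesis using w_Gamma zeta_Gamma by simp
    qed
    define \<psi> where "\<psi> \<sigma> z = w z + (\<sigma> * \<kappa>) * \<eta> z + (\<sigma> * (A / t\<^sup>2)) * \<zeta> z" for \<sigma> z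
    define p where "p \<sigma> z = gw z + (\<sigma> * \<kappa>) *\<^sub>R (2 *\<^sub>R (P z - y)) + (\<sigma> * (A / t\<^sup>2)) *\<^sub>R gz z" for \<sigma> z
    define X where "X \<sigma> z = Hw z + (\<sigma> * \<kappa>) *\<^sub>R T2 + (\<sigma> * (A / t\<^sup>2)) *\<^sub>R Hz z" for \<sigma> z
    have \<psi>: "C2_with closed_tube (\<psi> \<sigma>) (p \<sigma>) (X \<sigma>)" for \<sigma>
      unfolding \<psi>_def p_def X_def \<eta>_def T2_def
      by (intro C2_with_combine w z C2_with_transverse ey)
    note \<psi>\<Omega> = C2_with_subset[OF \<psi> dom_subset_closed_tube]
    have contV: "continuous_on T (\<lambda>z. t * ell e b z + \<psi> \<sigma> z / t)" for \<sigma>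
      by (rule continuous_on_subset[OF C2_with_continuous(1)[OF C2_with_near_plane[OF \<psi>]] TD])
    have size: "norm (p \<sigma> z) \<le> m" "norm (X \<sigma> z) \<le> m" "\<bar>\<psi> \<sigma> z\<bar> \<le> m"
      if \<sigma>: "\<bar>\<sigma>\<bar> = 1" and z: "z \<in> T" for \<sigma> z
    proof -
      have zS: "z \<in> S" using z TS by blast
      have tri: "norm (v1 + (\<sigma> * \<kappa>) *\<^sub>R v2 + (\<sigma> * (A / t\<^sup>2)) *\<^sub>R v3) \<le> m"
        if "norm v1 \<le> Mw" "norm v2 \<le> r\<^sup>2 + 2 * r + norm T2" "norm v3 \<le> Mz"
        for v1 v2 v3 :: "'b::real_normed_vector"
      proof -
        have "norm (v1 + (\<sigma> * \<kappa>) *\<^sub>R v2 + (\<sigma> * (A / t\<^sup>2)) *\<^sub>R v3)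
          \<le> norm v1 + norm ((\<sigma> * \<kappa>) *\<^sub>R v2) + norm ((\<sigma> * (A / t\<^sup>2)) *\<^sub>R v3)"
          by (intro order_trans[OF norm_triangle_ineq] add_right_mono norm_triangle_ineq)
        also have "\<dots> = norm v1 + \<kappa> * norm v2 + (A / t\<^sup>2) * norm v3"
          using \<sigma> \<kappa>(1) A by (simp add: abs_mult)
        also have "\<dots> \<le> Mw + \<kappa> * (r\<^sup>2 + 2 * r + norm T2) + 1 * Mz"
          using that \<kappa>(1) A1 by (intro add_mono mult_mono) auto
        finally show ?thesis by (simp add: m_def)
      qed
      have wb: "norm (w z) \<le> Mw" "norm (gw z) \<le> Mw" "norm (Hw z) \<le> Mw"
        using B1 B2 B3 zS by (auto simp: Mw_def add_increasing add_increasing2)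
      have zb: "norm (\<zeta> z) \<le> Mz" "norm (gz z) \<le> Mz" "norm (Hz z) \<le> Mz"
        using B4(1) B4(2)[OF zS] B5(1) B5(2)[OF zS] B6(1) B6(2)[OF zS] by (simp_all add: Mz_def)
      have r0: "r\<^sup>2 \<ge> 0" "norm T2 \<ge> 0" by simp_all
      have \<eta>b: "norm (\<eta> z) \<le> r\<^sup>2 + 2 * r + norm T2"
        "norm (2 *\<^sub>R (P z - y)) \<le> r\<^sup>2 + 2 * r + norm T2" "norm T2 \<le> r\<^sup>2 + 2 * r + norm T2"
        using \<eta>[OF z] r r0 unfolding real_norm_def by linarith+
      show "norm (p \<sigma> z) \<le> m" unfolding p_def by (rule tri[OF wb(2) \<eta>b(2) zb(2)])
      show "norm (X \<sigma> z) \<le> m" unfolding X_def by (rule tri[OF wb(3) \<eta>b(3) zb(3)])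
      have "norm (w z + (\<sigma> * \<kappa>) *\<^sub>R \<eta> z + (\<sigma> * (A / t\<^sup>2)) *\<^sub>R \<zeta> z) \<le> m"
        by (rule tri[OF wb(1) \<eta>b(1) zb(1)])
      then show "\<bar>\<psi> \<sigma> z\<bar> \<le> m" by (simp add: \<psi>_def)
    qed
    have F: "\<bar>t * F_op q z (t * ell e b z + \<psi> \<sigma> z / t) (t *\<^sub>R e + (1 / t) *\<^sub>R p \<sigma> z) ((1 / t) *\<^sub>R X \<sigma> z)
        - 2 * \<sigma> * A\<bar> \<le> E" if \<sigma>: "\<bar>\<sigma>\<bar> = 1" and z: "z \<in> N" for \<sigma> z
    proof -
      have zT: "z \<in> T" and z\<Omega>: "z \<in> \<Omega>" using z NT by auto
      have zcl: "z \<in> closure \<Omega>" using zT by (simp add: T_def)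
      have "X \<sigma> z e \<bullet> e = f z - 2 * \<sigma> * (A / t\<^sup>2)"
        using w_second_derivative[OF z\<Omega> C2_with_subset[OF w dom_subset_closed_tube]]
          zeta_second_derivative[OF z\<Omega> C2_with_subset[OF \<open>C2_with closed_tube \<zeta> gz Hz\<close> dom_subset_closed_tube]]
        by (simp add: X_def T2_def blinfun.add_left blinfun.scaleR_left transverse_hessian_apply
            inner_add_left)
      moreover define R where "R = e \<bullet> X \<sigma> z (p \<sigma> z) + p \<sigma> z \<bullet> X \<sigma> z e
          + (1 / t\<^sup>2) * (p \<sigma> z \<bullet> X \<sigma> z (p \<sigma> z)) - q z * \<psi> \<sigma> z"
      ultimately have "F_op q z (t * ell e b z + \<psi> \<sigma> z / t) (t *\<^sub>R e + (1 / t) *\<^sub>R p \<sigma> z) ((1 / t) *\<^sub>R X \<sigma> z)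
        = t * (2 * \<sigma> * (A / t\<^sup>2)) - (1 / t) * R"
        unfolding F_op_near_plane[OF t'(3)] R_def by simp
      also have "t * \<dots> = 2 * \<sigma> * A - R"
        using t'(3) by (simp add: power2_eq_square right_diff_distrib)
      finally have "t * F_op q z (t * ell e b z + \<psi> \<sigma> z / t) (t *\<^sub>R e + (1 / t) *\<^sub>R p \<sigma> z) ((1 / t) *\<^sub>R X \<sigma> z)
        = 2 * \<sigma> * A - R" .
      moreover have "\<bar>R\<bar> \<le> E"
        unfolding E_def R_def
        by (rule near_plane_remainder_bound[OF unit_e size(1)[OF \<sigma> zT] size(2)[OF \<sigma> zT] size(3)[OF \<sigma> zT]
              _ _ t'(2)])
          (use q_pos[OF zcl] Q(2)[OF zcl] in auto)
      ultimately show ?thesis by simp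
    qed
    have qN: "q z \<ge> 0" if "z \<in> N" for z
    proof -
      have "z \<in> closure \<Omega>" using that NT closure_subset by blast
      then show ?thesis using q_pos less_imp_le by blast
    qed
    have xT: "x \<in> T" using x r by (simp add: T_def y_def)
    have \<zeta>pos: "(A / t\<^sup>2) * \<zeta> z \<ge> 0" if "z \<in> T" for z
      using zeta_nonneg[of z] that TD A1(2) by (intro mult_nonneg_nonneg) (auto simp: closed_tube_def)
    have \<psi>_side: "\<psi> \<sigma> z = w z + \<sigma> * (C + Mw) + \<sigma> * ((A / t\<^sup>2) * \<zeta> z)" if "\<eta> z = r\<^sup>2" for z \<sigma>
      by (simp only: \<psi>_def that mult.assoc \<kappa>(2))
    have wT: "\<bar>w z\<bar> \<le> Mw" if "z \<in> T" for z using B(2)[of z] B(3,5) TS that by (force simp: Mw_def)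
    have upper: "u t x \<le> t * ell e b x + \<psi> 1 x / t"
    proof (rule viscosity_comparison_above[OF u_facts(2)[OF t'(3)] C2_with_near_plane[OF \<psi>\<Omega>]
          compactT contT contV openN NT(2,1) _ qN _ xT])
      fix z assume z: "z \<in> T - N"
      then have zT: "z \<in> T" "z \<in> closure \<Omega>" by (auto simp: T_def)
      have "\<psi> 1 z \<ge> 0"
      proof (cases "z \<in> Gamma \<Omega> e")
        case True
        then show ?thesis using w_Gamma zeta_Gamma \<kappa>(1) \<eta>(1)[OF zT(1)] by (simp add: \<psi>_def)
      next
        case False
        then have "\<eta> z = r\<^sup>2" using bd[OF z] by blast
        from \<psi>_side[OF this, of 1, unfolded mult_1] show ?thesis
          using \<zeta>pos[OF zT(1)] wT[OF zT(1)] C(1) by linarith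
      qed
      then have "\<psi> 1 z / t \<ge> 0" using t'(3) by simp
      then show "u t z \<le> t * ell e b z + \<psi> 1 z / t"
        using u_below_plane[OF t'(3) zT(2)] by linarith
    next
      fix z assume "z \<in> N"
      from F[of 1, OF _ this] have "t * F_op q z (t * ell e b z + \<psi> 1 z / t)
          (t *\<^sub>R e + (1 / t) *\<^sub>R p 1 z) ((1 / t) *\<^sub>R X 1 z) > 0"
        using E by (simp add: A_def abs_le_iff)
      then show "F_op q z (t * ell e b z + \<psi> 1 z / t)
          (t *\<^sub>R e + (1 / t) *\<^sub>R p 1 z) ((1 / t) *\<^sub>R X 1 z) > 0"
        using t'(3) by (simp add: zero_less_mult_iff)
    qed
    have lower: "t * ell e b x + \<psi> (- 1) x / t \<le> u t x"
    proof (rule viscosity_comparison_below[OF u_facts(3)[OF t'(3)] C2_with_near_plane[OF \<psi>\<Omega>]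
          compactT contT contV openN NT(2,1) _ qN _ xT])
      fix z assume z: "z \<in> T - N"
      then have zT: "z \<in> T" "z \<in> closure \<Omega>" by (auto simp: T_def)
      show "t * ell e b z + \<psi> (- 1) z / t \<le> u t z"
      proof (cases "z \<in> Gamma \<Omega> e")
        case True
        then have "\<psi> (- 1) z \<le> 0" using w_Gamma zeta_Gamma \<kappa>(1) \<eta>(1)[OF zT(1)] by (simp add: \<psi>_def)
        then have "\<psi> (- 1) z / t \<le> 0" using t'(3) by (simp add: divide_nonpos_pos)
        then show ?thesis using u_facts(4)[OF t'(3), of z] True Gamma_eq by auto
      next
        case False
        then have "\<eta> z = r\<^sup>2" using bd[OF z] by blast
        from \<psi>_side[OF this, of "- 1", unfolded mult_minus1] have "\<psi> (- 1) z \<le> - C"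
          using \<zeta>pos[OF zT(1)] wT[OF zT(1)] by linarith
        then have "\<psi> (- 1) z / t \<le> - C / t" using t'(3) by (intro divide_right_mono) auto
        then show ?thesis using C(3)[OF t'(1) zT(2)] by simp
      qed
    next
      fix z assume "z \<in> N"
      from F[of "- 1", OF _ this] have "t * F_op q z (t * ell e b z + \<psi> (- 1) z / t)
          (t *\<^sub>R e + (1 / t) *\<^sub>R p (- 1) z) ((1 / t) *\<^sub>R X (- 1) z) < 0"
        using E by (simp add: A_def abs_le_iff)
      then show "F_op q z (t * ell e b z + \<psi> (- 1) z / t)
          (t *\<^sub>R e + (1 / t) *\<^sub>R p (- 1) z) ((1 / t) *\<^sub>R X (- 1) z) < 0"
        using t'(3) by (simp add: mult_less_0_iff)
    qed
    have "\<psi> \<sigma> x / t = w x / t + \<sigma> * (A / t ^ 3 * \<zeta> x)" for \<sigma>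
      using x(2) by (simp add: \<psi>_def \<eta>_def y_def add_divide_distrib power2_eq_square power3_eq_cube)
    then show ?thesis using upper lower by (simp add: abs_le_iff)
  qed
  moreover have "t0 \<ge> 1" using C(2) by (simp add: t0_def)
  ultimately show ?thesis using A by blast
qed

lemma boundary_gradient_from_closed_tube:
  assumes x: "x \<in> Gamma \<Omega> e" and h: "(h has_derivative (\<lambda>v. g \<bullet> v)) (at x within closed_tube)"
  shows "has_boundary_gradient \<Omega> h x g"
proof -
  have "at x within closed_tube = at x within closure \<Omega>"
    by (rule at_within_nhd[of x cylinder]) (use x Gamma_eq open_cylinder in \<open>auto simp: closed_tube_def\<close>)
  then show ?thesis using h by (simp add: has_boundary_gradient_def)
qed

text \<open>
  Write the gradients of \<open>u - t \<ell>\<close>, \<open>w\<close> and \<open>\<zeta>\<close> at \<open>x\<close> as \<open>\<delta> \<nu>\<close>, \<open>\<mu> \<nu>\<close> and \<open>\<theta> \<nu>\<close>. All three functions vanish at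
  \<open>x\<close>, so the bounds of \<open>chord_barriers\<close> on the chord through \<open>x\<close> pass to the derivatives along it and give
  \<open>|\<delta> - \<mu> / t| \<le> A |\<theta>| / t\<^sup>3\<close>. The factor \<open>\<nu> \<bullet> e\<close> is common to all terms and cancels, so
  the constant does not depend on its size.
\<close>

lemma normal_derivative_expansion:
  assumes K: "compact K" "K \<subseteq> Gamma \<Omega> e"
  shows "\<exists>C>0. \<exists>t0\<ge>1. \<forall>t\<ge>t0. \<forall>x\<in>K.
    \<bar>normal_derivative \<Omega> (u t) x - t * (e \<bullet> \<nu> x) - normal_derivative \<Omega> w x / t\<bar> \<le> C / t ^ 3"
proof -
  obtain A t0 where A: "A > 0" "t0 \<ge> 1" and barrier: "\<And>t x0 x. t \<ge> t0 \<Longrightarrow> x0 \<in> K \<Longrightarrow>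
      x \<in> closure \<Omega> \<Longrightarrow> P x = P x0 \<Longrightarrow> \<bar>u t x - t * ell e b x - w x / t\<bar> \<le> A / t ^ 3 * \<zeta> x"
    using chord_barriers[OF K] by blast
  obtain gw Hw where w: "C2_with closed_tube w gw Hw" using C2_w unfolding C2_on_def by blast
  obtain gz Hz where z: "C2_with closed_tube \<zeta> gz Hz"
    using C2_zeta_closed_tube unfolding C2_on_def by blast
  have KD: "K \<subseteq> closed_tube" using K(2) Gamma_subset_closed_tube by blast
  obtain M where M: "M \<ge> 0" "\<And>x. x \<in> K \<Longrightarrow> norm (gz x) \<le> M"
    using continuous_bounded_on_compact[OF C2_with_continuous(2)[OF z] K(1) KD] by blast
  have "\<bar>normal_derivative \<Omega> (u t) x - t * (e \<bullet> \<nu> x) - normal_derivative \<Omega> w x / t\<bar> \<le> (A * M + 1) / t ^ 3"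
    if t: "t \<ge> t0" and x: "x \<in> K" for t x
  proof -
    have t': "t > 0" using t A(2) by simp
    have x\<Gamma>: "x \<in> Gamma \<Omega> e" and xF: "x \<in> frontier \<Omega>" using x K(2) Gamma_eq by auto
    have \<nu>1: "\<nu> x \<bullet> \<nu> x = 1" using normal_facts(1)[OF xF] by (simp add: norm_eq_1)
    have bw: "has_boundary_gradient \<Omega> w x (gw x)" and bz: "has_boundary_gradient \<Omega> \<zeta> x (gz x)"
      using w z KD x by (auto intro!: boundary_gradient_from_closed_tube[OF x\<Gamma>] simp: C2_with_def)
    obtain Du where Du: "has_boundary_gradient \<Omega> (u t) x Du"
      using boundary_differentiable[OF t' xF] by blast
    define D' where "D' = Du - t *\<^sub>R e"
    define \<phi> where "\<phi> z = u t z - t * ell e b z" for z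
    have b\<phi>: "(\<phi> has_derivative (\<lambda>h. D' \<bullet> h)) (at x within closure \<Omega>)"
      unfolding \<phi>_def ell_def D'_def using Du unfolding has_boundary_gradient_def
      by (auto intro!: derivative_eq_intros simp: inner_diff_left)
    obtain \<delta> \<mu> \<theta> where normal: "D' = \<delta> *\<^sub>R \<nu> x" "gw x = \<mu> *\<^sub>R \<nu> x" "gz x = \<theta> *\<^sub>R \<nu> x"
    proof (rule that)
      show "D' = ((D' \<bullet> e) / (\<nu> x \<bullet> e)) *\<^sub>R \<nu> x"
        by (rule gradient_normal[OF x\<Gamma> b\<phi>]) (use u_facts(4)[OF t'] Gamma_eq in \<open>auto simp: \<phi>_def\<close>)
      show "gw x = ((gw x \<bullet> e) / (\<nu> x \<bullet> e)) *\<^sub>R \<nu> x"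
        by (rule gradient_normal[OF x\<Gamma> bw[unfolded has_boundary_gradient_def] w_Gamma])
      show "gz x = ((gz x \<bullet> e) / (\<nu> x \<bullet> e)) *\<^sub>R \<nu> x"
        by (rule gradient_normal[OF x\<Gamma> bz[unfolded has_boundary_gradient_def] zeta_Gamma])
    qed
    \<comment> \<open>the direction of the chord that points into the domain\<close>
    define d where "d = - sgn (\<nu> x \<bullet> e) *\<^sub>R e"
    have \<nu>d: "\<nu> x \<bullet> d < 0"
    proof -
      have "\<nu> x \<bullet> e \<noteq> 0" using x\<Gamma> by (simp add: Gamma_def inner_commute)
      then show ?thesis by (simp add: d_def sgn_if)
    qed
    obtain d0 where d0: "d0 > 0" "\<And>h. 0 < h \<Longrightarrow> h < d0 \<Longrightarrow> x + h *\<^sub>R d \<in> \<Omega>"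
      using normal_facts(3)[OF xF \<nu>d] by blast
    have chord: "x + h *\<^sub>R d \<in> closure \<Omega>"
      "\<bar>\<phi> (x + h *\<^sub>R d) - w (x + h *\<^sub>R d) / t\<bar> \<le> A / t ^ 3 * \<zeta> (x + h *\<^sub>R d)"
      if "0 < h" "h < d0" for h
    proof -
      show c: "x + h *\<^sub>R d \<in> closure \<Omega>" using d0(2)[OF that] closure_subset by blast
      have "P (x + h *\<^sub>R d) = P x" using P_line[of x "h * - sgn (\<nu> x \<bullet> e)"] by (simp add: d_def)
      from barrier[OF t x c this]
      show "\<bar>\<phi> (x + h *\<^sub>R d) - w (x + h *\<^sub>R d) / t\<bar> \<le> A / t ^ 3 * \<zeta> (x + h *\<^sub>R d)"
        by (simp add: \<phi>_def)
    qed
    have zero: "\<phi> x = 0" "w x = 0" "\<zeta> x = 0"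
      using u_facts(4)[OF t' xF] w_Gamma[OF x\<Gamma>] zeta_Gamma[OF x\<Gamma>] by (simp_all add: \<phi>_def)
    have one_sided: "(\<sigma> * (\<delta> - \<mu> / t) - A / t ^ 3 * \<theta>) * (\<nu> x \<bullet> d) \<le> 0" if \<sigma>: "\<sigma> = 1 \<or> \<sigma> = - 1" for \<sigma> :: real
    proof -
      let ?h = "\<lambda>z. \<sigma> * (\<phi> z - (1 / t) * w z) - (A / t ^ 3) * \<zeta> z"
      have "(?h has_derivative (\<lambda>v. \<sigma> * (D' \<bullet> v - (1 / t) * (gw x \<bullet> v)) - (A / t ^ 3) * (gz x \<bullet> v)))
          (at x within closure \<Omega>)"
        by (intro has_derivative_diff has_derivative_mult_right b\<phi>
            bw[unfolded has_boundary_gradient_def] bz[unfolded has_boundary_gradient_def])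
      then have "(?h has_derivative (\<lambda>v. ((\<sigma> * (\<delta> - \<mu> / t) - A / t ^ 3 * \<theta>) *\<^sub>R \<nu> x) \<bullet> v)) (at x within closure \<Omega>)"
        by (rule has_derivative_eq_rhs) (simp add: fun_eq_iff normal algebra_simps)
      then have "((\<sigma> * (\<delta> - \<mu> / t) - A / t ^ 3 * \<theta>) *\<^sub>R \<nu> x) \<bullet> d \<le> 0"
      proof (rule one_sided_derivative_nonpos[OF _ d0(1)], intro conjI)
        fix h assume h: "0 < h" "h < d0"
        show "x + h *\<^sub>R d \<in> closure \<Omega>" by (rule chord(1)[OF h])
        show "?h (x + h *\<^sub>R d) \<le> ?h x"
          using chord(2)[OF h] \<sigma> zero by (auto simp: abs_le_iff)
      qed
      then show ?thesis by simp
    qed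
    have "\<sigma> * (\<delta> - \<mu> / t) \<ge> A / t ^ 3 * \<theta>" if "\<sigma> = 1 \<or> \<sigma> = - 1" for \<sigma> :: real
      using one_sided[OF that] \<nu>d by (simp add: mult_le_0_iff)
    from this[of 1] this[of "- 1"] have "\<bar>\<delta> - \<mu> / t\<bar> \<le> - (A / t ^ 3 * \<theta>)" by simp
    also have "\<dots> \<le> A / t ^ 3 * \<bar>\<theta>\<bar>" using A(1) t' mult_left_mono[of "- \<theta>" "\<bar>\<theta>\<bar>" "A / t ^ 3"] by simp
    also have "\<dots> \<le> A / t ^ 3 * M"
    proof -
      have "\<bar>\<theta>\<bar> \<le> M" using M(2)[OF x] normal_facts(1)[OF xF] by (simp add: normal)
      then show ?thesis using A(1) t' by (intro mult_left_mono) auto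
    qed
    also have "\<dots> \<le> (A * M + 1) / t ^ 3" using t' by (simp add: divide_right_mono)
    finally have est: "\<bar>\<delta> - \<mu> / t\<bar> \<le> (A * M + 1) / t ^ 3" .
    have "Du = t *\<^sub>R e + \<delta> *\<^sub>R \<nu> x" using normal(1) by (simp add: D'_def algebra_simps)
    then have "normal_derivative \<Omega> (u t) x = t * (e \<bullet> \<nu> x) + \<delta>"
      using normal_derivative_eq[OF xF Du] \<nu>1 by (simp add: inner_add_left)
    moreover have "normal_derivative \<Omega> w x = \<mu>"
      using normal_derivative_eq[OF xF bw] \<nu>1 by (simp add: normal)
    ultimately show ?thesis using est by simp
  qed
  moreover have "A * M + 1 > 0" using A(1) M(1) by (simp add: add_nonneg_pos)
  ultimately show ?thesis using A(2) by blast
qed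

lemma Gamma_locally_compact:
  assumes "x \<in> Gamma \<Omega> e"
  shows "\<exists>r>0. closure \<Omega> \<inter> ball x r \<subseteq> closed_tube \<and> compact (frontier \<Omega> \<inter> cball x r)
    \<and> frontier \<Omega> \<inter> cball x r \<subseteq> Gamma \<Omega> e"
proof -
  obtain r where r: "r > 0" "cball x r \<subseteq> cylinder"
    using open_cylinder assms Gamma_eq open_contains_cball by (metis IntD2)
  have "ball x r \<subseteq> cylinder" using r(2) ball_subset_cball by blast
  moreover have "closed (frontier \<Omega>)" by simp
  then have "compact (frontier \<Omega> \<inter> cball x r)" by (simp add: closed_Int_compact)
  ultimately show ?thesis using r by (auto simp: closed_tube_def Gamma_eq)
qed

lemma chord_tube_subset_closed_tube: "closure B \<subseteq> Y_set \<Omega> e \<Longrightarrow> chord_tube \<Omega> e B \<subseteq> closed_tube"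
  using chord_in_closed_tube by (auto simp: chord_tube_def)

end

lemma C1_frontier_ell: "C1_frontier \<Omega> (\<lambda>x. t * ell e b x)"
proof -
  have "C1_on UNIV (\<lambda>x. t * ell e b x)"
    unfolding ell_def by (intro C1_on_mult C1_on_add C1_on_const C1_on_inner)
  then show ?thesis unfolding C1_frontier_def by blast
qed

theorem theorem1p1:
  fixes \<Omega> :: "'a::euclidean_space set" and q :: "'a \<Rightarrow> real" and c0 b :: real and e :: 'a
    and u :: "real \<Rightarrow> 'a \<Rightarrow> real" and \<Lambda> :: "('a \<Rightarrow> real) \<Rightarrow> 'a \<Rightarrow> real"
  assumes "DIM('a) \<ge> 2"
    and "open \<Omega>" and "convex \<Omega>" and "bounded \<Omega>" and "\<Omega> \<noteq> {}" and "C2_boundary \<Omega>"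
    and "C2_on (closure \<Omega>) q" and "c0 > 0" and "\<forall>x\<in>closure \<Omega>. q x \<ge> c0"
    and "b > (SUP x\<in>closure \<Omega>. norm x)"
    and "norm e = 1"
    and "dirichlet_to_neumann \<Omega> q \<Lambda>"
    and "\<forall>t>0. dirichlet_solution \<Omega> q (\<lambda>x. t * ell e b x) (u t)"
    and "\<forall>t>0. \<forall>x\<in>frontier \<Omega>. \<exists>D. has_boundary_gradient \<Omega> (u t) x D"
  shows "\<exists>H.
    \<comment> \<open>(1)\<close>
    (\<forall>x\<in>Gamma \<Omega> e.
      ((\<lambda>t. t * (\<Lambda> (\<lambda>z. t * ell e b z) x - t * (e \<bullet> outward_normal \<Omega> x))) \<longlongrightarrow> H x) at_top) \<and>
    (\<forall>x\<in>Gamma \<Omega> e. \<exists>r>0.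
      uniform_limit (Gamma \<Omega> e \<inter> ball x r)
        (\<lambda>t x. t * (\<Lambda> (\<lambda>z. t * ell e b z) x - t * (e \<bullet> outward_normal \<Omega> x))) H at_top) \<and>
    \<comment> \<open>(2)\<close>
    (\<forall>y\<in>Y_set \<Omega> e.
      chord_bvp \<Omega> q e b y (\<lambda>s. w_fun \<Omega> q e b (y + s *\<^sub>R e)) \<and>
      (\<forall>v. chord_bvp \<Omega> q e b y v \<longrightarrow>
        (\<forall>s\<in>{alpha \<Omega> e y..beta \<Omega> e y}. v s = w_fun \<Omega> q e b (y + s *\<^sub>R e)))) \<and>
    (\<forall>B. compact (closure B) \<and> closure B \<subseteq> Y_set \<Omega> e \<longrightarrow>
      C2_on (chord_tube \<Omega> e B) (w_fun \<Omega> q e b)) \<and>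
    (\<forall>x\<in>Gamma \<Omega> e. \<exists>r>0. C2_on (closure \<Omega> \<inter> ball x r) (w_fun \<Omega> q e b)) \<and>
    (\<forall>x\<in>Gamma \<Omega> e. H x = normal_derivative \<Omega> (w_fun \<Omega> q e b) x) \<and>
    \<comment> \<open>(3)\<close>
    (\<forall>K. compact K \<and> K \<subseteq> Gamma \<Omega> e \<longrightarrow>
      (\<exists>C>0. \<exists>tK>0. \<forall>t\<ge>tK. \<forall>x\<in>K.
        \<bar>\<Lambda> (\<lambda>z. t * ell e b z) x - t * (e \<bullet> outward_normal \<Omega> x)
          - normal_derivative \<Omega> (w_fun \<Omega> q e b) x / t\<bar> \<le> C / t ^ 3))"
proof -
  have q_pos: "q x > 0" if "x \<in> closure \<Omega>" for x
    using assms(8,9) that by force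
  have ell_pos: "ell e b x > 0" if x: "x \<in> closure \<Omega>" for x
  proof -
    have "bdd_above (norm ` closure \<Omega>)"
      using bounded_closure[OF assms(4)] by (simp add: bdd_above_norm)
    then have "norm x < b" using cSUP_upper[OF x, of norm] assms(10) by simp
    moreover have "\<bar>e \<bullet> x\<bar> \<le> norm x" using Cauchy_Schwarz_ineq2[of e x] assms(11) by simp
    ultimately show ?thesis by (simp add: ell_def)
  qed
  interpret large_data_family \<Omega> e q b u
    using assms q_pos ell_pos by unfold_locales auto
  have \<Lambda>: "\<Lambda> (\<lambda>z. t * ell e b z) x = normal_derivative \<Omega> (u t) x"
    if "t > 0" "x \<in> frontier \<Omega>" for t x
    using assms(12) C1_frontier_ell solution[OF that(1)] that(2)
    unfolding dirichlet_to_neumann_def by blast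
  let ?G = "\<lambda>t x. t * (\<Lambda> (\<lambda>z. t * ell e b z) x - t * (e \<bullet> \<nu> x))"
  let ?H = "\<lambda>x. normal_derivative \<Omega> w x"
  have expansion: "\<exists>C>0. \<exists>t0\<ge>1. \<forall>t\<ge>t0. \<forall>x\<in>K.
      \<bar>\<Lambda> (\<lambda>z. t * ell e b z) x - t * (e \<bullet> \<nu> x) - ?H x / t\<bar> \<le> C / t ^ 3"
    if K: "compact K" "K \<subseteq> Gamma \<Omega> e" for K
  proof -
    obtain C t0 where C: "C > 0" "t0 \<ge> 1" "\<And>t x. t \<ge> t0 \<Longrightarrow> x \<in> K \<Longrightarrow>
        \<bar>normal_derivative \<Omega> (u t) x - t * (e \<bullet> \<nu> x) - ?H x / t\<bar> \<le> C / t ^ 3"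
      using normal_derivative_expansion[OF K] by blast
    have "\<bar>\<Lambda> (\<lambda>z. t * ell e b z) x - t * (e \<bullet> \<nu> x) - ?H x / t\<bar> \<le> C / t ^ 3"
      if "t \<ge> t0" "x \<in> K" for t x
      using C(2) C(3)[OF that] \<Lambda>[of t x] that K(2) Gamma_eq by auto
    then show ?thesis using C by blast
  qed
  have unif: "uniform_limit K ?G ?H at_top" if K: "compact K" "K \<subseteq> Gamma \<Omega> e" for K
    unfolding uniform_limit_iff
  proof (intro allI impI)
    fix \<epsilon> :: real assume \<epsilon>: "\<epsilon> > 0"
    obtain C t0 where C: "C > 0" "t0 \<ge> 1" "\<And>t x. t \<ge> t0 \<Longrightarrow> x \<in> K \<Longrightarrow>
        \<bar>\<Lambda> (\<lambda>z. t * ell e b z) x - t * (e \<bullet> \<nu> x) - ?H x / t\<bar> \<le> C / t ^ 3"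
      using expansion[OF K] by blast
    have "dist (?G t x) (?H x) < \<epsilon>" if t: "t \<ge> max t0 (C / \<epsilon> + 1)" and x: "x \<in> K" for t x
    proof -
      have t': "t \<ge> t0" "t \<ge> 1" "t > 0" using t C(2) by auto
      have "?G t x - ?H x = t * (\<Lambda> (\<lambda>z. t * ell e b z) x - t * (e \<bullet> \<nu> x) - ?H x / t)"
        using t' by (simp add: algebra_simps)
      then have "\<bar>?G t x - ?H x\<bar> = t * \<bar>\<Lambda> (\<lambda>z. t * ell e b z) x - t * (e \<bullet> \<nu> x) - ?H x / t\<bar>"
        using t'(3) by (simp add: abs_mult)
      also have "\<dots> \<le> t * (C / t ^ 3)" using C(3)[OF t'(1) x] t'(3) by (intro mult_left_mono) auto
      also have "\<dots> = C / t / t" using t'(3) by (simp add: power3_eq_cube)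
      also have "\<dots> \<le> C / t" using t' C(1) by (simp add: divide_le_eq_1 pos_divide_le_eq)
      also have "\<dots> < \<epsilon>"
      proof -
        have "C / \<epsilon> < t" using t by simp
        then show ?thesis using \<epsilon> t'(3) by (simp add: field_simps)
      qed
      finally show ?thesis by (simp add: dist_real_def)
    qed
    then show "\<forall>\<^sub>F t in at_top. \<forall>x\<in>K. dist (?G t x) (?H x) < \<epsilon>"
      unfolding eventually_at_top_linorder by blast
  qed
  have loc_unif: "\<exists>r>0. uniform_limit (Gamma \<Omega> e \<inter> ball x r) ?G ?H at_top"
    if x: "x \<in> Gamma \<Omega> e" for x
  proof -
    obtain r where r: "r > 0" "compact (frontier \<Omega> \<inter> cball x r)" "frontier \<Omega> \<inter> cball x r \<subseteq> Gamma \<Omega> e"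
      using Gamma_locally_compact[OF x] by blast
    have "uniform_limit (Gamma \<Omega> e \<inter> ball x r) ?G ?H at_top"
      by (rule uniform_limit_on_subset[OF unif[OF r(2,3)]]) (auto simp: Gamma_eq)
    then show ?thesis using r(1) by blast
  qed
  have lim: "((\<lambda>t. ?G t x) \<longlongrightarrow> ?H x) at_top" if x: "x \<in> Gamma \<Omega> e" for x
  proof -
    obtain r where r: "r > 0" and lim: "uniform_limit (Gamma \<Omega> e \<inter> ball x r) ?G ?H at_top"
      using loc_unif[OF x] by blast
    show ?thesis by (rule tendsto_uniform_limitI[OF lim]) (use x r in simp)
  qed
  have bvp: "chord_bvp \<Omega> q e b y (\<lambda>s. w (y + s *\<^sub>R e)) \<and>
      (\<forall>v. chord_bvp \<Omega> q e b y v \<longrightarrow>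
        (\<forall>s\<in>{alpha \<Omega> e y..beta \<Omega> e y}. v s = w (y + s *\<^sub>R e)))" if y: "y \<in> Y_set \<Omega> e" for y
    using chord_bvp_w[OF y] chord_bvp_unique[OF y _ chord_bvp_w[OF y]] by blast
  have tube: "C2_on (chord_tube \<Omega> e B) w" if "closure B \<subseteq> Y_set \<Omega> e" for B
    using C2_on_subset[OF C2_w chord_tube_subset_closed_tube[OF that]] .
  have near: "\<exists>r>0. C2_on (closure \<Omega> \<inter> ball x r) w" if "x \<in> Gamma \<Omega> e" for x
    using Gamma_locally_compact[OF that] C2_on_subset[OF C2_w] by blast
  have est: "\<exists>C>0. \<exists>tK>0. \<forall>t\<ge>tK. \<forall>x\<in>K.
      \<bar>\<Lambda> (\<lambda>z. t * ell e b z) x - t * (e \<bullet> \<nu> x) - ?H x / t\<bar> \<le> C / t ^ 3"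
    if "compact K" "K \<subseteq> Gamma \<Omega> e" for K
    using expansion[OF that] by (meson less_le_trans zero_less_one)
  show ?thesis
    by (intro exI[of _ ?H] conjI ballI allI impI lim loc_unif near tube est refl)
      (use bvp in auto)
qed

end
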